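(* There exists a nontrivial countable torsion-free group admitting no non-discrete Hausdorff group topology.
   Context: A group topology on a group $G$ is a topology on the set $G$ for which multiplication $G\times G\to G$ and inversion $G\to G$ are continuous. *)

theory Defs
  imports "HOL-Analysis.Analysis" "HOL-Algebra.Group"
begin

definition group_topology :: "('a, 'b) monoid_scheme \<Rightarrow> 'a topology \<Rightarrow> bool" where
  "group_topology G T \<longleftrightarrow>
     topspace T = carrier G \<and>
     continuous_map (prod_topology T T) T (\<lambda>(x, y). x \<otimes>\<^bsub>G\<^esub> y) \<and>
     continuous_map T T (\<lambda>x. inv\<^bsub>G\<^esub> x)"

definition torsion_free :: "('a, 'b) monoid_scheme \<Rightarrow> bool" where
  "torsion_free G \<longleftrightarrow>
     (\<forall>x \<in> carrier G. \<forall>n::nat. n > 0 \<longrightarrow> x [^]\<^bsub>G\<^esub> n = \<one>\<^bsub>G\<^esub> \<longrightarrow> x = \<one>\<^bsub>G\<^esub>)"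

end

(* Conditions such as (q_a(k) q_b(k))^4 = u (q_c(k) q_d(k))^4 with u \<noteq> 1 fail at k = 1, so in a Hausdorff
   group topology their negations hold near 1. We build a countable torsion-free group K with
   automorphisms q_0 = id, q_1, ..., q_4 such that every k \<noteq> 1 in K satisfies one of these finitely many
   equations. In the semidirect product G of K and the free group F on q_1, ..., q_4 they become
   equations with coefficients in G, so K is discrete. There is e in K such that only x = 1 commutes with both e and q_1(e) in G,
   and the commutators with e and q_1(e) lie in K; by continuity they are trivial near 1, so G is
   discrete as well. That F contributes nothing to the centralizer of e is seen on an F-equivariant
   homomorphism from K to the functions from F to Z/2.

   K is the union of a chain of groups on which the q_i are partial isomorphisms. In one step a new
   copy of K is attached for each missing image; the equation for an element y outside the domain is
   enforced by amalgamating the group generated by the images under q_a and q_b with the one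
   generated by the images under q_c and q_d, along subgroups that are free over K on the words
   (q_a(y) q_b(y))^4 and u (q_c(y) q_d(y))^4 respectively. *)

theory Submission imports Defs "HOL-Library.Z2" "HOL-Library.Function_Algebras" begin

subsection \<open>Subgroups and homomorphisms\<close>

text \<open>Arbitrary groups are written additively: \<open>group_add\<close> does not include commutativity. Without the
  following declaration \<open>simp\<close> would turn conjugates \<open>x + h + - x\<close> into \<open>x + h - x\<close>.\<close>

declare add_uminus_conv_diff [simp del]

text \<open>Five maps are taken because, whichever index \<open>j\<close> the new elements are
  entered at, the other four split into two disjoint pairs, one for each side of the law. The
  exponent four leaves room for cancellation: each power is cut into two halves of four syllables,
  neighbouring powers interact only through adjacent halves, and at most two syllables of each half
  are lost before a third pair merges into a syllable that survives. This bound requires that the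
  domains of the partial maps be malnormal and that no two nonzero tuples have two coordinates
  interchanged, so both properties have to survive every step. Malnormality is the main obstacle,
  since the amalgamated subgroup is large, the free product of \<open>K\<close> and a free group; it
  is enough that those of its elements that are conjugate into a smaller factor are conjugate into
  \<open>K\<close> already inside it. The element \<open>u\<close> is \<open>e + e\<close>: nonzero
  because there is no torsion, yet zero under every homomorphism into a group of exponent two, so
  that the law does not destroy the map that detects the free group.\<close>

definition is_subgroup :: "'g::group_add set \<Rightarrow> bool" where
  "is_subgroup S \<longleftrightarrow> 0 \<in> S \<and> (\<forall>x\<in>S. \<forall>y\<in>S. x + y \<in> S) \<and> (\<forall>x\<in>S. - x \<in> S)"

definition additive_on :: "'g::group_add set \<Rightarrow> ('g \<Rightarrow> 'h::group_add) \<Rightarrow> bool" where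
  "additive_on S f \<longleftrightarrow> (\<forall>x\<in>S. \<forall>y\<in>S. f (x + y) = f x + f y)"

definition embeds :: "'g::group_add set \<Rightarrow> ('g \<Rightarrow> 'h::group_add) \<Rightarrow> bool" where
  "embeds S f \<longleftrightarrow> additive_on S f \<and> inj_on f S"

definition malnormal :: "'g::group_add set \<Rightarrow> 'g set \<Rightarrow> bool" where
  "malnormal H S \<longleftrightarrow> H \<subseteq> S \<and> (\<forall>x\<in>S. \<forall>h\<in>H. h \<noteq> 0 \<longrightarrow> x + h + - x \<in> H \<longrightarrow> x \<in> H)"

definition nmul :: "nat \<Rightarrow> 'g::group_add \<Rightarrow> 'g" where
  "nmul n x = sum_list (replicate n x)"

definition torsion_free_on :: "'g::group_add set \<Rightarrow> bool" where
  "torsion_free_on S \<longleftrightarrow> (\<forall>x\<in>S. \<forall>n>0. nmul n x = 0 \<longrightarrow> x = 0)"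

lemma subgroupD:
  assumes "is_subgroup S"
  shows subgroup_zero: "0 \<in> S" and subgroup_add: "x \<in> S \<Longrightarrow> y \<in> S \<Longrightarrow> x + y \<in> S"
    and subgroup_uminus: "x \<in> S \<Longrightarrow> - x \<in> S"
  using assms by (auto simp: is_subgroup_def)

lemma subgroup_uminus_iff: "is_subgroup S \<Longrightarrow> - x \<in> S \<longleftrightarrow> x \<in> S"
  using subgroup_uminus[of S x] subgroup_uminus[of S "- x"] by auto

lemma subgroup_add_left_iff: "is_subgroup S \<Longrightarrow> x \<in> S \<Longrightarrow> x + y \<in> S \<longleftrightarrow> y \<in> S"
  using subgroup_add[of S x y] subgroup_add[of S "- x" "x + y"] subgroup_uminus[of S x] by auto

lemma subgroup_add_right_iff: "is_subgroup S \<Longrightarrow> y \<in> S \<Longrightarrow> x + y \<in> S \<longleftrightarrow> x \<in> S"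
  using subgroup_add[of S x y] subgroup_add[of S "x + y" "- y"] subgroup_uminus[of S y]
  by (auto simp: add.assoc)

lemma subgroup_sum_list: "is_subgroup S \<Longrightarrow> set ws \<subseteq> S \<Longrightarrow> sum_list ws \<in> S"
  by (induction ws) (auto simp: subgroup_zero subgroup_add)

lemma subgroup_nmul: "is_subgroup S \<Longrightarrow> x \<in> S \<Longrightarrow> nmul n x \<in> S"
  unfolding nmul_def by (rule subgroup_sum_list) auto

lemma nmul_0 [simp]: "nmul 0 x = 0" and nmul_Suc: "nmul (Suc n) x = x + nmul n x"
  by (simp_all add: nmul_def)

lemma nmul_zero [simp]: "nmul n 0 = 0"
  by (induction n) (simp_all add: nmul_Suc)

lemma subgroup_UNIV: "is_subgroup UNIV"
  by (simp add: is_subgroup_def)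

lemma torsion_free_int: "torsion_free_on (UNIV :: int set)"
proof -
  have "nmul n x = int n * x" for n and x :: int
    by (induction n) (simp_all add: nmul_Suc algebra_simps)
  then show ?thesis by (simp add: torsion_free_on_def)
qed

lemma nmul_conj: "nmul n (y + x + - y) = y + nmul n x + - y"
  by (induction n) (simp_all add: nmul_Suc add.assoc)

lemma nmul_sum_list: "nmul n (sum_list ws) = sum_list (concat (replicate n ws))"
  by (induction n) (simp_all add: nmul_Suc)

lemma sum_list_rev_uminus: "sum_list (map uminus (rev ws)) = - sum_list (ws :: 'g::group_add list)"
  by (induction ws) (simp_all add: minus_add)

lemma additive_on_zero:
  assumes "is_subgroup S" "additive_on S f"
  shows "f 0 = 0"
proof -
  have "f (0 + 0) = f 0 + f 0" using assms subgroup_zero unfolding additive_on_def by blast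
  then have "- f 0 + (f 0 + f 0) = - f 0 + f 0" by simp
  then show ?thesis by simp
qed

lemma additive_on_add: "additive_on S f \<Longrightarrow> x \<in> S \<Longrightarrow> y \<in> S \<Longrightarrow> f (x + y) = f x + f y"
  by (simp add: additive_on_def)

lemma additive_on_uminus: "is_subgroup S \<Longrightarrow> additive_on S f \<Longrightarrow> x \<in> S \<Longrightarrow> f (- x) = - f x"
  using additive_on_add[of S f "-x" x] additive_on_zero[of S f] subgroup_uminus[of S x]
  by (simp add: eq_neg_iff_add_eq_0)

lemma additive_on_sum_list:
  "is_subgroup S \<Longrightarrow> additive_on S f \<Longrightarrow> set ws \<subseteq> S \<Longrightarrow> f (sum_list ws) = sum_list (map f ws)"
  by (induction ws) (auto simp: additive_on_zero additive_on_add subgroup_sum_list)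

lemma additive_on_nmul:
  "is_subgroup S \<Longrightarrow> additive_on S f \<Longrightarrow> x \<in> S \<Longrightarrow> f (nmul n x) = nmul n (f x)"
  by (induction n) (simp_all add: nmul_Suc additive_on_zero additive_on_add subgroup_nmul)

lemma additive_on_subset: "additive_on S f \<Longrightarrow> T \<subseteq> S \<Longrightarrow> additive_on T f"
  by (auto simp: additive_on_def)

lemma embeds_subset: "embeds S f \<Longrightarrow> T \<subseteq> S \<Longrightarrow> embeds T f"
  by (auto simp: embeds_def intro: additive_on_subset inj_on_subset)

lemma subgroup_image: "is_subgroup S \<Longrightarrow> additive_on S f \<Longrightarrow> is_subgroup (f ` S)"
  unfolding is_subgroup_def[of "f ` S"]
proof (intro conjI ballI)
  assume S: "is_subgroup S" "additive_on S f"
  show "0 \<in> f ` S"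
    using additive_on_zero[OF S] subgroup_zero[OF S(1)] by (metis imageI)
  show "x + y \<in> f ` S" if "x \<in> f ` S" "y \<in> f ` S" for x y
    using that additive_on_add[OF S(2)] subgroup_add[OF S(1)] by (metis (no_types, lifting) image_iff)
  show "- x \<in> f ` S" if "x \<in> f ` S" for x
    using that additive_on_uminus[OF S] subgroup_uminus[OF S(1)] by (metis (no_types, lifting) image_iff)
qed

lemma additive_on_comp: "additive_on S f \<Longrightarrow> additive_on (f ` S) g \<Longrightarrow> additive_on S (g \<circ> f)"
  by (auto simp: additive_on_def)

lemma embeds_comp: "embeds S f \<Longrightarrow> embeds (f ` S) g \<Longrightarrow> embeds S (g \<circ> f)"
  by (auto simp: embeds_def intro: additive_on_comp comp_inj_on)

lemma embeds_zero_iff: "is_subgroup S \<Longrightarrow> embeds S f \<Longrightarrow> x \<in> S \<Longrightarrow> f x = 0 \<longleftrightarrow> x = 0"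
  using additive_on_zero[of S f] subgroup_zero[of S] by (auto simp: embeds_def inj_on_def)

lemma embedsI:
  assumes "is_subgroup S" "additive_on S f" "\<And>x. x \<in> S \<Longrightarrow> f x = 0 \<Longrightarrow> x = 0"
  shows "embeds S f"
  unfolding embeds_def
proof (intro conjI inj_onI assms(2))
  fix x y assume xy: "x \<in> S" "y \<in> S" "f x = f y"
  have "f (x + - y) = 0"
    using xy assms(1,2) by (simp add: additive_on_add additive_on_uminus subgroup_uminus)
  then have "x + - y = 0"
    using assms(3) xy assms(1) by (meson subgroup_add subgroup_uminus)
  then show "x = y" by (simp add: add_eq_0_iff2)
qed

lemma embeds_inv:
  assumes "is_subgroup S" "embeds S f"
  shows "embeds (f ` S) (inv_into S f)"
proof -
  have i: "inj_on f S" and a: "additive_on S f" using assms by (auto simp: embeds_def)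
  have "additive_on (f ` S) (inv_into S f)"
    unfolding additive_on_def
  proof (intro ballI)
    fix x y assume "x \<in> f ` S" "y \<in> f ` S"
    then obtain a b where ab: "a \<in> S" "b \<in> S" "x = f a" "y = f b" by blast
    then have "f (a + b) = x + y" using a by (simp add: additive_on_add)
    then show "inv_into S f (x + y) = inv_into S f x + inv_into S f y"
      using ab i assms(1) by (metis inv_into_f_f subgroup_add)
  qed
  then show ?thesis by (simp add: embeds_def inj_on_inv_into)
qed

lemma malnormalD: "malnormal H S \<Longrightarrow> x \<in> S \<Longrightarrow> h \<in> H \<Longrightarrow> h \<noteq> 0 \<Longrightarrow> x + h + - x \<in> H \<Longrightarrow> x \<in> H"
  by (simp add: malnormal_def)

lemma malnormal_subset: "malnormal H S \<Longrightarrow> H \<subseteq> S"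
  by (simp add: malnormal_def)

lemma malnormal_trans: "malnormal H A \<Longrightarrow> malnormal A S \<Longrightarrow> malnormal H S"
  unfolding malnormal_def by (meson order_trans subsetD)

lemma torsion_free_image:
  assumes "is_subgroup S" "embeds S f" "torsion_free_on S"
  shows "torsion_free_on (f ` S)"
  unfolding torsion_free_on_def
proof (intro ballI allI impI)
  fix x n assume "x \<in> f ` S" "0 < (n::nat)" "nmul n x = 0"
  then obtain y where y: "y \<in> S" "x = f y" by blast
  have f: "additive_on S f" using assms by (auto simp: embeds_def)
  have "f (nmul n y) = 0" using y \<open>nmul n x = 0\<close> f assms(1) by (simp add: additive_on_nmul)
  then have "nmul n y = 0" using embeds_zero_iff[OF assms(1,2)] y assms(1) by (simp add: subgroup_nmul)
  then have "y = 0" using assms(3) y \<open>0 < n\<close> by (auto simp: torsion_free_on_def)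
  then show "x = 0" using y additive_on_zero[OF assms(1) f] by simp
qed

subsection \<open>Alternating words\<close>

fun alt :: "'g set \<Rightarrow> 'g set \<Rightarrow> 'g list \<Rightarrow> bool" where
  "alt A B [] \<longleftrightarrow> True"
| "alt A B (w # ws) \<longleftrightarrow> w \<in> A \<and> w \<notin> B \<and> alt B A ws"

text \<open>The normal form theorem taken as a definition: \<open>join A B\<close> is the free
  product of \<open>A\<close> and \<open>B\<close> amalgamated along \<open>A \<inter> B\<close>. In
  this internal form an amalgam is a subgroup of a given group, and no quotient of a set of words is
  involved.\<close>

definition amalgam :: "'g::group_add set \<Rightarrow> 'g set \<Rightarrow> bool" where
  "amalgam A B \<longleftrightarrow> is_subgroup A \<and> is_subgroup B \<and>
     (\<forall>ws. ws \<noteq> [] \<longrightarrow> alt A B ws \<or> alt B A ws \<longrightarrow> sum_list ws \<noteq> 0)"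

definition join :: "'g::group_add set \<Rightarrow> 'g set \<Rightarrow> 'g set" where
  "join A B = {sum_list ws |ws. set ws \<subseteq> A \<union> B}"

lemma amalgam_sym: "amalgam A B \<Longrightarrow> amalgam B A"
  by (auto simp: amalgam_def)

lemma join_sym: "join A B = join B A"
  by (auto simp: join_def Un_commute)

lemma amalgam_subgroup: "amalgam A B \<Longrightarrow> is_subgroup A" "amalgam A B \<Longrightarrow> is_subgroup B"
  by (auto simp: amalgam_def)

lemma alt_append:
  "alt A B (xs @ ys) \<longleftrightarrow> alt A B xs \<and> (if even (length xs) then alt A B ys else alt B A ys)"
  by (induction xs arbitrary: A B) auto

lemma alt_subset: "alt A B ws \<Longrightarrow> set ws \<subseteq> A \<union> B"
  by (induction ws arbitrary: A B) auto

lemma alt_rev_uminus: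
  assumes "is_subgroup A" "is_subgroup B" "alt A B ws"
  shows "if odd (length ws) then alt A B (map uminus (rev ws)) else alt B A (map uminus (rev ws))"
  using assms by (induction ws arbitrary: A B) (auto simp: alt_append subgroup_uminus_iff split: if_splits)

lemma alt_glue:
  assumes "is_subgroup A" "is_subgroup B" "alt A B xs" "alt B A ys"
  shows "alt A B (map uminus (rev xs) @ ys) \<or> alt B A (map uminus (rev xs) @ ys)"
  using alt_rev_uminus[OF assms(1-3)] assms(4) by (auto simp: alt_append split: if_splits)

lemma alt_absorb:
  assumes "is_subgroup A" "is_subgroup B" "c \<in> A \<inter> B" "alt A B (w # ws)"
  shows "alt A B ((c + w) # ws)" "alt A B ((w + c) # ws)"
  using assms by (auto simp: subgroup_add_left_iff subgroup_add_right_iff)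

lemma sum_list_map_neg:
  fixes h :: "'l \<Rightarrow> 'g::group_add"
  assumes "\<And>x. x \<in> set ws \<Longrightarrow> h (neg x) = - h x"
  shows "sum_list (map h (map neg (rev ws))) = - sum_list (map h ws)"
  using assms by (induction ws) (auto simp: minus_add)

lemma subgroup_words:
  fixes e :: "'l \<Rightarrow> 'g::group_add"
  assumes neg: "\<And>x. x \<in> L \<Longrightarrow> neg x \<in> L" "\<And>x. x \<in> L \<Longrightarrow> e (neg x) = - e x"
  shows "is_subgroup {sum_list (map e ws) |ws. set ws \<subseteq> L}"
  unfolding is_subgroup_def
proof (intro conjI ballI)
  let ?W = "{sum_list (map e ws) |ws. set ws \<subseteq> L}"
  show "0 \<in> ?W" by (intro CollectI exI[of _ "[]"]) auto
  show "x + y \<in> ?W" if "x \<in> ?W" "y \<in> ?W" for x y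
  proof -
    from that obtain u v where "x = sum_list (map e u)" "y = sum_list (map e v)" "set u \<subseteq> L" "set v \<subseteq> L" by blast
    then show ?thesis by (intro CollectI exI[of _ "u @ v"]) auto
  qed
  show "- x \<in> ?W" if "x \<in> ?W" for x
  proof -
    from that obtain u where u: "x = sum_list (map e u)" "set u \<subseteq> L" by blast
    then have "sum_list (map e (map neg (rev u))) = - x" using neg(2) by (simp only: u(1)) (intro sum_list_map_neg; blast)
    moreover have "set (map neg (rev u)) \<subseteq> L" using u(2) neg(1) by auto
    ultimately show ?thesis by (metis (mono_tags, lifting) mem_Collect_eq)
  qed
qed

lemma subgroup_join:
  assumes "is_subgroup A" "is_subgroup B"
  shows "is_subgroup (join A B)"
proof -
  have "is_subgroup {sum_list (map (\<lambda>x. x) ws) |ws. set ws \<subseteq> A \<union> B}"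
    by (rule subgroup_words[where neg = uminus]) (use assms in \<open>auto simp: subgroup_uminus\<close>)
  then show ?thesis by (simp add: join_def)
qed

lemma join_upper: "A \<subseteq> join A B" "B \<subseteq> join A B"
proof -
  have "x \<in> join A B" if "x \<in> A \<union> B" for x
    unfolding join_def using that by (intro CollectI exI[of _ "[x]"]) auto
  then show "A \<subseteq> join A B" "B \<subseteq> join A B" by auto
qed

lemma join_least: "is_subgroup S \<Longrightarrow> A \<subseteq> S \<Longrightarrow> B \<subseteq> S \<Longrightarrow> join A B \<subseteq> S"
  by (auto simp: join_def intro!: subgroup_sum_list)

lemma join_image:
  assumes "is_subgroup S" "additive_on S f" "A \<subseteq> S" "B \<subseteq> S"
  shows "join (f ` A) (f ` B) = f ` join A B"
proof
  have "join A B \<subseteq> S" by (rule join_least[OF assms(1,3,4)])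
  show "f ` join A B \<subseteq> join (f ` A) (f ` B)"
  proof
    fix y assume "y \<in> f ` join A B"
    then obtain ws where ws: "set ws \<subseteq> A \<union> B" "y = f (sum_list ws)" by (auto simp: join_def)
    then have "y = sum_list (map f ws)"
      using additive_on_sum_list[OF assms(1,2)] assms(3,4) by blast
    moreover have "set (map f ws) \<subseteq> f ` A \<union> f ` B" using ws(1) by (metis image_Un image_mono set_map)
    ultimately show "y \<in> join (f ` A) (f ` B)" unfolding join_def by blast
  qed
  show "join (f ` A) (f ` B) \<subseteq> f ` join A B"
  proof
    fix y assume "y \<in> join (f ` A) (f ` B)"
    then obtain vs where vs: "set vs \<subseteq> f ` (A \<union> B)" "y = sum_list vs" by (auto simp: join_def image_Un)
    then have "vs \<in> map f ` lists (A \<union> B)" by (simp only: lists_image[symmetric]) (simp add: in_lists_conv_set subset_iff)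
    then obtain ws where ws: "set ws \<subseteq> A \<union> B" "vs = map f ws" by (auto simp: in_lists_conv_set)
    then have "set ws \<subseteq> S" using assms(3,4) by blast
    then have "y = f (sum_list ws)" using additive_on_sum_list[OF assms(1,2)] vs ws by simp
    then show "y \<in> f ` join A B" using ws(1) by (auto simp: join_def)
  qed
qed

lemma amalgam_nonzero:
  "amalgam A B \<Longrightarrow> ws \<noteq> [] \<Longrightarrow> alt A B ws \<or> alt B A ws \<Longrightarrow> sum_list ws \<noteq> 0"
  by (auto simp: amalgam_def)

text \<open>The words are rewritten simultaneously under \<open>f\<close>, so that a pair of homomorphisms on \<open>A\<close> and \<open>B\<close>
  can be shown to extend to \<open>join A B\<close>.\<close>

lemma reduce_word:
  assumes A: "is_subgroup A" and B: "is_subgroup B" and fA: "additive_on A f" and fB: "additive_on B f"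
    and "set ws \<subseteq> A \<union> B"
  shows "\<exists>c vs. c \<in> A \<inter> B \<and> (alt A B vs \<or> alt B A vs) \<and> sum_list ws = c + sum_list vs \<and>
     sum_list (map f ws) = f c + sum_list (map f vs) \<and> length vs \<le> length ws"
  using assms(5)
proof (induction ws)
  case Nil
  have "0 \<in> A \<inter> B" "f 0 = 0" using A B additive_on_zero[OF A fA] by (auto simp: subgroup_zero)
  then show ?case by (intro exI[of _ 0] exI[of _ "[]"]) auto
next
  case (Cons v ws)
  then obtain c vs where c: "c \<in> A \<inter> B" and vs: "alt A B vs \<or> alt B A vs" and
    s: "sum_list ws = c + sum_list vs" "sum_list (map f ws) = f c + sum_list (map f vs)" "length vs \<le> length ws"
    by auto
  \<comment> \<open>One element of \<open>A\<close> is put in front. Together with \<open>c\<close>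
    it disappears into the coefficient, becomes a new first syllable, or merges with a first
    syllable from \<open>A\<close>; the merged element may in turn fall into the
    intersection.\<close>
  have key: "\<exists>c' vs'. c' \<in> A \<inter> B \<and> (alt A B vs' \<or> alt B A vs') \<and> v + (c + sum_list vs) = c' + sum_list vs' \<and>
     f v + (f c + sum_list (map f vs)) = f c' + sum_list (map f vs') \<and> length vs' \<le> Suc (length vs)"
    if A: "is_subgroup A" and B: "is_subgroup B" and fA: "additive_on A f" and fB: "additive_on B f"
      and v: "v \<in> A" and c: "c \<in> A \<inter> B" and vs: "alt A B vs \<or> alt B A vs" for A B
  proof -
    have z: "0 \<in> A \<inter> B" "f 0 = 0" using A B additive_on_zero[OF A fA] by (auto simp: subgroup_zero)
    have vc: "v + c \<in> A" "f (v + c) = f v + f c" using v c A fA by (auto simp: subgroup_add additive_on_add)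
    show ?thesis
    proof (cases "v + c \<in> B")
      case True
      then show ?thesis using vs vc by (intro exI[of _ "v + c"] exI[of _ vs]) (auto simp: add.assoc)
    next
      case False
      show ?thesis
      proof (cases "alt B A vs")
        case True
        then show ?thesis using vc z False
          by (intro exI[of _ 0] exI[of _ "(v + c) # vs"]) (auto simp: add.assoc)
      next
        case nBA: False
        then obtain w us where w: "vs = w # us" "w \<in> A" "w \<notin> B" "alt B A us"
          using vs by (cases vs) auto
        have vw: "v + c + w \<in> A" "f (v + c + w) = f v + f c + f w"
          using vc w A fA by (auto simp: subgroup_add additive_on_add)
        show ?thesis
        proof (cases "v + c + w \<in> B")
          case True
          then show ?thesis using vw w by (intro exI[of _ "v + c + w"] exI[of _ us]) (auto simp: add.assoc)
        next
          case False
          then show ?thesis using vw w z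
            by (intro exI[of _ 0] exI[of _ "(v + c + w) # us"]) (auto simp: add.assoc)
        qed
      qed
    qed
  qed
  have "v \<in> A \<or> v \<in> B" using Cons.prems by auto
  then show ?case
  proof
    assume "v \<in> A"
    from key[OF A B fA fB this c vs] show ?thesis using s by fastforce
  next
    assume "v \<in> B"
    from key[OF B A fB fA this] c vs show ?thesis using s by fastforce
  qed
qed

section \<open>Uniqueness and length of normal forms\<close>

lemma join_normal_form:
  assumes "is_subgroup A" "is_subgroup B" "x \<in> join A B"
  obtains c vs where "c \<in> A \<inter> B" "alt A B vs \<or> alt B A vs" "x = c + sum_list vs"
proof -
  obtain ws where ws: "set ws \<subseteq> A \<union> B" "x = sum_list ws" using assms(3) by (auto simp: join_def)
  have "additive_on S id" for S :: "'a set" by (simp add: additive_on_def)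
  from reduce_word[OF assms(1,2) this this ws(1)] ws(2) that show ?thesis by blast
qed

text \<open>First syllables are compared. If they come from different sides, the quotient of the two
  words alternates and cannot vanish. If they come from the same side, their quotient
  \<open>d\<close> must lie in \<open>A \<inter> B\<close>, since otherwise it would be a syllable
  of an alternating word of value zero; it then serves as the coefficient for the two shorter
  words.\<close>

lemma alt_length_unique:
  assumes am: "amalgam A B" and "alt A B ws" "alt A B vs \<or> alt B A vs" "c \<in> A \<inter> B"
    "sum_list ws = c + sum_list vs"
  shows "length ws = length vs"
  using assms
proof (induction ws arbitrary: A B c vs)
  case (Nil A B)
  note S = amalgam_subgroup[OF Nil.prems(1)]
  show ?case
  proof (cases vs)
    case (Cons v us)
    have "alt A B ((c + v) # us) \<or> alt B A ((c + v) # us)"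
      using alt_absorb(1)[OF S Nil.prems(4), of v us] alt_absorb(1)[OF S(2,1), of c v us] Nil.prems(3,4) Cons by blast
    from amalgam_nonzero[OF Nil.prems(1) _ this] Nil.prems(5) Cons show ?thesis by (simp add: add.assoc)
  qed simp
next
  case (Cons w ws A B)
  note am = Cons.prems(1)
  note S = amalgam_subgroup[OF am]
  show ?case
  proof (cases vs)
    case Nil
    have "- c \<in> A \<inter> B" using Cons.prems(4) S by (auto simp: subgroup_uminus)
    from alt_absorb(1)[OF S this Cons.prems(2)] have "alt A B ((- c + w) # ws)" .
    from amalgam_nonzero[OF am _ disjI1[OF this]] Cons.prems(5) Nil show ?thesis
      by (simp add: add.assoc)
  next
    case vs: (Cons v us)
    show ?thesis
    proof (cases "v \<in> A")
      case False
      then have "alt B A (v # us)" using Cons.prems(3) vs by auto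
      then have "alt B A ((c + v) # us)" using alt_absorb(1)[OF S(2,1), of c] Cons.prems(4) by blast
      from alt_glue[OF S Cons.prems(2) this] amalgam_nonzero[OF am] 
      have "sum_list (map uminus (rev (w # ws)) @ (c + v) # us) \<noteq> 0" by blast
      then have "- sum_list (w # ws) + (c + (v + sum_list us)) \<noteq> 0"
        unfolding sum_list_append sum_list_rev_uminus by (simp add: add.assoc)
      then show ?thesis using Cons.prems(5) vs by (metis left_minus sum_list.Cons)
    next
      case True
      then have v: "v \<in> A" "v \<notin> B" "alt B A us" using Cons.prems(3) vs by auto
      have w: "w \<in> A" "w \<notin> B" "alt B A ws" using Cons.prems(2) by auto
      define d where "d = - (c + v) + w"
      have dA: "d \<in> A" unfolding d_def using v w Cons.prems(4) S
        by (intro subgroup_add subgroup_uminus) auto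
      have e: "w + sum_list ws = c + v + sum_list us" using Cons.prems(5) vs by (simp add: add.assoc)
      then have e2: "d + sum_list ws = sum_list us" unfolding d_def by (metis add.assoc minus_add_cancel)
      show ?thesis
      proof (cases "d \<in> B")
        case True
        then have "- d \<in> B \<inter> A" using dA S by (auto simp: subgroup_uminus)
        moreover have "sum_list ws = - d + sum_list us" using e2 by (metis minus_add_cancel)
        ultimately have "length ws = length us"
          using Cons.IH[OF amalgam_sym[OF am] w(3), of us "- d"] v(3) by blast
        then show ?thesis using vs by simp
      next
        case False
        then have "alt A B (d # ws)" using dA w by simp
        from alt_glue[OF S(2,1) v(3) this] amalgam_nonzero[OF am]
        have "sum_list (map uminus (rev us) @ d # ws) \<noteq> 0" by blast
        then show ?thesis using e2 by (simp add: sum_list_rev_uminus)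
      qed
    qed
  qed
qed

text \<open>Alternating words are shortest among all words over \<open>A \<union> B\<close>, because
  reduction never lengthens a word and the reduced length is unique.\<close>

lemma alt_length_le:
  assumes am: "amalgam A B" and ws: "alt A B ws \<or> alt B A ws" and vs: "set vs \<subseteq> A \<union> B"
    and s: "sum_list ws = sum_list vs"
  shows "length ws \<le> length vs"
proof -
  note S = amalgam_subgroup[OF am]
  have id: "additive_on T id" for T :: "'a set" by (simp add: additive_on_def)
  obtain c us where c: "c \<in> A \<inter> B" "alt A B us \<or> alt B A us" "sum_list vs = c + sum_list us"
      "length us \<le> length vs"
    using reduce_word[OF S id id vs] by auto
  have "length ws = length us"
    using ws
  proof
    assume "alt A B ws" from alt_length_unique[OF am this c(2,1)] c(3) s show ?thesis by simp
  next
    assume "alt B A ws" from alt_length_unique[OF amalgam_sym[OF am] this, of us c] c s show ?thesis by auto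
  qed
  then show ?thesis using c(4) by simp
qed

lemma alt_long_notin:
  assumes "amalgam A B" "alt A B ws \<or> alt B A ws" "2 \<le> length ws"
  shows "sum_list ws \<notin> A" "sum_list ws \<notin> B"
  using alt_length_le[OF assms(1,2), of "[sum_list ws]"] assms(3) by auto

section \<open>Torsion and malnormality in amalgams\<close>

lemma alt_concat_replicate:
  "alt A B ws \<Longrightarrow> even (length ws) \<Longrightarrow> alt A B (concat (replicate n ws))"
  by (induction n) (auto simp: alt_append)

text \<open>Cyclic reduction. Powers of an alternating word of even length alternate again and hence
  do not vanish; a word of odd length at least three becomes shorter when its last syllable is moved
  to the front by conjugation; what remains lies in one of the factors.\<close>

lemma torsion_free_amalgam:
  assumes am: "amalgam A B" and tA: "torsion_free_on A" and tB: "torsion_free_on B"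
  shows "torsion_free_on (join A B)"
proof -
  have main: "c + sum_list vs = 0"
    if "c \<in> A \<inter> B" "alt A B vs" "amalgam A B" "torsion_free_on A" "torsion_free_on B" "n > 0"
      "nmul n (c + sum_list vs) = 0" for A B :: "'a set" and c vs n
    using that
  proof (induction "length vs" arbitrary: A B c vs rule: less_induct)
    case less
    note am = less.prems(3)
    note S = amalgam_subgroup[OF am]
    consider "vs = []" | v where "vs = [v]" | v us w where "vs = v # us @ [w]"
      by (metis append_Nil neq_Nil_conv rev_exhaust)
    then show ?case
    proof cases
      case 1
      then show ?thesis using less.prems by (auto simp: torsion_free_on_def)
    next
      case 2
      then have "c + v \<in> A" using less.prems(1,2) S by (auto intro: subgroup_add)
      then show ?thesis using less.prems 2 by (auto simp: torsion_free_on_def)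
    next
      case (3 v us w)
      show ?thesis
      proof (cases "even (length vs)")
        case True
        have "alt A B ((c + v) # us @ [w])" using alt_absorb(1)[OF S less.prems(1)] less.prems(2) 3 by blast
        then have "alt A B (concat (replicate n ((c + v) # us @ [w])))"
          by (rule alt_concat_replicate) (use True 3 in auto)
        moreover have "concat (replicate n ((c + v) # us @ [w])) \<noteq> []" using less.prems(6) by auto
        ultimately have "sum_list (concat (replicate n ((c + v) # us @ [w]))) \<noteq> 0"
          using amalgam_nonzero[OF am] by blast
        then have "nmul n (sum_list ((c + v) # us @ [w])) \<noteq> 0" by (metis nmul_sum_list)
        then show ?thesis using less.prems(7) 3 by (simp add: add.assoc)
      next
        case False
        then have ev: "odd (length us)" using 3 by auto
        have us: "v \<in> A" "v \<notin> B" "alt B A us" "w \<in> A" "w \<notin> B"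
          using less.prems(2) 3 ev by (auto simp: alt_append)
        define d where "d = w + (c + v)"
        have dA: "d \<in> A" unfolding d_def using us less.prems(1) S by (auto intro!: subgroup_add)
        have eq: "c + sum_list vs = (- w) + (d + sum_list us) + - (- w)"
          using 3 by (simp add: d_def add.assoc)
        have "nmul n (d + sum_list us) = 0"
        proof -
          have "- w + nmul n (d + sum_list us) + - (- w) = 0" using less.prems(7) unfolding eq nmul_conj .
          then show ?thesis by (metis add.right_neutral add_minus_cancel minus_minus neg_eq_iff_add_eq_0 add.assoc)
        qed
        moreover have "d + sum_list us = 0" if "nmul n (d + sum_list us) = 0"
        proof (cases "d \<in> B")
          case True
          show ?thesis
            by (rule less.hyps[OF _ _ us(3) amalgam_sym[OF am] less.prems(5,4,6) that])
               (use 3 True dA in auto)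
        next
          case False
          have z: "0 \<in> A \<inter> B" using S by (auto simp: subgroup_zero)
          have "0 + sum_list (d # us) = 0"
            by (rule less.hyps[OF _ z _ am less.prems(4,5,6)])
               (use 3 False dA us that in auto)
          then show ?thesis by simp
        qed
        ultimately show ?thesis using eq by simp
      qed
    qed
  qed
  show ?thesis
    unfolding torsion_free_on_def
  proof (intro ballI allI impI)
    fix x n assume x: "x \<in> join A B" "0 < (n::nat)" "nmul n x = 0"
    obtain c vs where c: "c \<in> A \<inter> B" "alt A B vs \<or> alt B A vs" "x = c + sum_list vs"
      using join_normal_form[OF amalgam_subgroup[OF am] x(1)] .
    then show "x = 0"
      using main[of c A B vs n] main[of c B A vs n] am amalgam_sym[OF am] tA tB x by blast
  qed
qed

lemma join_notin_front:
  assumes S: "is_subgroup A" "is_subgroup B" and x: "x \<in> join A B" "x \<notin> A"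
  obtains a b us where "a \<in> A" "alt B A (b # us)" "x = a + (b + sum_list us)"
proof -
  obtain c vs where c: "c \<in> A \<inter> B" "alt A B vs \<or> alt B A vs" "x = c + sum_list vs"
    using join_normal_form[OF S x(1)] .
  show thesis
  proof (cases "alt B A vs")
    case True
    then show thesis using c x(2) that[of c] by (cases vs) auto
  next
    case False
    then obtain w ws where w: "vs = w # ws" "w \<in> A" "alt B A ws" using c(2) by (cases vs) auto
    have cw: "c + w \<in> A" using c w S by (auto intro: subgroup_add)
    then have "ws \<noteq> []" using x(2) c(3) w by auto
    then show thesis using w c cw that[of "c + w"] by (cases ws) (auto simp: add.assoc)
  qed
qed

lemma join_notin_back:
  assumes S: "is_subgroup A" "is_subgroup B" and x: "x \<in> join A B" "x \<notin> A"
  obtains us b a where "alt A B (us @ [b]) \<or> alt B A (us @ [b])" "b \<in> B" "b \<notin> A" "a \<in> A"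
    "x = sum_list (us @ [b]) + a"
proof -
  have "- x \<in> join A B" "- x \<notin> A" using x S by (simp_all add: subgroup_join subgroup_uminus_iff)
  then obtain a b us where a: "a \<in> A" "alt B A (b # us)" "- x = a + (b + sum_list us)"
    using join_notin_front[OF S] by blast
  have e: "- x = a + sum_list (b # us)" using a(3) by simp
  have "x = - sum_list (b # us) + - a" by (metis e minus_add minus_minus)
  then have "x = sum_list (map uminus (rev us) @ [- b]) + - a"
    by (simp only: sum_list_rev_uminus[symmetric]) simp
  moreover have "alt A B (map uminus (rev us) @ [- b]) \<or> alt B A (map uminus (rev us) @ [- b])"
    using alt_rev_uminus[OF S(2,1) a(2)] by (auto split: if_splits)
  moreover have "- b \<in> B" "- b \<notin> A" "- a \<in> A" using a S by (auto simp: subgroup_uminus_iff)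
  ultimately show thesis using that by blast
qed

text \<open>Let \<open>x\<close> end in a syllable \<open>b\<close> of \<open>B\<close> followed by
  \<open>a\<close> in \<open>A\<close>. If the conjugate of \<open>h\<close> by \<open>a\<close>
  lies outside \<open>B\<close>, it is the middle syllable of an alternating word for
  \<open>x + h + - x\<close>. Otherwise its conjugate by \<open>b\<close> is the middle syllable,
  provided that it avoids \<open>A\<close>, which is what \<open>C\<close> grants. Only elements of
  the intersection that are conjugate into \<open>H\<close> have to be controlled, which is weaker
  than malnormality of \<open>A \<inter> B\<close> in \<open>B\<close>.\<close>

lemma malnormal_amalgam:
  assumes am: "amalgam A B" and H: "is_subgroup H" "malnormal H A"
    and C: "\<And>c a b. c \<in> A \<inter> B \<Longrightarrow> c \<noteq> 0 \<Longrightarrow> a \<in> A \<Longrightarrow> - a + c + a \<in> H \<Longrightarrow> b \<in> B \<Longrightarrow> b \<notin> A \<Longrightarrow>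
      b + c + - b \<notin> A"
  shows "malnormal H (join A B)"
  unfolding malnormal_def
proof (intro conjI ballI impI)
  note S = amalgam_subgroup[OF am]
  have HA: "H \<subseteq> A" using H(2) by (rule malnormal_subset)
  then show "H \<subseteq> join A B" using join_upper(1) by blast
  fix x h assume x: "x \<in> join A B" and h: "h \<in> H" "h \<noteq> 0" "x + h + - x \<in> H"
  show "x \<in> H"
  proof (cases "x \<in> A")
    case True
    then show ?thesis using malnormalD[OF H(2)] h by blast
  next
    case xA: False
    obtain us a b where us: "alt A B (us @ [b]) \<or> alt B A (us @ [b])" "b \<in> B" "b \<notin> A" "a \<in> A"
        "x = sum_list (us @ [b]) + a"
      using join_notin_back[OF S x xA] .
    define h' where "h' = a + h + - a"
    have h'A: "h' \<in> A" unfolding h'_def using us(4) h(1) HA S(1) by (auto intro!: subgroup_add subgroup_uminus)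
    have h'0: "h' \<noteq> 0" unfolding h'_def using h(2)
      by (metis add.assoc add.left_neutral add_minus_cancel left_minus minus_add_cancel add.right_neutral neg_eq_iff_add_eq_0)
    have conj: "x + h + - x = sum_list us + (b + h' + - b) + - sum_list us"
      using us(5) by (simp add: h'_def add.assoc minus_add)
    have "x + h + - x \<notin> A"
    proof (cases "h' \<in> B")
      case False
      have r: "- b \<in> B" "- b \<notin> A" using us S by (auto simp: subgroup_uminus_iff)
      have "alt A B ((us @ [b]) @ [h'] @ map uminus (rev (us @ [b]))) \<or> alt B A ((us @ [b]) @ [h'] @ map uminus (rev (us @ [b])))"
        using us(1)
      proof
        assume *: "alt A B (us @ [b])"
        then have "odd (length us)" using us(2,3) by (auto simp: alt_append split: if_splits)
        then show ?thesis using * h'A False us(2,3) alt_rev_uminus[OF S *] by (auto simp: alt_append)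
      next
        assume *: "alt B A (us @ [b])"
        then have "even (length us)" using us(2,3) by (auto simp: alt_append split: if_splits)
        then show ?thesis using * h'A False us(2,3) alt_rev_uminus[OF S(2,1) *] by (auto simp: alt_append)
      qed
      from alt_long_notin(1)[OF am this] have "sum_list ((us @ [b]) @ [h'] @ map uminus (rev (us @ [b]))) \<notin> A" by simp
      then show ?thesis unfolding conj sum_list_append sum_list_rev_uminus by (simp add: add.assoc minus_add)
    next
      case True
      define d where "d = b + h' + - b"
      have "- a + h' + a \<in> H" using h(1) by (simp add: h'_def add.assoc)
      then have dA: "d \<notin> A" unfolding d_def using C[of h' a b] True h'A h'0 us by blast
      have dB: "d \<in> B" unfolding d_def using True us(2) S(2) by (auto intro!: subgroup_add subgroup_uminus)
      have "alt A B (us @ [d] @ map uminus (rev us)) \<or> alt B A (us @ [d] @ map uminus (rev us))"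
        using us(1)
      proof
        assume *: "alt A B (us @ [b])"
        then have "odd (length us)" "alt A B us" using us(2,3) by (auto simp: alt_append split: if_splits)
        then show ?thesis using * dA dB us(2,3) alt_rev_uminus[OF S, of us] by (auto simp: alt_append)
      next
        assume *: "alt B A (us @ [b])"
        then have "even (length us)" "alt B A us" using us(2,3) by (auto simp: alt_append split: if_splits)
        then show ?thesis using * dA dB us(2,3) alt_rev_uminus[OF S(2,1), of us] by (auto simp: alt_append)
      qed
      from alt_long_notin(1)[OF am this] have "us \<noteq> [] \<Longrightarrow> sum_list (us @ [d] @ map uminus (rev us)) \<notin> A"
        by (cases us) simp_all
      then show ?thesis using dA unfolding conj sum_list_append sum_list_rev_uminus d_def[symmetric]
        by (cases "us = []") (simp_all add: add.assoc)
    qed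
    then show ?thesis using h(3) HA by blast
  qed
qed

text \<open>Von Dyck's principle for the subgroup generated by the values of \<open>e\<close>: it
  suffices that relators go to relators, because the formal inversion \<open>neg\<close> turns the
  quotient of two words with equal value into a relator.\<close>

lemma hom_on_words:
  fixes e :: "'l \<Rightarrow> 'g::group_add" and e' :: "'l \<Rightarrow> 'h::group_add"
  assumes neg: "\<And>x. x \<in> L \<Longrightarrow> neg x \<in> L" "\<And>x. x \<in> L \<Longrightarrow> e (neg x) = - e x" "\<And>x. x \<in> L \<Longrightarrow> e' (neg x) = - e' x"
    and ker: "\<And>ws. set ws \<subseteq> L \<Longrightarrow> sum_list (map e ws) = 0 \<Longrightarrow> sum_list (map e' ws) = 0"
  shows "\<exists>f. additive_on {sum_list (map e ws) |ws. set ws \<subseteq> L} f \<and>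
    (\<forall>ws. set ws \<subseteq> L \<longrightarrow> f (sum_list (map e ws)) = sum_list (map e' ws))"
proof -
  define f where "f x = sum_list (map e' (SOME ws. set ws \<subseteq> L \<and> sum_list (map e ws) = x))" for x
  have f: "f (sum_list (map e ws)) = sum_list (map e' ws)" if ws: "set ws \<subseteq> L" for ws
  proof -
    define vs where "vs = (SOME vs. set vs \<subseteq> L \<and> sum_list (map e vs) = sum_list (map e ws))"
    have vs: "set vs \<subseteq> L" "sum_list (map e vs) = sum_list (map e ws)"
      using someI[of "\<lambda>vs. set vs \<subseteq> L \<and> sum_list (map e vs) = sum_list (map e ws)" ws] ws
      unfolding vs_def by auto
    have e: "sum_list (map e (map neg (rev vs))) = - sum_list (map e vs)"
      and e': "sum_list (map e' (map neg (rev vs))) = - sum_list (map e' vs)"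
      using vs(1) neg by (intro sum_list_map_neg; blast)+
    have "sum_list (map e (map neg (rev vs) @ ws)) = 0"
      unfolding map_append sum_list_append e vs(2) by simp
    then have "sum_list (map e' (map neg (rev vs) @ ws)) = 0"
      using vs ws neg(1) by (intro ker) auto
    then have "- sum_list (map e' vs) + sum_list (map e' ws) = 0"
      unfolding map_append sum_list_append e' .
    then show ?thesis unfolding f_def vs_def[symmetric] by (metis minus_minus neg_eq_iff_add_eq_0)
  qed
  have "additive_on {sum_list (map e ws) |ws. set ws \<subseteq> L} f"
    unfolding additive_on_def
  proof (intro ballI)
    fix x y assume "x \<in> {sum_list (map e ws) |ws. set ws \<subseteq> L}" "y \<in> {sum_list (map e ws) |ws. set ws \<subseteq> L}"
    then obtain u v where uv: "set u \<subseteq> L" "x = sum_list (map e u)" "set v \<subseteq> L" "y = sum_list (map e v)" by blast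
    then have "f (sum_list (map e (u @ v))) = sum_list (map e' (u @ v))" by (intro f) auto
    then show "f (x + y) = f x + f y" using uv f by simp
  qed
  then show ?thesis using f by blast
qed

text \<open>The universal property. Reducing a word of value zero leaves no syllables, so only a
  coefficient in \<open>A \<inter> B\<close> remains, and \<open>reduce_word\<close> carries out the
  same reduction on the values of the map.\<close>

lemma amalgam_extend:
  fixes f g :: "'g::group_add \<Rightarrow> 'h::group_add"
  assumes am: "amalgam A B" and f: "additive_on A f" and g: "additive_on B g"
    and fg: "\<And>c. c \<in> A \<inter> B \<Longrightarrow> f c = g c"
  shows "\<exists>h. additive_on (join A B) h \<and> (\<forall>a\<in>A. h a = f a) \<and> (\<forall>b\<in>B. h b = g b)"
proof -
  note S = amalgam_subgroup[OF am]
  define k where "k x = (if x \<in> A then f x else g x)" for x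
  have kA: "k a = f a" if "a \<in> A" for a using that by (simp add: k_def)
  have kB: "k b = g b" if "b \<in> B" for b using that fg by (auto simp: k_def)
  have k: "additive_on A k" "additive_on B k"
    using f g S kA kB by (auto simp: additive_on_def subgroup_add)
  have "\<exists>h. additive_on {sum_list (map (\<lambda>x. x) ws) |ws. set ws \<subseteq> A \<union> B} h \<and>
    (\<forall>ws. set ws \<subseteq> A \<union> B \<longrightarrow> h (sum_list (map (\<lambda>x. x) ws)) = sum_list (map k ws))"
  proof (rule hom_on_words)
    show "- x \<in> A \<union> B" if "x \<in> A \<union> B" for x using that S by (auto simp: subgroup_uminus)
    show "k (- x) = - k x" if "x \<in> A \<union> B" for x
      using that k S additive_on_uminus[of A k x] additive_on_uminus[of B k x] by auto
    show "sum_list (map k ws) = 0" if ws: "set ws \<subseteq> A \<union> B" "sum_list (map (\<lambda>x. x) ws) = 0" for ws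
    proof -
      obtain c vs where c: "c \<in> A \<inter> B" "alt A B vs \<or> alt B A vs" "sum_list ws = c + sum_list vs"
          "sum_list (map k ws) = k c + sum_list (map k vs)"
        using reduce_word[OF S k ws(1)] by blast
      have "sum_list [] = c + sum_list vs" using c ws by simp
      from alt_length_unique[OF am _ c(2,1) this] have "vs = []" by simp
      then show ?thesis using c ws additive_on_zero[OF S(1) k(1)] by simp
    qed
  qed auto
  then obtain h where h: "additive_on (join A B) h"
    "\<And>ws. set ws \<subseteq> A \<union> B \<Longrightarrow> h (sum_list ws) = sum_list (map k ws)"
    by (auto simp: join_def)
  have "h x = k x" if "x \<in> A \<union> B" for x using h(2)[of "[x]"] that by simp
  then show ?thesis using h(1) kA kB by auto
qed

subsection \<open>Free subgroups generated by long words\<close>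

definition zig :: "('g \<Rightarrow> 'g) \<Rightarrow> ('g \<Rightarrow> 'g) \<Rightarrow> 'g \<Rightarrow> 'g::group_add" where
  "zig l m y = l y + m y + l y + m y"

text \<open>The fourth power written as two halves. The factor \<open>v\<close> is \<open>0\<close>
  for the pair on the left of the law and \<open>u\<close> for the pair on the right, so that both
  sides have the same shape.\<close>

definition zigzag :: "('g \<Rightarrow> 'g) \<Rightarrow> ('g \<Rightarrow> 'g) \<Rightarrow> 'g \<Rightarrow> 'g \<Rightarrow> 'g::group_add" where
  "zigzag l m v y = v + (zig l m y + zig l m y)"

text \<open>In the words below \<open>(y, s, g)\<close> stands for the letter \<open>\<gamma> y\<close> or, if \<open>s\<close> is false, its inverse, followed
  by the coefficient \<open>g\<close>.\<close>

fun wval :: "('g \<Rightarrow> 'g) \<Rightarrow> ('g \<times> bool \<times> 'g) list \<Rightarrow> 'g::group_add" where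
  "wval \<gamma> [] = 0"
| "wval \<gamma> ((y, s, g) # ws) = (if s then \<gamma> y else - \<gamma> y) + (g + wval \<gamma> ws)"

definition reduced :: "('g \<times> bool \<times> 'g::group_add) list \<Rightarrow> bool" where
  "reduced = successively (\<lambda>(y, s, g) (y', s', g'). y = y' \<longrightarrow> s = s' \<or> g \<noteq> 0)"

text \<open>Words are kept formal and evaluated under an arbitrary \<open>\<gamma>\<close>, since
  the same word has to be read in both factors of the later amalgam and be reduced in both at
  once.\<close>

fun letter :: "('g \<Rightarrow> 'g) \<Rightarrow> 'g + 'g \<times> bool \<Rightarrow> 'g::group_add" where
  "letter \<gamma> (Inl g) = g"
| "letter \<gamma> (Inr (y, s)) = (if s then \<gamma> y else - \<gamma> y)"

lemma wval_append: "wval \<gamma> (us @ vs) = wval \<gamma> us + wval \<gamma> vs"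
  by (induction \<gamma> us rule: wval.induct) (simp_all add: add.assoc)

lemma nmul_wval: "nmul n (wval \<gamma> ws) = wval \<gamma> (concat (replicate n ws))"
  by (induction n) (simp_all add: nmul_Suc wval_append)

lemma reduced_Cons2:
  "reduced ((y, s, g) # (y', s', g') # ws) \<longleftrightarrow> (y = y' \<longrightarrow> s = s' \<or> g \<noteq> 0) \<and> reduced ((y', s', g') # ws)"
  by (simp add: reduced_def)

lemma reduced_tl: "reduced (a # ws) \<Longrightarrow> reduced ws"
  by (cases ws) (auto simp: reduced_def)

lemma reduced_snoc: "reduced (us @ [(y, s, g)]) \<longleftrightarrow> reduced (us @ [(y, s, g')])"
  by (auto simp: reduced_def successively_append_iff)

lemma letter_uminus: "letter \<gamma> (case x of Inl g \<Rightarrow> Inl (- g) | Inr (y, s) \<Rightarrow> Inr (y, \<not> s)) = - letter \<gamma> x"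
  by (auto split: sum.split prod.split)

text \<open>Two copies \<open>l ` K\<close> and \<open>m ` K\<close> of \<open>K\<close> are attached freely to \<open>K\<close> along the images of \<open>R\<close>. The aim is
  that the subgroup generated by \<open>K\<close> and the elements \<open>zigzag l m v y\<close> with \<open>y \<in> K - R\<close> is the free
  product of \<open>K\<close> and the free group on these elements.\<close>

locale free_pair =
  fixes K R :: "'g::group_add set" and l m :: "'g \<Rightarrow> 'g"
  assumes K: "is_subgroup K" and R: "is_subgroup R" and malR: "malnormal R K"
    and l: "embeds K l" and m: "embeds K m"
    and lK: "l ` K \<inter> K = l ` R" and mK: "m ` K \<inter> K = m ` R"
    and aml: "amalgam K (l ` K)" and amm: "amalgam K (m ` K)"
    and am: "amalgam (join K (l ` K)) (join K (m ` K))"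
    and Pint: "join K (l ` K) \<inter> join K (m ` K) = K"
    and mal_lR: "malnormal (l ` R) K" and mal_mR: "malnormal (m ` R) K"
    and twist: "\<And>\<delta> \<epsilon>. \<delta> \<in> R \<Longrightarrow> \<epsilon> \<in> R \<Longrightarrow> m \<delta> = l \<epsilon> \<Longrightarrow> l \<delta> = m \<epsilon> \<Longrightarrow> \<delta> = 0"
begin

abbreviation "A \<equiv> join K (l ` K)"
abbreviation "B \<equiv> join K (m ` K)"

lemma swap: "free_pair K R m l"
proof unfold_locales
  show "join K (m ` K) \<inter> join K (l ` K) = K" using Pint by (simp add: Int_commute)
  show "\<delta> = 0" if "\<delta> \<in> R" "\<epsilon> \<in> R" "l \<delta> = m \<epsilon>" "m \<delta> = l \<epsilon>" for \<delta> \<epsilon>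
    using twist[OF that(1,2,4,3)] .
qed (fact K R malR l m lK mK aml amm am[THEN amalgam_sym] mal_lR mal_mR)+

lemma RK: "R \<subseteq> K" using malR by (rule malnormal_subset)

lemma sA: "is_subgroup A" and sB: "is_subgroup B"
  using am by (auto simp: amalgam_def)

lemma KA: "K \<subseteq> A" and KB: "K \<subseteq> B" and lA: "l ` K \<subseteq> A" and mB: "m ` K \<subseteq> B"
  by (rule join_upper)+

lemma l_additive: "additive_on K l" and m_additive: "additive_on K m"
  using l m by (auto simp: embeds_def)

lemma l_in_K: "y \<in> K \<Longrightarrow> l y \<in> K \<Longrightarrow> y \<in> R"
proof -
  assume y: "y \<in> K" "l y \<in> K"
  then obtain r where "r \<in> R" "l y = l r" using lK by blast
  then show "y \<in> R" using y RK l by (auto simp: embeds_def inj_on_def)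
qed

lemma m_in_K: "y \<in> K \<Longrightarrow> m y \<in> K \<Longrightarrow> y \<in> R"
  using free_pair.l_in_K[OF swap] by blast

lemma notR_uminus: "y \<in> K - R \<Longrightarrow> - y \<in> K - R"
  using K R by (auto simp: subgroup_uminus_iff)

section \<open>Cancellation at the junction of two powers\<close>

lemma l_notin: "y \<in> K - R \<Longrightarrow> l y \<in> A \<and> l y \<notin> B"
  using l_in_K lA Pint by blast

lemma m_notin: "y \<in> K - R \<Longrightarrow> m y \<in> B \<and> m y \<notin> A"
  using m_in_K mB Pint by blast

text \<open>The outer terms are syllables outside \<open>K\<close>. If the middle \<open>g\<close>
  were outside the image of \<open>K\<close> under \<open>l\<close>, the word would alternate with
  length three and could not lie in \<open>K\<close>. So \<open>g\<close> is an image as well, and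
  the sum is computed inside that image.\<close>

lemma leaf:
  assumes y: "y \<in> K - R" and z: "z \<in> K - R" and g: "g \<in> K" and h: "l y + g + l z \<in> K"
  obtains \<epsilon> where "\<epsilon> \<in> R" "g = l \<epsilon>" "y + \<epsilon> + z \<in> R" "l y + g + l z = l (y + \<epsilon> + z)"
proof -
  have yz: "l y \<notin> K" "l z \<notin> K" using y z l_in_K by blast+
  have "g \<in> l ` K"
  proof (rule ccontr)
    assume "g \<notin> l ` K"
    then have "alt (l ` K) K [l y, g, l z]" using yz y z g by auto
    from alt_long_notin(1)[OF aml disjI2[OF this]] h show False by (simp add: add.assoc)
  qed
  then obtain \<epsilon> where e: "\<epsilon> \<in> R" "g = l \<epsilon>" using g lK by blast
  then have "l y + g + l z = l (y + \<epsilon> + z)"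
    using y z RK K l_additive by (auto simp: additive_on_add subgroup_add subsetD)
  moreover have "y + \<epsilon> + z \<in> K" using y z e RK K by (auto intro!: subgroup_add)
  ultimately show thesis using that[OF e] h l_in_K by metis
qed

text \<open>The inverse of a half is a half of the pair with \<open>l\<close> and \<open>m\<close>
  exchanged. With \<open>swap\<close> this reduces the four sign patterns at a junction to
  two.\<close>

lemma zig_uminus: "y \<in> K \<Longrightarrow> - zig l m y = zig m l (- y)"
  using K l_additive m_additive by (simp add: zig_def minus_add add.assoc additive_on_uminus)

lemma zig_alt:
  assumes "y \<in> K - R" "k \<in> K"
  shows "\<exists>us. alt A B us \<and> length us = 4 \<and> sum_list us = zig l m y + k"
proof -
  have "m y + k \<in> B" "m y + k \<notin> A"
    using m_notin[OF assms(1)] assms(2) KA KB sA sB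
    by (auto simp: subgroup_add_right_iff subsetD)
  then show ?thesis using l_notin[OF assms(1)] m_notin[OF assms(1)]
    by (intro exI[of _ "[l y, m y, l y, m y + k]"]) (simp add: zig_def add.assoc)
qed

text \<open>Cancellation between two inverse-looking words stops after at most two letters: the third
  cancellation would contradict \<open>twist\<close>.\<close>

lemma junction_opposite:
  assumes y: "y \<in> K - R" and z: "z \<in> K - R" and g: "g \<in> K" and ne: "z \<noteq> - y \<or> g \<noteq> 0"
  shows "\<exists>ws. alt A B ws \<and> odd (length ws) \<and> sum_list ws = zig l m y + g + zig m l z"
proof -
  note ly = l_notin[OF y] and my = m_notin[OF y] and lz = l_notin[OF z] and mz = m_notin[OF z]
  have sB2: "m y + k + m z \<in> B" if "k \<in> K" for k using my mz that sB KB by (auto intro!: subgroup_add)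
  have sA2: "l y + k + l z \<in> A" if "k \<in> K" for k using ly lz that sA KA by (auto intro!: subgroup_add)
  have nA: "m y + k + m z \<notin> A" if "k \<in> K" "m y + k + m z \<notin> K" for k using that sB2 Pint by blast
  have nB: "l y + k + l z \<notin> B" if "k \<in> K" "l y + k + l z \<notin> K" for k using that sA2 Pint by blast
  show ?thesis
  proof (cases "m y + g + m z \<in> K")
    case False
    then show ?thesis using ly my lz mz sB2[OF g] nA[OF g]
      by (intro exI[of _ "[l y, m y, l y, m y + g + m z, l z, m z, l z]"]) (simp add: zig_def add.assoc)
  next
    case True
    obtain \<epsilon> where e: "\<epsilon> \<in> R" "g = m \<epsilon>" "y + \<epsilon> + z \<in> R" "m y + g + m z = m (y + \<epsilon> + z)"
      using free_pair.leaf[OF swap y z g True] by blast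
    define \<delta> where "\<delta> = y + \<epsilon> + z"
    define g1 where "g1 = m \<delta>"
    have g1: "g1 \<in> K" "m y + g + m z = g1" using True e by (auto simp: g1_def \<delta>_def)
    have "zig l m y + g + zig m l z = l y + m y + (l y + (m y + g + m z) + l z) + m z + l z"
      by (simp add: zig_def add.assoc)
    then have s1: "zig l m y + g + zig m l z = l y + m y + (l y + g1 + l z) + m z + l z"
      unfolding g1(2) .
    show ?thesis
    proof (cases "l y + g1 + l z \<in> K")
      case False
      then show ?thesis using ly my lz mz sA2[OF g1(1)] nB[OF g1(1)]
        by (intro exI[of _ "[l y, m y, l y + g1 + l z, m z, l z]"]) (simp_all add: s1, simp add: add.assoc)
    next
      case True
      obtain \<epsilon>' where e': "\<epsilon>' \<in> R" "g1 = l \<epsilon>'" "y + \<epsilon>' + z \<in> R" "l y + g1 + l z = l (y + \<epsilon>' + z)"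
        using leaf[OF y z g1(1) True] by blast
      \<comment> \<open>Malnormality makes the cancelling element unique: two candidates differ by
        an element of \<open>R\<close> whose conjugate by \<open>y\<close>, which is not in
        \<open>R\<close>, is again in \<open>R\<close>.\<close>
      have eq: "\<epsilon>' = \<epsilon>" if "\<epsilon>' \<in> R" "y + \<epsilon>' + z \<in> R" for \<epsilon>'
      proof (rule ccontr)
        assume "\<epsilon>' \<noteq> \<epsilon>"
        then have "\<epsilon>' + - \<epsilon> \<noteq> 0" by (simp add: add_eq_0_iff2)
        moreover have "\<epsilon>' + - \<epsilon> \<in> R" using that e R by (auto intro!: subgroup_add subgroup_uminus)
        moreover have "y + (\<epsilon>' + - \<epsilon>) + - y = (y + \<epsilon>' + z) + - (y + \<epsilon> + z)"
          by (simp add: add.assoc minus_add)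
        then have "y + (\<epsilon>' + - \<epsilon>) + - y \<in> R" using that e R by (metis subgroup_add subgroup_uminus)
        ultimately show False using malnormalD[OF malR] y by blast
      qed
      define g2 where "g2 = l \<delta>"
      have g2: "g2 \<in> K" "l y + g1 + l z = g2" using True e' eq by (auto simp: g2_def \<delta>_def)
      have s2: "zig l m y + g + zig m l z = l y + (m y + g2 + m z) + l z"
        unfolding s1 g2(2)[symmetric] by (simp add: add.assoc)
      have "m y + g2 + m z \<notin> K"
      proof
        assume *: "m y + g2 + m z \<in> K"
        obtain \<epsilon>'' where e'': "\<epsilon>'' \<in> R" "g2 = m \<epsilon>''" "y + \<epsilon>'' + z \<in> R"
          using free_pair.leaf[OF swap y z g2(1) *] by blast
        have "m \<delta> = l \<epsilon>" "l \<delta> = m \<epsilon>" using e' e'' eq g1_def g2_def by auto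
        then have "\<delta> = 0" using twist e by (auto simp: \<delta>_def)
        then have "m \<delta> = 0" using additive_on_zero[OF K m_additive] by simp
        then have "\<epsilon> = 0" using \<open>m \<delta> = l \<epsilon>\<close> embeds_zero_iff[OF K l] e RK by auto
        then have "g = 0" "z = - y" using e additive_on_zero[OF K m_additive] \<open>\<delta> = 0\<close>
          by (auto simp: \<delta>_def add_eq_0_iff)
        then show False using ne by blast
      qed
      then show ?thesis using ly lz sB2[OF g2(1)] nA[OF g2(1)]
        by (intro exI[of _ "[l y, m y + g2 + m z, l z]"]) (simp_all add: s2, simp add: add.assoc)
    qed
  qed
qed

lemma junction_same:
  assumes y: "y \<in> K - R" and z: "z \<in> K - R" and g: "g \<in> K"
  shows "\<exists>ws. alt A B ws \<and> even (length ws) \<and> sum_list ws = zig l m y + g + zig l m z"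
proof -
  obtain us where us: "alt A B us" "length us = 4" "sum_list us = zig l m y + g" using zig_alt[OF y g] by blast
  moreover obtain vs where "alt A B vs" "length vs = 4" "sum_list vs = zig l m z + 0"
    using zig_alt[OF z subgroup_zero[OF K]] by blast
  ultimately show ?thesis by (intro exI[of _ "us @ vs"]) (simp add: alt_append)
qed

definition half :: "'g \<Rightarrow> bool \<Rightarrow> 'g" where
  "half y s = (if s then zig l m y else zig m l (- y))"

definition altS :: "bool \<Rightarrow> 'g list \<Rightarrow> bool" where
  "altS s us = (if s then alt A B us else alt B A us)"

text \<open>The parity is what lets consecutive junctions be concatenated. The next word starts on
  the side given by \<open>t\<close>; after a word starting on the side given by \<open>s\<close>
  this alternates exactly if the length is odd for \<open>s \<noteq> t\<close> and even for
  \<open>s = t\<close>.\<close>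

lemma junction:
  assumes "y \<in> K - R" "z \<in> K - R" "k \<in> K" "y = z \<longrightarrow> s = t \<or> k \<noteq> 0"
  shows "\<exists>ws. altS s ws \<and> (odd (length ws) \<longleftrightarrow> s \<noteq> t) \<and> sum_list ws = half y s + k + half z t"
proof -
  have n: "- y \<in> K - R" "- z \<in> K - R" using assms notR_uminus by auto
  note jo = junction_opposite free_pair.junction_opposite[OF swap]
  note js = junction_same free_pair.junction_same[OF swap]
  show ?thesis
    using js(1)[OF assms(1-3)] js(2)[OF n assms(3)] jo(1)[OF assms(1) n(2) assms(3)] jo(2)[OF n(1) assms(2,3)] assms(4)
    by (cases s; cases t) (auto simp: altS_def half_def)
qed

section \<open>Freeness of the core\<close>

definition word_ok :: "('g \<times> bool \<times> 'g) list \<Rightarrow> bool" where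
  "word_ok ws \<longleftrightarrow> (\<forall>(y, s, g)\<in>set ws. y \<in> K - R \<and> g \<in> K)"

lemma zigzag_half:
  assumes "y \<in> K"
  shows "(if s then zigzag l m v y else - zigzag l m v y) =
    (if s then v else 0) + (half y s + (half y s + (if s then 0 else - v)))"
  using assms by (auto simp: zigzag_def half_def minus_add add.assoc zig_uminus)

lemma half_alt: "y \<in> K - R \<Longrightarrow> k \<in> K \<Longrightarrow> \<exists>us. altS s us \<and> length us = 4 \<and> sum_list us = half y s + k"
  using zig_alt[of y k] free_pair.zig_alt[OF swap, of "- y" k] notR_uminus[of y] by (auto simp: altS_def half_def)

text \<open>The first half of the first power is split off, so that each step of the induction meets
  the back half of one power, a coefficient and the front half of the next, which is the shape of
  \<open>junction\<close>.\<close>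

lemma reduced_alt:
  assumes v: "v \<in> K" and "word_ok ((y, s, g) # ws)" "reduced ((y, s, g) # ws)"
  shows "\<exists>us. altS s us \<and> Suc (length ws) \<le> length us \<and>
    wval (zigzag l m v) ((y, s, g) # ws) = (if s then v else 0) + (half y s + sum_list us)"
  using assms(2,3)
proof (induction ws arbitrary: y s g)
  case Nil
  then have y: "y \<in> K - R" "g \<in> K" by (auto simp: word_ok_def)
  then have "(if s then 0 else - v) + g \<in> K" using v K by (auto intro!: subgroup_add subgroup_uminus subgroup_zero)
  from half_alt[OF y(1) this] obtain us where "altS s us" "length us = 4"
     "sum_list us = half y s + ((if s then 0 else - v) + g)" by blast
  then show ?case using y by (intro exI[of _ us]) (simp add: zigzag_half add.assoc)
next
  case (Cons a ws)
  obtain z t h where a: "a = (z, t, h)" by (cases a)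
  have y: "y \<in> K - R" "g \<in> K" "z \<in> K - R" and ok: "word_ok ((z, t, h) # ws)"
    using Cons.prems(1) a by (auto simp: word_ok_def)
  have rd: "y = z \<longrightarrow> s = t \<or> g \<noteq> 0" "reduced ((z, t, h) # ws)"
    using Cons.prems(2) a by (auto simp: reduced_Cons2)
  obtain us where us: "altS t us" "Suc (length ws) \<le> length us"
    "wval (zigzag l m v) ((z, t, h) # ws) = (if t then v else 0) + (half z t + sum_list us)"
    using Cons.IH[OF ok rd(2)] by blast
  \<comment> \<open>Besides \<open>g\<close>, the gap between the two halves collects the factors
    \<open>v\<close> of the adjacent powers: a positive power carries \<open>v\<close> in front, an
    inverted one \<open>- v\<close> at the end.\<close>
  define k where "k = (if s then 0 else - v) + (g + (if t then v else 0))"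
  have kK: "k \<in> K" using v K y by (auto simp: k_def intro!: subgroup_add subgroup_uminus subgroup_zero)
  have "y = z \<longrightarrow> s = t \<or> k \<noteq> 0"
  proof -
    have "k = - v + g + v" if "\<not> s" "t" using that by (simp add: k_def add.assoc)
    moreover have "g = 0" if "- v + g + v = 0"
      using that by (metis add.assoc add.right_neutral add_minus_cancel neg_eq_iff_add_eq_0 minus_minus right_minus)
    ultimately show ?thesis using rd(1) by (cases s; cases t) (auto simp: k_def)
  qed
  from junction[OF y(1,3) kK this] obtain ws' where ws': "altS s ws'" "odd (length ws') \<longleftrightarrow> s \<noteq> t"
      "sum_list ws' = half y s + k + half z t" by blast
  \<comment> \<open>An empty word has even length, so the signs agree; but two halves of equal sign
    together form an alternating word of length eight, whose value is not zero.\<close>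
  have ne: "1 \<le> length ws'"
  proof (cases ws')
    case Nil
    have sum0: "half y s + k + half z t = 0" using Nil ws'(3) by simp
    have "t = s" using Nil ws' by simp
    obtain ua where ua: "altS s ua" "length ua = 4" "sum_list ua = half y s + k" using half_alt[OF y(1) kK] by blast
    obtain ub where ub: "altS t ub" "length ub = 4" "sum_list ub = half z t + 0"
      using half_alt[OF y(3) subgroup_zero[OF K]] by blast
    have "sum_list (ua @ ub) = 0" using ua ub sum0 by (simp add: add.assoc)
    moreover have "alt A B (ua @ ub) \<or> alt B A (ua @ ub)"
      using ua ub \<open>t = s\<close> by (auto simp: altS_def alt_append split: if_splits)
    moreover have "ua @ ub \<noteq> []" using ua by auto
    ultimately show ?thesis using amalgam_nonzero[OF am] by blast
  qed (use Nil in simp)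
  have "altS s (ws' @ us)" using ws' us by (auto simp: altS_def alt_append)
  moreover have "Suc (length (a # ws)) \<le> length (ws' @ us)" using us ne by simp
  moreover have "wval (zigzag l m v) ((y, s, g) # a # ws) = (if s then v else 0) + (half y s + sum_list (ws' @ us))"
  proof -
    have "wval (zigzag l m v) ((y, s, g) # a # ws) =
       (if s then zigzag l m v y else - zigzag l m v y) + (g + wval (zigzag l m v) ((z, t, h) # ws))"
      using a by simp
    also have "\<dots> = (if s then v else 0) + (half y s + (half y s + (if s then 0 else - v))) +
        (g + ((if t then v else 0) + (half z t + sum_list us)))"
      by (simp only: us(3)) (use zigzag_half y in simp)
    also have "\<dots> = (if s then v else 0) + (half y s + ((half y s + k + half z t) + sum_list us))"
      by (simp only: k_def add.assoc)
    finally show ?thesis using ws'(3) by simp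
  qed
  ultimately show ?case by blast
qed

text \<open>The first half is attached again, its first syllable absorbing the coefficient. The
  bound grows with the word, which makes long powers long, and is at least five for a nonempty word,
  which excludes values in \<open>A\<close> or \<open>B\<close>.\<close>

lemma reduced_long:
  assumes v: "v \<in> K" and g: "g \<in> K" and ws: "word_ok ws" "reduced ws" "ws \<noteq> []"
  obtains us where "alt A B us \<or> alt B A us" "length ws + 4 \<le> length us"
    "sum_list us = g + wval (zigzag l m v) ws"
proof -
  obtain y s h ws' where a: "ws = (y, s, h) # ws'" using ws(3) by (metis list.exhaust surj_pair)
  obtain us where us: "altS s us" "Suc (length ws') \<le> length us"
    "wval (zigzag l m v) ws = (if s then v else 0) + (half y s + sum_list us)"
    using reduced_alt[OF v] ws a by blast
  have "y \<in> K - R" using ws a by (auto simp: word_ok_def)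
  then obtain ua where ua: "altS s ua" "length ua = 4" "sum_list ua = half y s + 0"
    using half_alt[OF _ subgroup_zero[OF K]] by blast
  obtain w ub where w: "ua = w # ub" using ua(2) by (cases ua) auto
  define c where "c = g + (if s then v else 0)"
  have "c \<in> K" using v g K by (cases s) (simp_all add: c_def subgroup_add)
  then have "c \<in> A \<inter> B" using KA KB by blast
  then have "altS s ((c + w) # ub)"
    using ua(1) w alt_absorb(1)[OF sA sB] alt_absorb(1)[OF sB sA] by (auto simp: altS_def)
  then have "altS s (((c + w) # ub) @ us)"
    using us(1) ua(2) w by (auto simp: altS_def alt_append)
  moreover have "w + (sum_list ub + sum_list us) = half y s + sum_list us"
    using ua(3) w by (simp add: add.assoc[symmetric])
  then have "sum_list (((c + w) # ub) @ us) = g + wval (zigzag l m v) ws"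
    using us(3) by (simp add: c_def add.assoc)
  moreover have "length ws + 4 \<le> length (((c + w) # ub) @ us)" using us(2) a ua(2) w by simp
  moreover have "alt A B (((c + w) # ub) @ us) \<or> alt B A (((c + w) # ub) @ us)"
    using calculation(1) by (auto simp only: altS_def split: if_splits)
  ultimately show thesis using that by blast
qed

definition letters :: "('g + 'g \<times> bool) set" where
  "letters = Inl ` K \<union> Inr ` ((K - R) \<times> UNIV)"

lemma reduce_letters:
  assumes "set L \<subseteq> letters"
  shows "\<exists>g ws. g \<in> K \<and> word_ok ws \<and> reduced ws \<and> (\<forall>\<gamma>. sum_list (map (letter \<gamma>) L) = g + wval \<gamma> ws)"
  using assms
proof (induction L)
  case Nil
  then show ?case using K by (intro exI[of _ 0] exI[of _ "[]"]) (auto simp: subgroup_zero word_ok_def reduced_def)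
next
  case (Cons x L)
  then obtain g ws where IH: "g \<in> K" "word_ok ws" "reduced ws"
      "\<And>\<gamma>. sum_list (map (letter \<gamma>) L) = g + wval \<gamma> ws" by auto
  show ?case
  proof (cases x)
    case (Inl h)
    then have "h \<in> K" using Cons.prems by (auto simp: letters_def)
    then show ?thesis using IH Inl K
      by (intro exI[of _ "h + g"] exI[of _ ws]) (auto simp: add.assoc subgroup_add)
  next
    case (Inr p)
    obtain y s where p: "p = (y, s)" by (cases p)
    have y: "y \<in> K - R" using Cons.prems Inr p by (auto simp: letters_def)
    show ?thesis
    proof (cases "\<exists>h us. ws = (y, \<not> s, h) # us \<and> g = 0")
      case True
      then obtain h us where us: "ws = (y, \<not> s, h) # us" "g = 0" by blast
      then show ?thesis using IH Inr p reduced_tl[of "(y, \<not> s, h)" us]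
        by (intro exI[of _ h] exI[of _ us]) (auto simp: word_ok_def)
    next
      case False
      have "reduced ((y, s, g) # ws)"
      proof (cases ws)
        case (Cons b us)
        then show ?thesis using IH(3) False by (cases b) (auto simp: reduced_Cons2)
      qed (simp add: reduced_def)
      then show ?thesis using IH y Inr p K
        by (intro exI[of _ 0] exI[of _ "(y, s, g) # ws"]) (auto simp: word_ok_def subgroup_zero)
    qed
  qed
qed

definition core :: "'g \<Rightarrow> 'g set" where
  "core v = {sum_list (map (letter (zigzag l m v)) L) |L. set L \<subseteq> letters}"

lemma letters_uminus:
  "x \<in> letters \<Longrightarrow> (case x of Inl g \<Rightarrow> Inl (- g) | Inr (y, s) \<Rightarrow> Inr (y, \<not> s)) \<in> letters"
  using K by (auto simp: letters_def subgroup_uminus)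

text \<open>A word of value zero reduces formally to the empty word, so it vanishes for every choice
  of \<open>\<gamma>\<close>. This is the statement that the zigzags are free over
  \<open>K\<close>.\<close>

lemma core_kernel:
  assumes "v \<in> K" "set L \<subseteq> letters" "sum_list (map (letter (zigzag l m v)) L) = 0"
  shows "sum_list (map (letter \<gamma>) L) = 0"
proof -
  obtain g ws where g: "g \<in> K" "word_ok ws" "reduced ws"
    "\<forall>\<gamma>. sum_list (map (letter \<gamma>) L) = g + wval \<gamma> ws" using reduce_letters[OF assms(2)] by blast
  have "ws = []"
  proof (rule ccontr)
    assume "ws \<noteq> []"
    then obtain us where us: "alt A B us \<or> alt B A us" "length ws + 4 \<le> length us"
      "sum_list us = g + wval (zigzag l m v) ws" using reduced_long[OF assms(1) g(1-3)] by blast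
    then show False using amalgam_nonzero[OF am _ us(1)] assms(3) g(4) by fastforce
  qed
  then show ?thesis using g assms(3) by simp
qed

lemma core_elem:
  assumes "c \<in> core v"
  obtains g ws where "g \<in> K" "word_ok ws" "reduced ws" "c = g + wval (zigzag l m v) ws"
proof -
  obtain L where L: "c = sum_list (map (letter (zigzag l m v)) L)" "set L \<subseteq> letters"
    using assms unfolding core_def by blast
  obtain g ws where "g \<in> K" "word_ok ws" "reduced ws" "\<forall>\<gamma>. sum_list (map (letter \<gamma>) L) = g + wval \<gamma> ws"
    using reduce_letters[OF L(2)] by blast
  then show thesis using that L(1) by blast
qed

lemma core_subgroup: "is_subgroup (core v)"
  unfolding core_def using letters_uminus letter_uminus by (rule subgroup_words)

lemma K_core: "K \<subseteq> core v"
proof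
  fix g assume "g \<in> K"
  then show "g \<in> core v" unfolding core_def by (intro CollectI exI[of _ "[Inl g]"]) (auto simp: letters_def)
qed

lemma zigzag_core: "y \<in> K - R \<Longrightarrow> zigzag l m v y \<in> core v"
  unfolding core_def by (intro CollectI exI[of _ "[Inr (y, True)]"]) (auto simp: letters_def)

lemma zigzag_join: "v \<in> K \<Longrightarrow> y \<in> K \<Longrightarrow> zigzag l m v y \<in> join A B"
proof -
  assume v: "v \<in> K" "y \<in> K"
  have "v \<in> A" "l y \<in> A" "m y \<in> B" using v KA lA mB by blast+
  then have "v \<in> join A B" "l y \<in> join A B" "m y \<in> join A B"
    by (simp_all add: subsetD[OF join_upper(1)] subsetD[OF join_upper(2)])
  then show ?thesis unfolding zigzag_def zig_def by (intro subgroup_add[OF subgroup_join[OF sA sB]])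
qed

lemma core_join: "v \<in> K \<Longrightarrow> core v \<subseteq> join A B"
proof -
  assume v: "v \<in> K"
  have J: "is_subgroup (join A B)" using sA sB by (rule subgroup_join)
  have "letter (zigzag l m v) x \<in> join A B" if "x \<in> letters" for x
    using that v zigzag_join[OF v] J subset_trans[OF KA join_upper(1)[of A B]]
    by (auto simp: letters_def subgroup_uminus subset_iff)
  then show ?thesis unfolding core_def using J by (auto simp: subset_iff intro!: subgroup_sum_list)
qed

section \<open>The core against conjugates of \<open>A\<close> and \<open>B\<close>\<close>

lemma core_Int:
  assumes "v \<in> K" "c \<in> core v" "c \<in> A \<or> c \<in> B"
  shows "c \<in> K"
proof -
  obtain g ws where g: "g \<in> K" "word_ok ws" "reduced ws" "c = g + wval (zigzag l m v) ws"
    using core_elem[OF assms(2)] .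
  have "ws = []"
  proof (rule ccontr)
    assume "ws \<noteq> []"
    then obtain us where us: "alt A B us \<or> alt B A us" "length ws + 4 \<le> length us"
      "sum_list us = g + wval (zigzag l m v) ws" using reduced_long[OF assms(1) g(1-3)] by blast
    then show False using alt_long_notin[OF am us(1)] assms(3) g(4) by auto
  qed
  then show ?thesis using g by simp
qed

text \<open>Powers of an element conjugate into \<open>A \<union> B\<close> by a word of length
  \<open>length xs\<close> have length at most \<open>2 * length xs + 1\<close>, whereas the powers
  of a cyclically reduced word grow; the exponent \<open>n\<close> just exceeds that bound.\<close>

lemma core_power_elliptic:
  assumes v: "v \<in> K" and ws: "word_ok ws" "ws \<noteq> []" and rd: "\<And>n. reduced (concat (replicate n ws))"
    and x: "x \<in> join A B"
  shows "x + wval (zigzag l m v) ws + - x \<notin> A \<union> B"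
proof
  let ?c = "wval (zigzag l m v) ws"
  assume s: "x + ?c + - x \<in> A \<union> B"
  obtain xs where xs: "set xs \<subseteq> A \<union> B" "x = sum_list xs" using x by (auto simp: join_def)
  define n where "n = 2 * length xs + 2"
  define t where "t = nmul n (x + ?c + - x)"
  have t: "t \<in> A \<union> B" using s sA sB by (auto simp: t_def subgroup_nmul)
  have "word_ok (concat (replicate n ws))" using ws(1) by (auto simp: word_ok_def)
  moreover have "concat (replicate n ws) \<noteq> []" using ws(2) by (simp add: n_def)
  ultimately obtain us where us: "alt A B us \<or> alt B A us" "length (concat (replicate n ws)) + 4 \<le> length us"
      "sum_list us = 0 + wval (zigzag l m v) (concat (replicate n ws))"
    using reduced_long[OF v subgroup_zero[OF K] _ rd] by blast
  have "n \<le> n * length ws" using ws(2) by (cases ws) auto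
  moreover have "length (concat (replicate n ws)) = n * length ws" by (induction n) auto
  ultimately have len: "n \<le> length us" using us(2) by linarith
  have "t = x + nmul n ?c + - x" by (simp only: t_def nmul_conj)
  then have "sum_list us = - x + t + x"
    using us(3) by (simp add: nmul_wval[symmetric] add.assoc)
  also have "\<dots> = sum_list (map uminus (rev xs) @ [t] @ xs)"
    unfolding sum_list_append sum_list_rev_uminus using xs(2) by (simp add: add.assoc)
  finally have "length us \<le> length (map uminus (rev xs) @ [t] @ xs)"
    using xs(1) t sA sB by (intro alt_length_le[OF am us(1)]) (auto simp: subgroup_uminus_iff)
  then show False using len by (simp add: n_def)
qed

lemma reduced_power:
  assumes "reduced ws" "ws \<noteq> []" "reduced [last ws, hd ws]"
  shows "reduced (concat (replicate n ws))"
proof (induction n)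
  case (Suc n)
  have "hd (concat (replicate n ws)) = hd ws" if "n \<noteq> 0" using that assms(2) by (cases n) auto
  then show ?case using Suc assms by (cases "n = 0") (auto simp: reduced_def successively_append_iff)
qed (simp add: reduced_def)

text \<open>Cyclic reduction inside the core. If the last and the first letter cancel, conjugation
  by the first letter and its coefficient removes both and keeps the element elliptic. If they do
  not, all powers are reduced, and \<open>core_power_elliptic\<close> leaves only the empty word. A
  coefficient left at the end is absorbed by the last letter.\<close>

lemma core_elliptic:
  assumes v: "v \<in> K" and "c \<in> core v" "x \<in> join A B" "x + c + - x \<in> A \<union> B"
  shows "\<exists>f\<in>core v. - f + c + f \<in> K"
proof -
  have J: "is_subgroup (join A B)" using sA sB by (rule subgroup_join)
  let ?w = "wval (zigzag l m v)"
  have conj: "\<exists>f\<in>core v. - f + c + f \<in> K"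
    if t: "g \<in> core v" "\<exists>f\<in>core v. - f + (- g + c + g) + f \<in> K" for g c
  proof -
    from t(2) obtain f where "f \<in> core v" "- f + (- g + c + g) + f \<in> K" by blast
    then show ?thesis using t(1) core_subgroup
      by (intro bexI[of _ "g + f"]) (auto simp: subgroup_add minus_add add.assoc)
  qed
  have conjx: "\<exists>y\<in>join A B. y + (- g + c + g) + - y \<in> A \<union> B"
    if "g \<in> core v" "x \<in> join A B" "x + c + - x \<in> A \<union> B" for g c x
    using that J core_join[OF v] by (intro bexI[of _ "x + g"]) (auto simp: subgroup_add minus_add add.assoc)
  have tail: "\<exists>us. word_ok us \<and> reduced us \<and> length us = length ws \<and> us \<noteq> [] \<and> ?w us = ?w ws + g"
    if t: "word_ok ws" "reduced ws" "ws \<noteq> []" "g \<in> K" for ws g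
  proof -
    obtain us y s h where ws: "ws = us @ [(y, s, h)]" using t(3) by (metis rev_exhaust surj_pair)
    then show ?thesis using t K reduced_snoc[of us y s h "h + g"]
      by (intro exI[of _ "us @ [(y, s, h + g)]"]) (auto simp: word_ok_def wval_append add.assoc subgroup_add)
  qed
  have main: "\<exists>f\<in>core v. - f + ?w ws + f \<in> K"
    if "word_ok ws" "reduced ws" "\<exists>x\<in>join A B. x + ?w ws + - x \<in> A \<union> B" for ws
    using that
  proof (induction "length ws" arbitrary: ws rule: less_induct)
    case less
    consider "ws = []" | "ws \<noteq> []" "reduced [last ws, hd ws]" | "ws \<noteq> []" "\<not> reduced [last ws, hd ws]" by blast
    then show ?case
    proof cases
      case 1
      then show ?thesis using subgroup_zero[OF K] subgroup_zero[OF core_subgroup, of v] by auto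
    next
      case 2
      then show ?thesis using core_power_elliptic[OF v less.prems(1) 2(1) reduced_power[OF less.prems(2) 2]] less.prems(3) by blast
    next
      case 3
      obtain y s g ws' where ws1: "ws = (y, s, g) # ws'" using 3(1) by (metis list.exhaust surj_pair)
      have "ws' \<noteq> []" using 3 ws1 by (auto simp: reduced_def)
      then obtain us y' s' g' where ws2: "ws' = us @ [(y', s', g')]" by (metis rev_exhaust surj_pair)
      have bad: "y' = y" "s' = (\<not> s)" "g' = 0" using 3(2) ws1 ws2 by (auto simp: reduced_def)
      define \<gamma> where "\<gamma> = (if s then zigzag l m v y else - zigzag l m v y)"
      have yg: "y \<in> K - R" "g \<in> K" "word_ok us" using less.prems(1) ws1 ws2 by (auto simp: word_ok_def)
      have gc: "\<gamma> \<in> core v" unfolding \<gamma>_def using zigzag_core[OF yg(1)] core_subgroup by (auto simp: subgroup_uminus)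
      have gg: "\<gamma> + g \<in> core v" using gc yg K_core core_subgroup by (auto intro!: subgroup_add)
      have eq: "- (\<gamma> + g) + ?w ws + (\<gamma> + g) = ?w us + g"
        using bad by (auto simp: ws1 ws2 wval_append \<gamma>_def minus_add add.assoc)
      have ex: "\<exists>x\<in>join A B. x + (?w us + g) + - x \<in> A \<union> B"
        using less.prems(3) conjx[OF gg] unfolding eq[symmetric] by blast
      have rus: "reduced us"
        using reduced_tl[of "(y, s, g)" ws'] less.prems(2) ws1 ws2
        by (auto simp: reduced_def successively_append_iff)
      have "\<exists>f\<in>core v. - f + (?w us + g) + f \<in> K"
      proof (cases "us = []")
        case True
        then show ?thesis using yg subgroup_zero[OF core_subgroup, of v] by (auto intro!: bexI[of _ 0])
      next
        case False
        obtain us' where us': "word_ok us'" "reduced us'" "length us' = length us" "?w us' = ?w us + g"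
          using tail[OF yg(3) rus False yg(2)] by blast
        then show ?thesis using less.hyps[of us'] ex ws1 ws2 by auto
      qed
      then show ?thesis using conj[OF gg] eq by metis
    qed
  qed
  obtain g ws where g: "g \<in> K" "word_ok ws" "reduced ws" "c = g + ?w ws"
    using core_elem[OF assms(2)] .
  have gc: "g \<in> core v" using g K_core by blast
  have eq: "- g + c + g = ?w ws + g" using g(4) by (simp add: add.assoc)
  have ex: "\<exists>x\<in>join A B. x + (?w ws + g) + - x \<in> A \<union> B"
    using conjx[OF gc assms(3,4)] unfolding eq .
  have "\<exists>f\<in>core v. - f + (?w ws + g) + f \<in> K"
  proof (cases "ws = []")
    case True
    then show ?thesis using g subgroup_zero[OF core_subgroup, of v] by (auto intro!: bexI[of _ 0])
  next
    case False
    from tail[OF g(2,3) False g(1)] main ex show ?thesis by metis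
  qed
  then show ?thesis using conj[OF gc] eq by metis
qed

section \<open>Malnormality of \<open>K\<close> and its two copies\<close>

lemma malnormal_K_A: "malnormal K A"
proof (rule malnormal_amalgam[OF aml K])
  show "malnormal K K" by (simp add: malnormal_def)
  fix c a b assume c: "c \<in> K \<inter> l ` K" "c \<noteq> 0" and b: "b \<in> l ` K" "b \<notin> K"
  obtain y where y: "y \<in> K" "b = l y" "y \<notin> R" using b lK by blast
  obtain r where r: "r \<in> R" "c = l r" using c lK by blast
  have "b + c + - b = l (y + r + - y)"
    using y r RK K l_additive by (auto simp: additive_on_add additive_on_uminus subgroup_add subgroup_uminus subsetD)
  moreover have "y + r + - y \<in> K" using y r RK K by (auto intro!: subgroup_add subgroup_uminus)
  moreover have "r \<noteq> 0" using c r additive_on_zero[OF K l_additive] by auto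
  ultimately show "b + c + - b \<notin> K" using l_in_K malnormalD[OF malR y(1) r(1)] y(3) by metis
qed

text \<open>Counterpart of \<open>malnormal_K_A\<close> for the other factor. There the conjugator
  lies in the copy of \<open>K\<close>, and \<open>malR\<close> is transported by \<open>l\<close>;
  here it lies in \<open>K\<close>, where the intersection of the factors is the image of
  \<open>R\<close>, and \<open>mal_lR\<close> decides.\<close>

lemma malnormal_lK_A: "malnormal (l ` K) A"
proof -
  have "malnormal (l ` K) (join (l ` K) K)"
  proof (rule malnormal_amalgam[OF amalgam_sym[OF aml] subgroup_image[OF K l_additive]])
    show "malnormal (l ` K) (l ` K)" by (simp add: malnormal_def)
    show "b + c + - b \<notin> l ` K" if hyp: "c \<in> l ` K \<inter> K" "c \<noteq> 0" "b \<in> K" "b \<notin> l ` K" for c b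
    proof
      assume *: "b + c + - b \<in> l ` K"
      have c: "c \<in> l ` R" using hyp lK by blast
      have "b + c + - b \<in> K" using hyp K by (auto intro!: subgroup_add subgroup_uminus)
      then have "b + c + - b \<in> l ` R" using * lK by blast
      then have "b \<in> l ` R" using malnormalD[OF mal_lR hyp(3) c hyp(2)] by blast
      then show False using hyp RK by blast
    qed
  qed
  then show ?thesis by (simp add: join_sym)
qed

lemma malnormal_A: "malnormal A (join A B)"
proof (rule malnormal_amalgam[OF am sA])
  show "malnormal A A" by (simp add: malnormal_def)
  show "b + c + - b \<notin> A" if hyp: "c \<in> A \<inter> B" "c \<noteq> 0" "b \<in> B" "b \<notin> A" for c b
  proof
    assume "b + c + - b \<in> A"
    moreover have "b + c + - b \<in> B" using hyp sB by (auto intro!: subgroup_add subgroup_uminus)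
    ultimately have "b + c + - b \<in> K" using Pint by blast
    then have "b \<in> K" using malnormalD[OF free_pair.malnormal_K_A[OF swap] hyp(3)] hyp Pint by blast
    then show False using hyp KA by blast
  qed
qed

lemma malnormal_K: "malnormal K (join A B)"
  using malnormal_trans[OF malnormal_K_A malnormal_A] .

lemma malnormal_lK: "malnormal (l ` K) (join A B)"
  using malnormal_trans[OF malnormal_lK_A malnormal_A] .

lemma malnormal_mK: "malnormal (m ` K) (join A B)"
  using free_pair.malnormal_lK[OF swap] by (simp add: join_sym)

end

subsection \<open>Groups of permutations\<close>

text \<open>Permutations provide the ambient groups. Every countable group embeds into
  \<open>nat sym\<close>, so all stages of the construction can be subsets of one type and their
  union makes sense.\<close>

typedef 'a sym = "{f :: 'a \<Rightarrow> 'a. bij f}" morphisms app Sym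
  by (auto intro: exI[of _ id])

instantiation sym :: (type) group_add
begin

definition "0 = Sym id"
definition "f + g = Sym (app f \<circ> app g)"
definition "- f = Sym (inv_into UNIV (app f))"
definition "f - g = f + - (g :: 'a sym)"

instance
proof
  have b: "bij (app f)" for f :: "'a sym" using app[of f] by simp
  note defs = zero_sym_def plus_sym_def uminus_sym_def
  fix f g h :: "'a sym"
  show "f + g + h = f + (g + h)"
    by (simp add: defs Sym_inverse bij_comp b comp_assoc)
  show "0 + f = f" "f + 0 = f" by (simp_all add: defs Sym_inverse app_inverse)
  show "- f + f = 0"
    by (simp add: defs Sym_inverse b bij_imp_bij_inv inv_o_cancel bij_is_inj)
  show "f + - g = f - g" by (simp add: minus_sym_def)
qed

end

lemma bij_app: "bij (app f)"
  using app[of f] by simp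

lemma app_zero [simp]: "app 0 x = x"
  by (simp add: zero_sym_def Sym_inverse)

lemma app_add [simp]: "app (f + g) x = app f (app g x)"
  by (simp add: plus_sym_def Sym_inverse bij_comp bij_app)

lemma app_uminus [simp]: "app (- f) (app f x) = x" "app f (app (- f) x) = x"
  by (simp_all flip: app_add)

lemma app_Sym: "bij f \<Longrightarrow> app (Sym f) = f"
  by (simp add: Sym_inverse)

lemma sym_eqI: "(\<And>x. app f x = app g x) \<Longrightarrow> f = g"
  by (metis app_inject ext)

lemma amalgam_image:
  assumes am: "amalgam A B" and S: "is_subgroup S" "A \<subseteq> S" "B \<subseteq> S" and f: "embeds S f"
  shows "amalgam (f ` A) (f ` B)"
proof -
  have fa: "additive_on S f" and fi: "inj_on f S" using f by (auto simp: embeds_def)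
  have lift: "\<exists>vs. alt A B vs \<and> ws = map f vs" if "alt (f ` A) (f ` B) ws" "A \<subseteq> S" "B \<subseteq> S" for A B ws
    using that
  proof (induction ws arbitrary: A B)
    case (Cons w ws)
    then obtain a where "a \<in> A" "w = f a" by auto
    with Cons.prems have a: "a \<in> A" "w = f a" "a \<notin> B" "alt (f ` B) (f ` A) ws" by auto
    from Cons.IH[OF a(4) Cons.prems(3,2)] obtain vs where "alt B A vs" "ws = map f vs" by blast
    then show ?case using a by (intro exI[of _ "a # vs"]) auto
  qed simp
  have nz: "sum_list ws \<noteq> 0"
    if am: "amalgam A B" "A \<subseteq> S" "B \<subseteq> S" and ws: "ws \<noteq> []" "alt (f ` A) (f ` B) ws" for A B ws
  proof
    assume 0: "sum_list ws = 0"
    obtain vs where vs: "alt A B vs" "ws = map f vs" using lift[OF ws(2) am(2,3)] by blast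
    have sub: "set vs \<subseteq> S" using alt_subset[OF vs(1)] am by blast
    then have "f (sum_list vs) = 0" using 0 vs additive_on_sum_list[OF S(1) fa] by simp
    then have "sum_list vs = 0" using embeds_zero_iff[OF S(1) f] subgroup_sum_list[OF S(1) sub] by blast
    then show False using amalgam_nonzero[OF am(1)] vs ws(1) by blast
  qed
  show ?thesis
    unfolding amalgam_def
    using nz[OF am S(2,3)] nz[OF amalgam_sym[OF am] S(3,2)] amalgam_subgroup[OF am]
      subgroup_image additive_on_subset[OF fa S(2)] additive_on_subset[OF fa S(3)] by blast
qed

subsection \<open>Coset representatives\<close>

text \<open>The predicate under the choice depends only on the right coset of \<open>p\<close>,
  hence so does the value. The coset \<open>C\<close> itself receives \<open>0\<close>, so that a
  zero representative signals that no syllable is to be written.\<close>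

definition rep :: "'g::group_add set \<Rightarrow> 'g \<Rightarrow> 'g" where
  "rep C p = (if p \<in> C then 0 else SOME q. \<exists>c\<in>C. q = c + p)"

context
  fixes C :: "'g::group_add set"
  assumes C: "is_subgroup C"
begin

lemma rep_coset: "\<exists>c\<in>C. rep C p = c + p"
proof (cases "p \<in> C")
  case True
  then show ?thesis using C by (intro bexI[of _ "- p"]) (auto simp: rep_def subgroup_uminus)
next
  case False
  have "\<exists>q. \<exists>c\<in>C. q = c + p" using subgroup_zero[OF C] by blast
  from someI_ex[OF this] show ?thesis using False by (simp add: rep_def)
qed

lemma rep_add: "c \<in> C \<Longrightarrow> rep C (c + p) = rep C p"
proof -
  assume c: "c \<in> C"
  have "(\<exists>d\<in>C. q = d + (c + p)) \<longleftrightarrow> (\<exists>d\<in>C. q = d + p)" for q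
  proof
    assume "\<exists>d\<in>C. q = d + (c + p)"
    then obtain d where "d \<in> C" "q = d + (c + p)" by blast
    then show "\<exists>d\<in>C. q = d + p" using c C by (intro bexI[of _ "d + c"]) (auto simp: add.assoc subgroup_add)
  next
    assume "\<exists>d\<in>C. q = d + p"
    then obtain d where "d \<in> C" "q = d + p" by blast
    then show "\<exists>d\<in>C. q = d + (c + p)" using c C
      by (intro bexI[of _ "d + - c"]) (auto simp: add.assoc subgroup_add subgroup_uminus)
  qed
  then show ?thesis using c C by (simp add: rep_def subgroup_add_left_iff)
qed

lemma rep_diff: "p + - rep C p \<in> C"
proof -
  obtain c where "c \<in> C" "rep C p = c + p" using rep_coset by blast
  then show ?thesis using C by (simp add: minus_add subgroup_uminus)
qed

lemma rep_rep: "rep C (rep C p) = rep C p"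
  using rep_coset[of p] rep_add by metis

lemma rep_zero_iff: "rep C p = 0 \<longleftrightarrow> p \<in> C"
proof
  assume "rep C p = 0"
  then show "p \<in> C" using rep_diff[of p] by simp
qed (simp add: rep_def)

lemma rep_in: "is_subgroup A \<Longrightarrow> C \<subseteq> A \<Longrightarrow> p \<in> A \<Longrightarrow> rep C p \<in> A"
  using rep_coset[of p] by (metis subgroup_add subsetD)

end

subsection \<open>Free actions on the natural numbers\<close>

text \<open>A subgroup is good if \<open>nat\<close> is a disjoint union of infinitely many regular orbits. Isomorphic good
  groups are conjugate, so extensions can be chosen to contain a given good group as a subset.\<close>

definition good :: "nat sym set \<Rightarrow> bool" where
  "good S \<longleftrightarrow> is_subgroup S \<and> (\<exists>b. bij_betw b UNIV (S \<times> (UNIV :: nat set)) \<and>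
     (\<forall>s\<in>S. \<forall>n. b (app s n) = (s + fst (b n), snd (b n))))"

lemma good_subgroup: "good S \<Longrightarrow> is_subgroup S"
  by (simp add: good_def)

lemma good_countable: "good S \<Longrightarrow> countable S"
proof -
  assume "good S"
  then obtain b :: "nat \<Rightarrow> nat sym \<times> nat" where b: "bij_betw b UNIV (S \<times> UNIV)" by (auto simp: good_def)
  have "s \<in> range (fst \<circ> b)" if "s \<in> S" for s
  proof -
    have "(s, 0) \<in> range b" using b that by (simp add: bij_betw_def)
    then obtain n where "b n = (s, 0)" by (metis imageE)
    then show ?thesis by (intro image_eqI[of _ _ n]) auto
  qed
  then have "S \<subseteq> range (fst \<circ> b)" by blast
  then show "countable S" by (rule countable_subset) simp
qed

lemma ex_bij_nat:
  assumes "countable S" "infinite S"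
  shows "\<exists>e :: nat \<Rightarrow> 'a. bij_betw e UNIV S"
  using assms by (metis bij_betw_from_nat_into)

text \<open>Left translation on \<open>S \<times> nat\<close>: the second factor supplies infinitely
  many regular orbits and makes the set infinite even if \<open>S\<close> is finite.\<close>

lemma cayley:
  fixes S :: "'g::group_add set"
  assumes S: "is_subgroup S" and "countable S"
  shows "\<exists>f :: 'g \<Rightarrow> nat sym. embeds S f \<and> good (f ` S)"
proof -
  have "infinite (S \<times> (UNIV :: nat set))"
    using subgroup_zero[OF S] by (auto simp: finite_cartesian_product_iff)
  then obtain e :: "nat \<Rightarrow> 'g \<times> nat" where e: "bij_betw e UNIV (S \<times> UNIV)"
    using ex_bij_nat assms(2) by (metis countable_SIGMA countableI_type)
  define d where "d = inv_into UNIV e"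
  have de: "d (e n) = n" for n using e by (simp add: d_def bij_betw_def)
  have ed: "e (d p) = p" if "fst p \<in> S" for p
    using that e unfolding d_def by (auto simp: bij_betw_def mem_Times_iff intro!: f_inv_into_f)
  have eS: "fst (e n) \<in> S" for n using bij_betwE[OF e] by (simp add: mem_Times_iff)
  define F where "F s n = d (s + fst (e n), snd (e n))" for s n
  have eF: "e (F s n) = (s + fst (e n), snd (e n))" if "s \<in> S" for s n
    unfolding F_def using that eS S by (intro ed) (auto simp: subgroup_add)
  have Fadd: "F s (F t n) = F (s + t) n" if "s \<in> S" "t \<in> S" for s t n
    using eF[OF that(2)] by (simp add: F_def[of s] F_def[of "s + t"] add.assoc)
  have F0: "F 0 n = n" for n by (simp add: F_def de)
  have bF: "bij (F s)" if "s \<in> S" for s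
    using that S Fadd F0 by (intro o_bij[of "F (- s)"]) (auto simp: fun_eq_iff subgroup_uminus)
  define f where "f s = Sym (F s)" for s
  have f: "app (f s) = F s" if "s \<in> S" for s using bF[OF that] by (simp add: f_def app_Sym)
  have add: "additive_on S f"
    unfolding additive_on_def using f Fadd S by (auto intro!: sym_eqI simp: subgroup_add)
  have emb: "embeds S f"
  proof (rule embedsI[OF S add])
    fix x assume x: "x \<in> S" "f x = 0"
    then have "F x 0 = 0" using f by (metis app_zero)
    then have "e 0 = (x + fst (e 0), snd (e 0))" using eF[OF x(1), of 0] by simp
    then have "x + fst (e 0) = 0 + fst (e 0)" by (metis fst_conv add_0)
    then show "x = 0" by (rule add_right_imp_eq)
  qed
  have "good (f ` S)"
    unfolding good_def
  proof (intro conjI exI[of _ "\<lambda>n. (f (fst (e n)), snd (e n))"] ballI allI)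
    show "is_subgroup (f ` S)" using subgroup_image[OF S add] .
    have "bij_betw (map_prod f id) (S \<times> UNIV) (f ` S \<times> (UNIV :: nat set))"
      using emb by (intro bij_betw_map_prod) (auto simp: embeds_def inj_on_imp_bij_betw)
    from bij_betw_trans[OF e this] show "bij_betw (\<lambda>n. (f (fst (e n)), snd (e n))) UNIV (f ` S \<times> UNIV)"
      by (simp add: comp_def map_prod_def case_prod_beta)
    fix t n assume "t \<in> f ` S"
    then obtain s where s: "s \<in> S" "t = f s" by blast
    show "(f (fst (e (app t n))), snd (e (app t n))) =
      (t + fst (f (fst (e n)), snd (e n)), snd (f (fst (e n)), snd (e n)))"
      using s f eF eS additive_on_add[OF add] by simp
  qed
  then show ?thesis using emb by blast
qed

lemma good_conj:
  assumes "good S"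
  shows "good ((\<lambda>x. \<sigma> + x + - \<sigma>) ` S)"
proof -
  let ?c = "\<lambda>x. \<sigma> + x + - \<sigma>"
  obtain b where S: "is_subgroup S" and b: "bij_betw b UNIV (S \<times> (UNIV :: nat set))"
    "\<And>s n. s \<in> S \<Longrightarrow> b (app s n) = (s + fst (b n), snd (b n))"
    using assms unfolding good_def by blast
  have add: "additive_on S ?c" by (simp add: additive_on_def add.assoc)
  have emb: "embeds S ?c"
    using S add by (rule embedsI) (metis add.assoc add.right_neutral add_minus_cancel minus_add_cancel right_minus left_minus)
  have "bij_betw (map_prod ?c id) (S \<times> UNIV) (?c ` S \<times> (UNIV :: nat set))"
    using emb by (intro bij_betw_map_prod) (auto simp: embeds_def inj_on_imp_bij_betw)
  from bij_betw_trans[OF bij_betw_trans[OF bij_app[of "- \<sigma>"] b(1)] this]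
  have 1: "bij_betw (\<lambda>n. (?c (fst (b (app (- \<sigma>) n))), snd (b (app (- \<sigma>) n)))) UNIV (?c ` S \<times> UNIV)"
    by (simp add: comp_def map_prod_def case_prod_beta)
  show ?thesis
    unfolding good_def
    by (intro conjI exI[of _ "\<lambda>n. (?c (fst (b (app (- \<sigma>) n))), snd (b (app (- \<sigma>) n)))"] ballI allI 1
        subgroup_image[OF S add]) (auto simp: b(2) add.assoc)
qed

text \<open>Cosets split regular orbits of \<open>P\<close> into regular orbits of \<open>A\<close>.
  With \<open>T\<close> a transversal of the image \<open>D\<close> of \<open>\<eta>\<close> in
  \<open>P\<close>, the coordinates \<open>P \<times> nat\<close> become
  \<open>A \<times> (T \<times> nat)\<close>, and \<open>T \<times> nat\<close> is again countably
  infinite. So both actions of \<open>A\<close> have the same orbit structure, and matching their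
  coordinates gives the conjugating permutation.\<close>

lemma good_conjugate:
  assumes A: "good A" and P: "good P" and \<eta>: "embeds A \<eta>" "\<eta> ` A \<subseteq> P"
  shows "\<exists>\<sigma>. \<forall>a\<in>A. \<sigma> + \<eta> a + - \<sigma> = a"
proof -
  obtain b where sA: "is_subgroup A" and b: "bij_betw b UNIV (A \<times> (UNIV :: nat set))"
    "\<And>s n. s \<in> A \<Longrightarrow> b (app s n) = (s + fst (b n), snd (b n))"
    using A unfolding good_def by blast
  obtain e where sP: "is_subgroup P" and e: "bij_betw e UNIV (P \<times> (UNIV :: nat set))"
    "\<And>s n. s \<in> P \<Longrightarrow> e (app s n) = (s + fst (e n), snd (e n))"
    using P unfolding good_def by blast
  have ea: "additive_on A \<eta>" and ei: "inj_on \<eta> A" using \<eta> by (auto simp: embeds_def)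
  define D where "D = \<eta> ` A"
  have D: "is_subgroup D" unfolding D_def using subgroup_image[OF sA ea] .
  define T where "T = rep D ` P"
  have TP: "T \<subseteq> P" unfolding T_def using rep_in[OF D sP] \<eta>(2) by (auto simp: D_def)
  define part where "part p = inv_into A \<eta> (p + - rep D p)" for p
  have part: "part p \<in> A" "\<eta> (part p) + rep D p = p" for p
  proof -
    have "p + - rep D p \<in> \<eta> ` A" using rep_diff[OF D] by (simp add: D_def)
    then show "part p \<in> A" "\<eta> (part p) + rep D p = p"
      unfolding part_def by (auto simp: inv_into_into f_inv_into_f add.assoc)
  qed
  have part_add: "part (\<eta> a + p) = a + part p" if "a \<in> A" for a p
  proof -
    have "\<eta> a \<in> D" using that by (simp add: D_def)
    have "\<eta> (part (\<eta> a + p)) + rep D p = \<eta> (a + part p) + rep D p"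
      using part(2)[of "\<eta> a + p"] part(2)[of p] rep_add[OF D \<open>\<eta> a \<in> D\<close>, of p]
        additive_on_add[OF ea that part(1)[of p]] by (simp add: add.assoc)
    then have "\<eta> (part (\<eta> a + p)) = \<eta> (a + part p)" by simp
    then show ?thesis using ei part(1) that sA by (auto simp: inj_on_eq_iff subgroup_add)
  qed
  have "infinite (T \<times> (UNIV :: nat set))"
    using subgroup_zero[OF sP] by (auto simp: T_def finite_cartesian_product_iff)
  moreover have "countable (T \<times> (UNIV :: nat set))"
    using good_countable[OF P] by (auto simp: T_def)
  ultimately obtain t0 :: "nat \<Rightarrow> nat sym \<times> nat" where t0: "bij_betw t0 UNIV (T \<times> UNIV)"
    using ex_bij_nat by blast
  define t where "t = inv_into UNIV t0"
  have t: "bij_betw t (T \<times> UNIV) UNIV" unfolding t_def using bij_betw_inv_into[OF t0] .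
  define G where "G n = (part (fst (e n)), t (rep D (fst (e n)), snd (e n)))" for n
  have eP: "fst (e n) \<in> P" for n using bij_betwE[OF e(1)] by (simp add: mem_Times_iff)
  have G: "bij_betw G UNIV (A \<times> (UNIV :: nat set))"
    unfolding bij_betw_def
  proof
    show "inj G"
    proof (rule injI)
      fix x y assume xy: "G x = G y"
      then have 1: "part (fst (e x)) = part (fst (e y))"
        and 2: "t (rep D (fst (e x)), snd (e x)) = t (rep D (fst (e y)), snd (e y))"
        by (auto simp: G_def)
      have "(rep D (fst (e x)), snd (e x)) = (rep D (fst (e y)), snd (e y))"
        using 2 t eP by (auto simp: bij_betw_def T_def inj_on_eq_iff)
      then have "fst (e x) = fst (e y)" "snd (e x) = snd (e y)" using 1 part(2) by (metis fst_conv, simp)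
      then have "e x = e y" by (simp add: prod_eq_iff)
      then show "x = y" using e(1) by (auto simp: bij_betw_def inj_eq)
    qed
    show "range G = A \<times> UNIV"
    proof (intro Set.set_eqI iffI)
      fix z assume "z \<in> A \<times> (UNIV :: nat set)"
      then obtain a k where z: "z = (a, k)" "a \<in> A" by blast
      have "k \<in> t ` (T \<times> UNIV)" using t by (simp add: bij_betw_def)
      then obtain q m where q: "q \<in> T" "t (q, m) = k" by blast
      have rq: "rep D q = q" using q(1) rep_rep[OF D] by (auto simp: T_def)
      have "\<eta> a + q \<in> P" using z q TP \<eta>(2) sP by (auto intro!: subgroup_add)
      then obtain n where n: "e n = (\<eta> a + q, m)" using e(1) by (metis bij_betw_def UNIV_I image_iff mem_Times_iff fst_conv snd_conv)
      have "\<eta> (part q) + q = 0 + q" using part(2)[of q] rq by simp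
      then have "\<eta> (part q) = 0" by (rule add_right_imp_eq)
      then have "part q = 0" using embeds_zero_iff[OF sA \<eta>(1)] part(1) by blast
      moreover have "rep D (\<eta> a + q) = q" using rep_add[OF D, of "\<eta> a" q] z rq by (simp add: D_def)
      ultimately have "G n = z" using n z q part_add by (simp add: G_def)
      then show "z \<in> range G" by blast
    qed (auto simp: G_def part(1))
  qed
  have Gact: "G (app (\<eta> a) n) = (a + fst (G n), snd (G n))" if "a \<in> A" for a n
  proof -
    have "\<eta> a \<in> P" "\<eta> a \<in> D" using that \<eta>(2) by (auto simp: D_def)
    then show ?thesis using e(2) part_add[OF that] rep_add[OF D] by (simp add: G_def)
  qed
  define s where "s n = inv_into UNIV b (G n)" for n
  have bs: "b (s n) = G n" for n
    unfolding s_def using b(1) G by (intro f_inv_into_f) (auto simp: bij_betw_def)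
  have "bij s"
  proof -
    have "bij_betw (inv_into UNIV b \<circ> G) UNIV UNIV" using bij_betw_trans[OF G bij_betw_inv_into[OF b(1)]] .
    then show ?thesis by (simp add: s_def[abs_def] comp_def)
  qed
  define \<sigma> where "\<sigma> = Sym s"
  have \<sigma>: "app \<sigma> = s" using \<open>bij s\<close> by (simp add: \<sigma>_def app_Sym)
  have eq: "\<sigma> + \<eta> a = a + \<sigma>" if "a \<in> A" for a
  proof (rule sym_eqI)
    fix n
    have "b (s (app (\<eta> a) n)) = b (app a (s n))" using that by (simp add: bs Gact b(2))
    then show "app (\<sigma> + \<eta> a) n = app (a + \<sigma>) n" using b(1) by (simp add: \<sigma> bij_betw_def inj_eq)
  qed
  show ?thesis using eq by (intro exI[of _ \<sigma>]) (simp add: add.assoc)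
qed

subsection \<open>Existence of amalgams\<close>

text \<open>Van der Waerden's argument: \<open>A\<close> acts on the normal forms \<open>(c, s\<^sub>1 \<dots> s\<^sub>n)\<close> by identifying them
  with the pairs consisting of an element of \<open>A\<close> and a normal form not starting in \<open>A\<close>.\<close>

locale normal_form_action =
  fixes A :: "'a::group_add set" and C :: "'c::group_add set" and i :: "'c \<Rightarrow> 'a"
    and tag :: "'a \<Rightarrow> 'l" and N :: "'l list set"
  assumes A: "is_subgroup A" and C: "is_subgroup C" and i: "embeds C i" "i ` C \<subseteq> A" and tag: "inj tag"
    and N: "\<And>s ls. tag s # ls \<in> N \<longleftrightarrow> s \<in> rep (i ` C) ` A \<and> s \<noteq> 0 \<and> ls \<in> N \<and> \<not> (\<exists>t us. ls = tag t # us)"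
begin

abbreviation "D \<equiv> i ` C"
abbreviation "X \<equiv> C \<times> N"
abbreviation "Y \<equiv> {(a, ls). a \<in> A \<and> ls \<in> N \<and> \<not> (\<exists>t us. ls = tag t # us)}"

definition dec :: "'c \<times> 'l list \<Rightarrow> 'a \<times> 'l list" where
  "dec p = (if \<exists>t us. snd p = tag t # us then (i (fst p) + inv_into UNIV tag (hd (snd p)), tl (snd p)) else (i (fst p), snd p))"

definition enc :: "'a \<times> 'l list \<Rightarrow> 'c \<times> 'l list" where
  "enc p = (inv_into C i (fst p + - rep D (fst p)),
     if rep D (fst p) = 0 then snd p else tag (rep D (fst p)) # snd p)"

text \<open>Left translation on the first component of \<open>Y\<close>, carried to \<open>X\<close>
  by the mutually inverse \<open>dec\<close> and \<open>enc\<close>. It is the identity off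
  \<open>X\<close>, so as to be a permutation of the whole type.\<close>

definition act :: "'a \<Rightarrow> 'c \<times> 'l list \<Rightarrow> 'c \<times> 'l list" where
  "act a p = (if p \<in> X then enc (a + fst (dec p), snd (dec p)) else p)"

lemma D: "is_subgroup D"
  using subgroup_image C i by (auto simp: embeds_def)

lemma ii: "inv_into C i (i c) = c" if "c \<in> C"
  using that i by (simp add: embeds_def)

lemma iD: "d \<in> D \<Longrightarrow> inv_into C i d \<in> C \<and> i (inv_into C i d) = d"
  by (simp add: f_inv_into_f inv_into_into)

lemma dec_Cons: "dec (c, tag s # ls) = (i c + s, ls)"
  using tag by (auto simp: dec_def)

lemma dec_other: "\<not> (\<exists>t us. ls = tag t # us) \<Longrightarrow> dec (c, ls) = (i c, ls)"
  by (auto simp: dec_def)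

lemma rep_A: "a \<in> A \<Longrightarrow> rep D a \<in> A"
  using rep_in[OF D A i(2)] .

lemma enc_dec:
  assumes "p \<in> X"
  shows "dec p \<in> Y" "enc (dec p) = p"
proof -
  obtain c ls where p: "p = (c, ls)" "c \<in> C" "ls \<in> N" using assms by blast
  have ic: "i c \<in> D" "i c \<in> A" using p i by auto
  show "dec p \<in> Y"
  proof (cases "\<exists>t us. ls = tag t # us")
    case True
    then obtain t us where t: "ls = tag t # us" by blast
    then have "t \<in> A" using p(3) N rep_A by auto
    then show ?thesis using p t N[of t us] ic A by (auto simp: dec_Cons subgroup_add)
  qed (use p ic in \<open>auto simp: dec_other\<close>)
  show "enc (dec p) = p"
  proof (cases "\<exists>t us. ls = tag t # us")
    case True
    then obtain t us where t: "ls = tag t # us" by blast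
    then obtain a where a: "a \<in> A" "t = rep D a" "t \<noteq> 0" using p(3) N by auto
    have "rep D (i c + t) = t" using rep_add[OF D ic(1)] rep_rep[OF D] a by simp
    then show ?thesis using p t a(3) by (simp add: dec_Cons enc_def add.assoc ii)
  next
    case False
    have "rep D (i c) = 0" using ic rep_zero_iff[OF D] by simp
    then show ?thesis using p False by (simp add: dec_other enc_def ii)
  qed
qed

lemma dec_enc:
  assumes "p \<in> Y"
  shows "enc p \<in> X" "dec (enc p) = p"
proof -
  obtain a ls where p: "p = (a, ls)" "a \<in> A" "ls \<in> N" "\<not> (\<exists>t us. ls = tag t # us)" using assms by blast
  have d: "inv_into C i (a + - rep D a) \<in> C" "i (inv_into C i (a + - rep D a)) = a + - rep D a"
    using iD rep_diff[OF D] by blast+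
  show "enc p \<in> X" using p d N by (auto simp: enc_def)
  show "dec (enc p) = p"
    using p d by (cases "rep D a = 0") (simp_all add: enc_def dec_Cons dec_other add.assoc)
qed

lemma act_X: "a \<in> A \<Longrightarrow> p \<in> X \<Longrightarrow> act a p \<in> X \<and> dec (act a p) = (a + fst (dec p), snd (dec p))"
proof -
  assume a: "a \<in> A" and p: "p \<in> X"
  have "(a + fst (dec p), snd (dec p)) \<in> Y" using enc_dec(1)[OF p] a A by (auto simp: subgroup_add)
  from dec_enc[OF this] show "act a p \<in> X \<and> dec (act a p) = (a + fst (dec p), snd (dec p))"
    using p by (auto simp: act_def)
qed

lemma act_add: "a \<in> A \<Longrightarrow> b \<in> A \<Longrightarrow> act a (act b p) = act (a + b) p"
proof (cases "p \<in> X")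
  case True
  assume "a \<in> A" "b \<in> A"
  then show ?thesis using act_X[of b p] True unfolding act_def[of a] act_def[of "a + b"] by (auto simp: add.assoc)
qed (auto simp: act_def)

lemma act_zero: "act 0 p = p"
  using enc_dec(2)[of p] by (simp add: act_def)

lemma bij_act: "a \<in> A \<Longrightarrow> bij (act a)"
  using A act_add act_zero by (intro o_bij[of "act (- a)"]) (auto simp: fun_eq_iff subgroup_uminus)

definition perm :: "'a \<Rightarrow> ('c \<times> 'l list) sym" where
  "perm a = Sym (act a)"

lemma app_perm: "a \<in> A \<Longrightarrow> app (perm a) = act a"
  by (simp add: perm_def app_Sym bij_act)

lemma perm_additive: "additive_on A perm"
  unfolding additive_on_def using A by (auto intro!: sym_eqI simp: app_perm act_add subgroup_add)

text \<open>The right-hand side mentions neither \<open>A\<close> nor \<open>i\<close>. Therefore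
  the actions of the two factors agree on the common subgroup.\<close>

lemma perm_C:
  assumes "d \<in> C"
  shows "perm (i d) = Sym (\<lambda>p. if p \<in> X then (d + fst p, snd p) else p)"
proof -
  have d: "i d \<in> A" "i d \<in> D" using assms i by auto
  have "act (i d) p = (if p \<in> X then (d + fst p, snd p) else p)" for p
  proof (cases "p \<in> X")
    case True
    have "dec (d + fst p, snd p) = (i d + fst (dec p), snd (dec p))"
      using True assms i C by (auto simp: dec_def embeds_def additive_on_add add.assoc)
    moreover have "(d + fst p, snd p) \<in> X" using True assms C by (auto simp: subgroup_add)
    ultimately show ?thesis using enc_dec(2)[of "(d + fst p, snd p)"] True by (simp add: act_def)
  qed (simp add: act_def)
  then have "act (i d) = (\<lambda>p. if p \<in> X then (d + fst p, snd p) else p)" by (rule ext)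
  then show ?thesis by (simp only: perm_def)
qed

lemma perm_grow:
  assumes "a \<in> A" "a \<notin> D" "(c, ls) \<in> X" "\<not> (\<exists>t us. ls = tag t # us)"
  shows "\<exists>d s. app (perm a) (c, ls) = (d, tag s # ls) \<and> (d, tag s # ls) \<in> X"
proof -
  have "i c \<in> D" using assms by auto
  then have "a + i c \<notin> D" using assms(2) D by (simp add: subgroup_add_right_iff)
  then have "rep D (a + i c) \<noteq> 0" using rep_zero_iff[OF D] by simp
  then have "act a (c, ls) = (inv_into C i (a + i c + - rep D (a + i c)), tag (rep D (a + i c)) # ls)"
    using assms by (simp add: act_def dec_other enc_def)
  then show ?thesis using act_X[OF assms(1,3)] assms(1)
    by (intro exI[of _ "inv_into C i (a + i c + - rep D (a + i c))"] exI[of _ "rep D (a + i c)"])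
      (auto simp: app_perm)
qed

end

text \<open>Both groups act on the same normal forms. An alternating word applied to the empty
  normal form writes down a list of its own length, so a nonempty word does not act as the
  identity.\<close>

lemma amalgam_exists_perm:
  fixes A :: "'a::group_add set" and B :: "'b::group_add set"
  assumes A: "is_subgroup A" and B: "is_subgroup B" and C: "is_subgroup C" "C \<subseteq> A"
    and \<theta>: "embeds C \<theta>" "\<theta> ` C \<subseteq> B"
  shows "\<exists>(f :: 'a \<Rightarrow> ('a \<times> ('a + 'b) list) sym) g. embeds A f \<and> embeds B g \<and> (\<forall>c\<in>C. f c = g (\<theta> c)) \<and>
    f ` A \<inter> g ` B = f ` C \<and> amalgam (f ` A) (g ` B)"
proof -
  define T where "T = (\<lambda>x. case x of Inl s \<Rightarrow> s \<in> rep C ` A \<and> s \<noteq> 0 | Inr t \<Rightarrow> t \<in> rep (\<theta> ` C) ` B \<and> t \<noteq> 0)"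
  define N where "N = {ls. (\<forall>x\<in>set ls. T x) \<and> successively (\<lambda>x y :: 'a + 'b. isl x \<noteq> isl y) ls}"
  have idC: "embeds C (\<lambda>x. x)" by (simp add: embeds_def additive_on_def)
  interpret P: normal_form_action A C "\<lambda>x. x" "Inl :: 'a \<Rightarrow> 'a + 'b" N
  proof
    show "Inl s # ls \<in> N \<longleftrightarrow> s \<in> rep ((\<lambda>x. x) ` C) ` A \<and> s \<noteq> 0 \<and> ls \<in> N \<and> \<not> (\<exists>t us. ls = Inl t # us)" for s ls
      by (cases ls) (auto simp: N_def T_def successively_Cons isl_def)
  qed (use A C idC in auto)
  interpret Q: normal_form_action B C \<theta> "Inr :: 'b \<Rightarrow> 'a + 'b" N
  proof
    show "Inr s # ls \<in> N \<longleftrightarrow> s \<in> rep (\<theta> ` C) ` B \<and> s \<noteq> 0 \<and> ls \<in> N \<and> \<not> (\<exists>t us. ls = Inr t # us)" for s ls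
      by (cases ls) (auto simp: N_def T_def successively_Cons isl_def split: sum.splits intro: sum.exhaust_sel)
  qed (use B C \<theta> in auto)
  define f g where "f = P.perm" and "g = Q.perm"
  have x0: "(0, []) \<in> C \<times> N" using subgroup_zero[OF C(1)] by (simp add: N_def)
  have fg: "f c = g (\<theta> c)" if "c \<in> C" for c
    using P.perm_C[OF that] Q.perm_C[OF that] by (simp add: f_def g_def)
  have fC: "app (f c) (0, []) = (c, [])" if "c \<in> C" for c
  proof -
    have "P.act c (0, []) = (c, [])"
      using that x0 C subgroup_zero[OF C(1)] rep_zero_iff[OF C(1), of c]
      by (simp add: P.act_def P.dec_other P.enc_def inv_into_f_f)
    then show ?thesis using P.app_perm[of c] that C by (auto simp: f_def)
  qed
  have fnC: "\<exists>d s. app (f a) p = (d, Inl s # snd p) \<and> (d, Inl s # snd p) \<in> C \<times> N"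
    if "a \<in> A" "a \<notin> C" "p \<in> C \<times> N" "\<not> (\<exists>t us. snd p = Inl t # us)" for a p
    using P.perm_grow[of a "fst p" "snd p"] that by (auto simp: f_def)
  have gnC: "\<exists>d s. app (g b) p = (d, Inr s # snd p) \<and> (d, Inr s # snd p) \<in> C \<times> N"
    if "b \<in> B" "b \<notin> \<theta> ` C" "p \<in> C \<times> N" "\<not> (\<exists>t us. snd p = Inr t # us)" for b p
    using Q.perm_grow[of b "fst p" "snd p"] that by (auto simp: g_def)
  have fe: "embeds A f"
  proof (rule embedsI[OF A])
    show "additive_on A f" unfolding f_def by (rule P.perm_additive)
    fix a assume a: "a \<in> A" "f a = 0"
    then have "app (f a) (0, []) = (0, [])" by simp
    then show "a = 0" using fC[of a] fnC[OF a(1) _ x0] by (cases "a \<in> C") auto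
  qed
  have ge: "embeds B g"
  proof (rule embedsI[OF B])
    show "additive_on B g" unfolding g_def by (rule Q.perm_additive)
    fix b assume b: "b \<in> B" "g b = 0"
    then have e: "app (g b) (0, []) = (0, [])" by simp
    then have "b \<in> \<theta> ` C" using gnC[OF b(1) _ x0] by auto
    then obtain c where c: "c \<in> C" "b = \<theta> c" by blast
    then have "c = 0" using fC[OF c(1)] fg[OF c(1)] e by simp
    then show "b = 0" using c additive_on_zero[OF C(1), of \<theta>] \<theta> by (simp add: embeds_def)
  qed
  have int: "f a \<in> f ` C" if ab: "a \<in> A" "b \<in> B" "f a = g b" for a b
  proof (rule ccontr)
    assume *: "f a \<notin> f ` C"
    then have a: "a \<notin> C" by blast
    have b: "b \<notin> \<theta> ` C" using * ab fg by auto
    show False using fnC[OF ab(1) a x0] gnC[OF ab(2) b x0] ab(3) by auto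
  qed
  have fgC: "f ` A \<inter> g ` B = f ` C"
  proof
    show "f ` A \<inter> g ` B \<subseteq> f ` C" using int by blast
    have "f c \<in> g ` B" if "c \<in> C" for c using fg[OF that] \<theta>(2) that by auto
    then show "f ` C \<subseteq> f ` A \<inter> g ` B" using C(2) by blast
  qed
  have word: "app (sum_list ws) (0, []) \<in> C \<times> N \<and>
      (alt (f ` A) (g ` B) ws \<longrightarrow> \<not> (\<exists>t us. snd (app (sum_list ws) (0, [])) = Inr t # us)) \<and>
      (alt (g ` B) (f ` A) ws \<longrightarrow> \<not> (\<exists>t us. snd (app (sum_list ws) (0, [])) = Inl t # us)) \<and>
      length (snd (app (sum_list ws) (0, []))) = length ws"
    if "alt (f ` A) (g ` B) ws \<or> alt (g ` B) (f ` A) ws" for ws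
    using that
  proof (induction ws)
    case Nil
    then show ?case using x0 by simp
  next
    case (Cons w ws)
    let ?p = "app (sum_list ws) (0, [])"
    from Cons.prems show ?case
    proof
      assume *: "alt (f ` A) (g ` B) (w # ws)"
      then obtain a where a: "a \<in> A" "w = f a" "a \<notin> C" using fg \<theta>(2) by auto
      have p: "?p \<in> C \<times> N" "\<not> (\<exists>t us. snd ?p = Inl t # us)" "length (snd ?p) = length ws"
        using Cons.IH * by auto
      from fnC[OF a(1,3) p(1,2)] obtain d s where "app (f a) ?p = (d, Inl s # snd ?p)"
          "(d, Inl s # snd ?p) \<in> C \<times> N" by blast
      then show ?case using a p(3) * by auto
    next
      assume *: "alt (g ` B) (f ` A) (w # ws)"
      then obtain b where b0: "b \<in> B" "w = g b" "w \<notin> f ` A" by auto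
      have "b \<notin> \<theta> ` C"
      proof
        assume "b \<in> \<theta> ` C"
        then obtain c where c: "c \<in> C" "b = \<theta> c" by blast
        then have "w = f c" using fg b0 by simp
        then show False using b0(3) c(1) C(2) by blast
      qed
      note b = b0(1,2) this
      have p: "?p \<in> C \<times> N" "\<not> (\<exists>t us. snd ?p = Inr t # us)" "length (snd ?p) = length ws"
        using Cons.IH * by auto
      from gnC[OF b(1,3) p(1,2)] obtain d s where "app (g b) ?p = (d, Inr s # snd ?p)"
          "(d, Inr s # snd ?p) \<in> C \<times> N" by blast
      then show ?case using b p(3) * by auto
    qed
  qed
  have "amalgam (f ` A) (g ` B)"
    unfolding amalgam_def
  proof (intro conjI allI impI)
    show "is_subgroup (f ` A)" "is_subgroup (g ` B)"
      using subgroup_image A B fe ge by (auto simp: embeds_def)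
    fix ws assume "ws \<noteq> []" "alt (f ` A) (g ` B) ws \<or> alt (g ` B) (f ` A) ws"
    from word[OF this(2)] this(1) show "sum_list ws \<noteq> 0" by auto
  qed
  then show ?thesis using fe ge fg fgC by blast
qed

lemma countable_join:
  assumes "countable A" "countable B"
  shows "countable (join A B)"
proof -
  have "join A B = sum_list ` lists (A \<union> B)" by (auto simp: join_def in_lists_conv_set)
  then show ?thesis using assms by (simp add: countable_lists)
qed

text \<open>The abstract amalgam is embedded into \<open>nat sym\<close> by \<open>cayley\<close>
  and then conjugated so that the copy of \<open>A\<close> becomes \<open>A\<close> itself,
  elementwise. Thus the first factor is kept as a subset, only the second is replaced by a copy, and
  the result is good again, ready for iteration.\<close>

lemma amalgam_exists:
  fixes A :: "nat sym set" and B :: "'b::group_add set"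
  assumes A: "good A" and B: "is_subgroup B" "countable B" and C: "is_subgroup C" "C \<subseteq> A"
    and \<theta>: "embeds C \<theta>" "\<theta> ` C \<subseteq> B"
  obtains \<beta> :: "'b \<Rightarrow> nat sym" where "embeds B \<beta>" "\<And>c. c \<in> C \<Longrightarrow> \<beta> (\<theta> c) = c" "A \<inter> \<beta> ` B = C"
    "amalgam A (\<beta> ` B)" "good (join A (\<beta> ` B))"
proof -
  note sA = good_subgroup[OF A]
  obtain f :: "nat sym \<Rightarrow> (nat sym \<times> (nat sym + 'b) list) sym" and g
    where f: "embeds A f" and g: "embeds B g" and fg: "\<And>c. c \<in> C \<Longrightarrow> f c = g (\<theta> c)"
      and int: "f ` A \<inter> g ` B = f ` C" and am: "amalgam (f ` A) (g ` B)"
    using amalgam_exists_perm[OF sA B(1) C \<theta>] by blast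
  define P where "P = join (f ` A) (g ` B)"
  have sP: "is_subgroup P" unfolding P_def using am amalgam_subgroup subgroup_join by blast
  have fP: "f ` A \<subseteq> P" and gP: "g ` B \<subseteq> P" unfolding P_def by (rule join_upper)+
  have "countable P" unfolding P_def using good_countable[OF A] B(2) by (intro countable_join countable_image)
  then obtain k :: "_ \<Rightarrow> nat sym" where k: "embeds P k" "good (k ` P)" using cayley[OF sP] by blast
  have kf: "embeds A (k \<circ> f)" using embeds_comp[OF f embeds_subset[OF k(1) fP]] .
  have "(k \<circ> f) ` A \<subseteq> k ` P" using fP by auto
  then obtain \<sigma> where \<sigma>: "\<And>a. a \<in> A \<Longrightarrow> \<sigma> + (k \<circ> f) a + - \<sigma> = a"
    using good_conjugate[OF A k(2) kf] by blast
  define \<kappa> where "\<kappa> x = \<sigma> + k x + - \<sigma>" for x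
  have kadd: "additive_on P k" "inj_on k P" using k by (auto simp: embeds_def)
  have \<kappa>: "embeds P \<kappa>"
  proof (rule embedsI[OF sP])
    show "additive_on P \<kappa>" using kadd by (auto simp: additive_on_def \<kappa>_def add.assoc)
    fix x assume x: "x \<in> P" "\<kappa> x = 0"
    then have "k x = 0"
      unfolding \<kappa>_def by (metis add.assoc add.right_neutral add_minus_cancel minus_add_cancel right_minus left_minus)
    then show "x = 0" using embeds_zero_iff[OF sP k(1)] x by blast
  qed
  have \<kappa>f: "\<kappa> (f a) = a" if "a \<in> A" for a using \<sigma>[OF that] by (simp add: \<kappa>_def)
  then have \<kappa>fA: "\<kappa> ` f ` A = A" by (force simp: image_iff)
  have \<kappa>P: "\<kappa> ` P = (\<lambda>x. \<sigma> + x + - \<sigma>) ` k ` P" by (auto simp: \<kappa>_def image_image)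
  have \<kappa>a: "additive_on P \<kappa>" and \<kappa>i: "inj_on \<kappa> P" using \<kappa> by (auto simp: embeds_def)
  show thesis
  proof (rule that[of "\<kappa> \<circ> g"])
    show "embeds B (\<kappa> \<circ> g)" using embeds_comp[OF g embeds_subset[OF \<kappa> gP]] .
    show "(\<kappa> \<circ> g) (\<theta> c) = c" if "c \<in> C" for c using fg[OF that] \<kappa>f[OF subsetD[OF C(2) that]] by simp
    have "A \<inter> (\<kappa> \<circ> g) ` B = \<kappa> ` f ` A \<inter> \<kappa> ` g ` B" by (simp only: \<kappa>fA image_comp[symmetric])
    also have "\<dots> = \<kappa> ` (f ` A \<inter> g ` B)" using inj_on_image_Int[OF \<kappa>i fP gP] by simp
    also have "\<dots> = C" unfolding int using \<kappa>f C(2) by (force simp: image_iff)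
    finally show "A \<inter> (\<kappa> \<circ> g) ` B = C" .
    have "amalgam (\<kappa> ` f ` A) (\<kappa> ` g ` B)" using amalgam_image[OF am sP fP gP \<kappa>] .
    then show "amalgam A ((\<kappa> \<circ> g) ` B)" by (simp only: \<kappa>fA image_comp[symmetric])
    have "join (\<kappa> ` f ` A) (\<kappa> ` g ` B) = \<kappa> ` P" unfolding P_def[symmetric]
      using join_image[OF sP \<kappa>a fP gP] by (simp add: P_def)
    then have "join A ((\<kappa> \<circ> g) ` B) = \<kappa> ` P" by (simp only: \<kappa>fA image_comp[symmetric])
    then show "good (join A ((\<kappa> \<circ> g) ` B))" using good_conj[OF k(2)] by (simp add: \<kappa>P)
  qed
qed

subsection \<open>Amalgams of free pairs\<close>

text \<open>The universal property is used three times: for each copy of \<open>K\<close> attached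
  to \<open>K\<close>, and for the amalgam of the two results over \<open>K\<close>.\<close>

lemma (in free_pair) extend_hom:
  fixes \<phi> f g :: "'g \<Rightarrow> 'h::group_add"
  assumes \<phi>: "additive_on K \<phi>" and f: "additive_on K f" and g: "additive_on K g"
    and fR: "\<And>r. r \<in> R \<Longrightarrow> f r = \<phi> (l r)" and gR: "\<And>r. r \<in> R \<Longrightarrow> g r = \<phi> (m r)"
  shows "\<exists>h. additive_on (join A B) h \<and> (\<forall>x\<in>K. h x = \<phi> x \<and> h (l x) = f x \<and> h (m x) = g x)"
proof -
  have ext: "\<exists>h. additive_on (join K (l ` K)) h \<and> (\<forall>x\<in>K. h x = \<phi> x \<and> h (l x) = f x)"
    if l: "embeds K l" and lK: "l ` K \<inter> K = l ` R" and aml: "amalgam K (l ` K)"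
      and f: "additive_on K f" and fR: "\<And>r. r \<in> R \<Longrightarrow> f r = \<phi> (l r)" for l f
  proof -
    have inv: "inv_into K l (l x) = x" if "x \<in> K" for x using that l by (simp add: embeds_def)
    have "additive_on (l ` K) (inv_into K l)" using embeds_inv[OF K l] by (simp add: embeds_def)
    moreover have "inv_into K l ` l ` K = K" using inv by (force simp: image_iff)
    ultimately have "additive_on (l ` K) (f \<circ> inv_into K l)" using f additive_on_comp by metis
    moreover have "\<phi> c = (f \<circ> inv_into K l) c" if c: "c \<in> K \<inter> l ` K" for c
    proof -
      obtain r where "r \<in> R" "c = l r" using c lK by blast
      then show ?thesis using fR RK inv by auto
    qed
    ultimately obtain h where "additive_on (join K (l ` K)) h" "\<forall>x\<in>K. h x = \<phi> x"
        "\<forall>y\<in>l ` K. h y = (f \<circ> inv_into K l) y"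
      using amalgam_extend[OF aml \<phi>] by blast
    then show ?thesis using inv by (intro exI[of _ h]) auto
  qed
  obtain h1 where h1: "additive_on A h1" "\<forall>x\<in>K. h1 x = \<phi> x \<and> h1 (l x) = f x"
    using ext[OF l lK aml f fR] by blast
  obtain h2 where h2: "additive_on B h2" "\<forall>x\<in>K. h2 x = \<phi> x \<and> h2 (m x) = g x"
    using ext[OF m mK amm g gR] by blast
  have "h1 c = h2 c" if "c \<in> A \<inter> B" for c using that h1 h2 Pint by auto
  from amalgam_extend[OF am h1(1) h2(1) this] obtain h where
    h: "additive_on (join A B) h" "\<forall>x\<in>A. h x = h1 x" "\<forall>x\<in>B. h x = h2 x" by blast
  show ?thesis using h h1 h2 KA lA mB by (intro exI[of _ h]) (auto simp: subset_iff)
qed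

lemma (in free_pair) torsion_free:
  assumes "torsion_free_on K"
  shows "torsion_free_on (join A B)"
  using assms torsion_free_image[OF K l] torsion_free_image[OF K m]
  by (intro torsion_free_amalgam am aml amm)

lemma (in free_pair) JK: "K \<subseteq> join A B" and Jl: "l ` K \<subseteq> join A B" and Jm: "m ` K \<subseteq> join A B"
  by (rule subset_trans[OF KA join_upper(1)] subset_trans[OF lA join_upper(1)] subset_trans[OF mB join_upper(2)])+

lemma (in free_pair) sJ: "is_subgroup (join A B)"
  using subgroup_join[OF sA sB] .

text \<open>An element of the common subgroup that is elliptic on one side is conjugate into \<open>K\<close>, hence
  elliptic on the other side as well.\<close>

lemma free_pair_conj_core:
  assumes F: "free_pair K R l m" and F': "free_pair K R l' m'" and v: "v \<in> K" "v' \<in> K"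
    and core: "free_pair.core K R l m v = free_pair.core K R l' m' v'"
    and c: "c \<in> free_pair.core K R l m v" "c \<noteq> 0"
    and a: "a \<in> join (join K (l ` K)) (join K (m ` K))" "- a + c + a \<in> join K (l ` K) \<union> join K (m ` K)"
    and b: "b \<in> join (join K (l' ` K)) (join K (m' ` K))" "b + c + - b \<in> free_pair.core K R l m v"
  shows "b \<in> free_pair.core K R l m v"
proof -
  interpret F: free_pair K R l m by fact
  interpret F': free_pair K R l' m' by fact
  let ?C = "F.core v"
  have C: "is_subgroup ?C" by (rule F.core_subgroup)
  have "- a \<in> join F.A F.B" using a(1) F.sJ by (simp add: subgroup_uminus)
  then obtain f where f: "f \<in> ?C" "- f + c + f \<in> K"
    using F.core_elliptic[OF v(1) c(1), of "- a"] a(2) by auto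
  define k where "k = - f + c + f"
  have ck: "c = f + k + - f" by (simp add: k_def add.assoc)
  have k0: "k \<noteq> 0" using ck c(2) by auto
  have fJ: "f \<in> join F'.A F'.B" using f(1) F'.core_join[OF v(2)] core by auto
  define g where "g = b + f"
  have g: "g \<in> join F'.A F'.B" unfolding g_def using b(1) fJ F'.sJ by (simp add: subgroup_add)
  have bc: "b + c + - b = g + k + - g" by (simp add: g_def ck add.assoc minus_add)
  have "- g + (b + c + - b) + - (- g) = k" unfolding bc by (simp add: add.assoc)
  then have "- g + (b + c + - b) + - (- g) \<in> F'.A \<union> F'.B"
    using f(2) F'.KA by (auto simp: k_def)
  moreover have "- g \<in> join F'.A F'.B" using g F'.sJ by (simp add: subgroup_uminus)
  ultimately obtain f' where f': "f' \<in> ?C" "- f' + (b + c + - b) + f' \<in> K"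
    using F'.core_elliptic[OF v(2), of "b + c + - b" "- g"] b(2) core by auto
  have f'J: "f' \<in> join F'.A F'.B" using f'(1) F'.core_join[OF v(2)] core by auto
  have "(- f' + g) + k + - (- f' + g) = - f' + (b + c + - b) + f'"
    unfolding bc by (simp add: add.assoc minus_add)
  then have "(- f' + g) + k + - (- f' + g) \<in> K" using f'(2) by simp
  moreover have "- f' + g \<in> join F'.A F'.B" using g f'J F'.sJ by (simp add: subgroup_add subgroup_uminus)
  ultimately have "- f' + g \<in> K"
    using malnormalD[OF F'.malnormal_K _ _ k0] f(2) unfolding k_def[symmetric] by blast
  then have "- f' + g \<in> ?C" by (rule subsetD[OF F.K_core])
  then have "f' + (- f' + g) + - f \<in> ?C" using f(1) f'(1)
    by (simp only: subgroup_add[OF C] subgroup_uminus[OF C])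
  then show ?thesis by (simp add: g_def add.assoc)
qed

text \<open>The amalgamated core is controlled only on elements conjugate into \<open>H\<close>. As
  \<open>H\<close> lies in the union of the two smaller factors, these are elliptic, and
  \<open>free_pair_conj_core\<close> applies to them.\<close>

lemma malnormal_free_pairs:
  assumes F: "free_pair K R l m" and F': "free_pair K R l' m'" and v: "v \<in> K" "v' \<in> K"
    and core: "free_pair.core K R l m v = free_pair.core K R l' m' v'"
    and J: "J = join (join K (l ` K)) (join K (m ` K))" and J': "J' = join (join K (l' ` K)) (join K (m' ` K))"
    and am: "amalgam J J'" and Int: "J \<inter> J' = free_pair.core K R l m v"
    and H: "is_subgroup H" "malnormal H J" "H \<subseteq> join K (l ` K) \<union> join K (m ` K)"
  shows "malnormal H (join J J')"
proof (rule malnormal_amalgam[OF am H(1,2)])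
  fix x p q assume x: "x \<in> J \<inter> J'" "x \<noteq> 0" and p: "p \<in> J" "- p + x + p \<in> H" and q: "q \<in> J'" "q \<notin> J"
  show "q + x + - q \<notin> J"
  proof
    assume "q + x + - q \<in> J"
    moreover have "q + x + - q \<in> J'"
      using q x amalgam_subgroup(2)[OF am] by (auto intro!: subgroup_add subgroup_uminus)
    ultimately have "q \<in> J \<inter> J'"
      using free_pair_conj_core[OF F F' v core, of x p q] Int x p q H(3) J J' by blast
    then show False using q(2) by blast
  qed
qed

text \<open>The second factor of an amalgam is available only as a copy under some
  \<open>\<beta>\<close>. If \<open>\<beta>\<close> fixes \<open>K\<close>, the copy is a free pair
  over the same \<open>K\<close> and \<open>R\<close>, with the corresponding zigzags and
  core.\<close>

lemma free_pair_image:
  assumes F: "free_pair K R l m" and \<beta>: "embeds (join (join K (l ` K)) (join K (m ` K))) \<beta>"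
    and id: "\<And>k. k \<in> K \<Longrightarrow> \<beta> k = k"
  shows "free_pair K R (\<beta> \<circ> l) (\<beta> \<circ> m)"
    and "join (join K ((\<beta> \<circ> l) ` K)) (join K ((\<beta> \<circ> m) ` K)) = \<beta> ` join (join K (l ` K)) (join K (m ` K))"
    and "\<And>y v. y \<in> K \<Longrightarrow> v \<in> K \<Longrightarrow> zigzag (\<beta> \<circ> l) (\<beta> \<circ> m) v y = \<beta> (zigzag l m v y)"
    and "\<And>v. v \<in> K \<Longrightarrow> free_pair.core K R (\<beta> \<circ> l) (\<beta> \<circ> m) v = \<beta> ` free_pair.core K R l m v"
proof -
  interpret F: free_pair K R l m by fact
  let ?J = "join F.A F.B"
  have ba: "additive_on ?J \<beta>" and bi: "inj_on \<beta> ?J" using \<beta> by (auto simp: embeds_def)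
  have bK: "\<beta> ` K = K" using id by (force simp: image_iff)
  have sub: "F.A \<subseteq> ?J" "F.B \<subseteq> ?J" by (rule join_upper)+
  have ll: "(\<beta> \<circ> l) ` K = \<beta> ` l ` K" "(\<beta> \<circ> m) ` K = \<beta> ` m ` K" "(\<beta> \<circ> l) ` R = \<beta> ` l ` R" "(\<beta> \<circ> m) ` R = \<beta> ` m ` R"
    by (auto simp: image_comp)
  have jA: "join K ((\<beta> \<circ> l) ` K) = \<beta> ` F.A" and jB: "join K ((\<beta> \<circ> m) ` K) = \<beta> ` F.B"
    using join_image[OF F.sJ ba F.JK F.Jl] join_image[OF F.sJ ba F.JK F.Jm] by (simp_all only: ll bK)
  have lR: "l ` R \<subseteq> K" "m ` R \<subseteq> K" using F.lK F.mK by blast+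
  have bR: "\<beta> ` l ` R = l ` R" "\<beta> ` m ` R = m ` R" using id lR by (force simp: image_iff)+
  show F': "free_pair K R (\<beta> \<circ> l) (\<beta> \<circ> m)"
  proof unfold_locales
    show "embeds K (\<beta> \<circ> l)" "embeds K (\<beta> \<circ> m)"
      using embeds_comp F.l F.m embeds_subset[OF \<beta> F.Jl] embeds_subset[OF \<beta> F.Jm] by blast+
    show "(\<beta> \<circ> l) ` K \<inter> K = (\<beta> \<circ> l) ` R"
      using inj_on_image_Int[OF bi F.Jl F.JK] unfolding ll bK F.lK by (rule sym)
    show "(\<beta> \<circ> m) ` K \<inter> K = (\<beta> \<circ> m) ` R"
      using inj_on_image_Int[OF bi F.Jm F.JK] unfolding ll bK F.mK by (rule sym)
    show "amalgam K ((\<beta> \<circ> l) ` K)" "amalgam K ((\<beta> \<circ> m) ` K)"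
      using amalgam_image[OF F.aml F.sJ F.JK F.Jl \<beta>] amalgam_image[OF F.amm F.sJ F.JK F.Jm \<beta>]
      by (simp_all only: ll bK)
    show "amalgam (join K ((\<beta> \<circ> l) ` K)) (join K ((\<beta> \<circ> m) ` K))"
      unfolding jA jB by (rule amalgam_image[OF F.am F.sJ sub \<beta>])
    show "join K ((\<beta> \<circ> l) ` K) \<inter> join K ((\<beta> \<circ> m) ` K) = K"
      unfolding jA jB using inj_on_image_Int[OF bi sub] by (simp add: F.Pint bK)
    show "malnormal ((\<beta> \<circ> l) ` R) K" "malnormal ((\<beta> \<circ> m) ` R) K"
      using F.mal_lR F.mal_mR by (simp_all only: ll bR)
    fix \<delta> \<epsilon> assume de: "\<delta> \<in> R" "\<epsilon> \<in> R" "(\<beta> \<circ> m) \<delta> = (\<beta> \<circ> l) \<epsilon>" "(\<beta> \<circ> l) \<delta> = (\<beta> \<circ> m) \<epsilon>"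
    have "l \<delta> \<in> K" "m \<delta> \<in> K" "l \<epsilon> \<in> K" "m \<epsilon> \<in> K" using de(1,2) lR by blast+
    then show "\<delta> = 0" using F.twist[OF de(1,2)] de(3,4) id by simp
  qed (fact F.K F.R F.malR)+
  show "join (join K ((\<beta> \<circ> l) ` K)) (join K ((\<beta> \<circ> m) ` K)) = \<beta> ` ?J"
    unfolding jA jB by (rule join_image[OF F.sJ ba sub])
  show zz: "zigzag (\<beta> \<circ> l) (\<beta> \<circ> m) v y = \<beta> (zigzag l m v y)" if "y \<in> K" "v \<in> K" for y v
  proof -
    have J: "v \<in> ?J" "l y \<in> ?J" "m y \<in> ?J" using that F.JK F.Jl F.Jm by blast+
    then show ?thesis using ba F.sJ id[OF that(2)]
      by (simp add: zigzag_def zig_def additive_on_add subgroup_add)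
  qed
  interpret F': free_pair K R "\<beta> \<circ> l" "\<beta> \<circ> m" by fact
  fix v assume v: "v \<in> K"
  have w: "sum_list (map (letter (zigzag (\<beta> \<circ> l) (\<beta> \<circ> m) v)) L) = \<beta> (sum_list (map (letter (zigzag l m v)) L))"
    if L: "set L \<subseteq> F.letters" for L
  proof -
    have el: "letter (zigzag (\<beta> \<circ> l) (\<beta> \<circ> m) v) x = \<beta> (letter (zigzag l m v) x) \<and> letter (zigzag l m v) x \<in> ?J"
      if "x \<in> F.letters" for x
      using that zz[OF _ v] F.zigzag_join[OF v] id F.JK F.sJ ba
      by (auto simp: F.letters_def additive_on_uminus subgroup_uminus subset_iff)
    then have "sum_list (map (letter (zigzag (\<beta> \<circ> l) (\<beta> \<circ> m) v)) L) = sum_list (map \<beta> (map (letter (zigzag l m v)) L))"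
      using L by (auto simp: subset_iff intro!: arg_cong[of _ _ sum_list])
    also have "\<dots> = \<beta> (sum_list (map (letter (zigzag l m v)) L))"
      using L el by (intro additive_on_sum_list[OF F.sJ ba, symmetric]) auto
    finally show ?thesis .
  qed
  have "F'.letters = F.letters" by (simp add: F.letters_def F'.letters_def)
  then show "F'.core v = \<beta> ` F.core v"
    unfolding F.core_def F'.core_def setcompr_eq_image image_image using w by (intro image_cong) auto
qed

subsection \<open>One step of the construction\<close>

datatype idx = I0 | I1 | I2 | I3 | I4

lemma idx_cases:
  fixes j :: idx
  obtains a b c d where "distinct [j, a, b, c, d]" "UNIV = {j, a, b, c, d}"
proof -
  have U: "UNIV = {I0, I1, I2, I3, I4}" by (auto intro: idx.exhaust)
  show thesis
    by (cases j)
      (use that[of I1 I2 I3 I4] that[of I0 I2 I3 I4] that[of I0 I1 I3 I4] that[of I0 I1 I2 I4] that[of I0 I1 I2 I3] U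
       in \<open>auto simp: insert_commute\<close>)
qed

definition pw :: "'g \<Rightarrow> 'g \<Rightarrow> 'g::group_add" where
  "pw x y = (x + y + x + y) + (x + y + x + y)"

definition law :: "'g \<Rightarrow> (idx \<Rightarrow> 'g::group_add) \<Rightarrow> bool" where
  "law u \<theta> \<longleftrightarrow> (\<exists>a b c d. pw (\<theta> a) (\<theta> b) = u + pw (\<theta> c) (\<theta> d))"

text \<open>The left regular action of the group on its functions with values in
  \<open>Z/2\<close>.\<close>

definition shift :: "'f \<Rightarrow> ('f \<Rightarrow> bit) \<Rightarrow> ('f::group_add \<Rightarrow> bit)" where
  "shift w m = (\<lambda>v. m (- w + v))"

lemma shift_add: "shift v (shift w m) = shift (v + w) m"
  by (simp add: shift_def minus_add add.assoc)

lemma shift_zero [simp]: "shift 0 m = m"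
  by (simp add: shift_def)

lemma additive_shift: "shift w (m + n) = shift w m + shift w n"
  by (simp add: shift_def fun_eq_iff)

lemma pw_char2: "pw x y = (0 :: 'f \<Rightarrow> bit)"
  by (rule ext) (simp add: pw_def)

text \<open>\<open>\<Theta>\<close> consists of the tuples \<open>(\<theta>\<^sub>0, \<dots>, \<theta>\<^sub>4)\<close> on which the partial isomorphisms \<open>\<theta>\<^sub>i \<mapsto> \<theta>\<^sub>k\<close> between
  subgroups of \<open>K\<close> are defined; \<open>\<phi>\<close> turns them into translations. Assumption \<open>tw\<close> provides \<open>twist\<close> for the next step, and
  \<open>TK0\<close> makes the common centralizer of \<open>e \<in> K0\<close> and its image under \<open>\<theta>\<^sub>0 \<mapsto> \<theta>\<^sub>1\<close> trivial in the limit.\<close>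

locale stage =
  fixes K0 :: "nat sym set" and u :: "nat sym" and s :: "idx \<Rightarrow> 'f::group_add" and K :: "nat sym set"
    and \<Theta> :: "(idx \<Rightarrow> nat sym) set" and \<phi> :: "nat sym \<Rightarrow> 'f \<Rightarrow> bit"
  assumes gK: "good K" and tK: "torsion_free_on K" and K0: "malnormal K0 K" and uK: "u \<in> K" and \<phi>u: "\<phi> u = 0"
    and T: "is_subgroup \<Theta>" and TK: "\<And>\<theta> i. \<theta> \<in> \<Theta> \<Longrightarrow> \<theta> i \<in> K"
    and T0: "\<And>\<theta> i. \<theta> \<in> \<Theta> \<Longrightarrow> \<theta> i = 0 \<Longrightarrow> \<theta> = 0"
    and mal: "\<And>i. malnormal ((\<lambda>\<theta>. \<theta> i) ` \<Theta>) K"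
    and tw: "\<And>\<theta> \<eta> p q. \<theta> \<in> \<Theta> \<Longrightarrow> \<eta> \<in> \<Theta> \<Longrightarrow> p \<noteq> q \<Longrightarrow> \<theta> p = \<eta> q \<Longrightarrow> \<theta> q = \<eta> p \<Longrightarrow> \<theta> = 0"
    and lawT: "\<And>\<theta>. \<theta> \<in> \<Theta> \<Longrightarrow> \<theta> \<noteq> 0 \<Longrightarrow> law u \<theta>"
    and TK0: "\<And>\<theta>. \<theta> \<in> \<Theta> \<Longrightarrow> \<theta> I0 \<in> K0 \<Longrightarrow> \<theta> I1 \<in> K0 \<Longrightarrow> \<theta> = 0"
    and \<phi>: "additive_on K \<phi>" and \<phi>s: "\<And>\<theta> i k. \<theta> \<in> \<Theta> \<Longrightarrow> \<phi> (\<theta> i) = shift (s i + - s k) (\<phi> (\<theta> k))"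

lemma proj_additive: "additive_on \<Theta> (\<lambda>\<theta> :: 'i \<Rightarrow> 'g::group_add. \<theta> i)"
  by (simp add: additive_on_def)

text \<open>A second copy of \<open>K\<close> is amalgamated to \<open>K\<close> by identifying
  \<open>\<theta> j\<close> in the copy with \<open>\<theta> i\<close> in \<open>K\<close>. The
  inclusion \<open>l\<close> of the copy then extends the partial isomorphism from coordinate
  \<open>j\<close> to coordinate \<open>i\<close> to all of \<open>K\<close>, at the cost of
  enlarging the target.\<close>

lemma stage_leaf:
  assumes st: "stage K0 u s K \<Theta> \<phi>"
  obtains l where "embeds K l" "\<And>\<theta>. \<theta> \<in> \<Theta> \<Longrightarrow> l (\<theta> j) = \<theta> i" "l ` K \<inter> K = l ` (\<lambda>\<theta>. \<theta> j) ` \<Theta>"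
    "amalgam K (l ` K)" "good (join K (l ` K))"
proof -
  interpret S: stage K0 u s K \<Theta> \<phi> by fact
  note gK = S.gK and T = S.T and TK = S.TK and T0 = S.T0
  have sK: "is_subgroup K" using gK by (rule good_subgroup)
  let ?p = "\<lambda>i \<theta>. \<theta> i"
  have pe: "embeds \<Theta> (?p i)" for i using T proj_additive T0 by (rule embedsI)
  define C where "C = ?p i ` \<Theta>"
  have C: "is_subgroup C" "C \<subseteq> K" unfolding C_def using subgroup_image[OF T proj_additive] TK by auto
  define r where "r = ?p j \<circ> inv_into \<Theta> (?p i)"
  have ri: "r (\<theta> i) = \<theta> j" if "\<theta> \<in> \<Theta>" for \<theta>
    using that pe[of i] by (simp add: r_def embeds_def inv_into_f_f[of "\<lambda>\<theta>. \<theta> i"])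
  have iT: "inv_into \<Theta> (?p i) ` C \<subseteq> \<Theta>" unfolding C_def by (auto intro: inv_into_into)
  have re: "embeds C r" unfolding r_def C_def
    using embeds_comp[OF embeds_inv[OF T pe[of i]] embeds_subset[OF pe[of j]]] iT by (simp add: C_def)
  have rK: "r ` C \<subseteq> K" using ri TK by (auto simp: C_def)
  obtain l where l: "embeds K l" "\<And>c. c \<in> C \<Longrightarrow> l (r c) = c" "K \<inter> l ` K = C"
     "amalgam K (l ` K)" "good (join K (l ` K))"
    using amalgam_exists[OF gK sK good_countable[OF gK] C re rK] by blast
  have lj: "l (\<theta> j) = \<theta> i" if "\<theta> \<in> \<Theta>" for \<theta> using l(2)[of "\<theta> i"] ri[OF that] that by (simp add: C_def)
  then have "l ` ?p j ` \<Theta> = C" by (force simp: C_def image_iff)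
  then show thesis using that l lj by (simp add: Int_commute)
qed

lemma stage_pair:
  assumes st: "stage K0 u s K \<Theta> \<phi>" and ab: "a \<noteq> b"
  obtains l m where "free_pair K ((\<lambda>\<theta>. \<theta> j) ` \<Theta>) l m" "\<And>\<theta>. \<theta> \<in> \<Theta> \<Longrightarrow> l (\<theta> j) = \<theta> a"
    "\<And>\<theta>. \<theta> \<in> \<Theta> \<Longrightarrow> m (\<theta> j) = \<theta> b" "good (join (join K (l ` K)) (join K (m ` K)))"
proof -
  interpret S: stage K0 u s K \<Theta> \<phi> by fact
  note gK = S.gK and T = S.T and TK = S.TK and mal = S.mal and tw = S.tw
  have sK: "is_subgroup K" using gK by (rule good_subgroup)
  let ?R = "(\<lambda>\<theta>. \<theta> j) ` \<Theta>"
  obtain l where l: "embeds K l" "\<And>\<theta>. \<theta> \<in> \<Theta> \<Longrightarrow> l (\<theta> j) = \<theta> a" "l ` K \<inter> K = l ` ?R"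
    "amalgam K (l ` K)" "good (join K (l ` K))" using stage_leaf[OF st] by blast
  obtain n where n: "embeds K n" "\<And>\<theta>. \<theta> \<in> \<Theta> \<Longrightarrow> n (\<theta> j) = \<theta> b" "n ` K \<inter> K = n ` ?R"
    "amalgam K (n ` K)" "good (join K (n ` K))" using stage_leaf[OF st] by blast
  let ?A = "join K (l ` K)" and ?B = "join K (n ` K)"
  have KA: "K \<subseteq> ?A" and KB: "K \<subseteq> ?B" and nB: "n ` K \<subseteq> ?B" by (rule join_upper)+
  note sB = good_subgroup[OF n(5)]
  have idK: "embeds K (\<lambda>x. x)" by (simp add: embeds_def additive_on_def)
  obtain \<beta> where \<beta>: "embeds ?B \<beta>" "\<And>c. c \<in> K \<Longrightarrow> \<beta> c = c" "?A \<inter> \<beta> ` ?B = K"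
    "amalgam ?A (\<beta> ` ?B)" "good (join ?A (\<beta> ` ?B))"
    using amalgam_exists[OF l(5) sB good_countable[OF n(5)] sK KA idK] KB by auto
  define m where "m = \<beta> \<circ> n"
  have bK: "\<beta> ` K = K" using \<beta>(2) by (force simp: image_iff)
  have mK: "m ` K = \<beta> ` n ` K" by (simp add: m_def image_comp)
  have ba: "additive_on ?B \<beta>" "inj_on \<beta> ?B" using \<beta>(1) by (auto simp: embeds_def)
  have jB: "join K (m ` K) = \<beta> ` ?B" using join_image[OF sB ba(1) KB nB] by (simp add: bK mK)
  have mj: "m (\<theta> j) = \<theta> b" if "\<theta> \<in> \<Theta>" for \<theta> using n(2)[OF that] \<beta>(2) TK[OF that] by (simp add: m_def)
  have lR: "l ` ?R = (\<lambda>\<theta>. \<theta> a) ` \<Theta>" using l(2) by (force simp: image_iff)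
  have mR: "m ` ?R = (\<lambda>\<theta>. \<theta> b) ` \<Theta>" using mj by (force simp: image_iff)
  have nR: "n ` ?R = (\<lambda>\<theta>. \<theta> b) ` \<Theta>" using n(2) by (force simp: image_iff)
  have "free_pair K ?R l m"
  proof
    show "is_subgroup ?R" using subgroup_image[OF T proj_additive] .
    show "embeds K m" unfolding m_def using embeds_comp[OF n(1) embeds_subset[OF \<beta>(1) nB]] .
    have "\<beta> ` n ` ?R = n ` ?R" unfolding nR using \<beta>(2) TK by (force simp: image_iff)
    then show "m ` K \<inter> K = m ` ?R"
      using inj_on_image_Int[OF ba(2) nB KB] by (simp add: mK bK n(3) mR nR)
    show "amalgam K (m ` K)" using amalgam_image[OF n(4) sB KB nB \<beta>(1)] by (simp only: mK bK)
    show "amalgam (join K (l ` K)) (join K (m ` K))" unfolding jB by fact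
    show "join K (l ` K) \<inter> join K (m ` K) = K" unfolding jB by fact
    show "malnormal (l ` ?R) K" "malnormal (m ` ?R) K" unfolding lR mR by (rule mal)+
    fix \<delta> \<epsilon> assume de: "\<delta> \<in> ?R" "\<epsilon> \<in> ?R" "m \<delta> = l \<epsilon>" "l \<delta> = m \<epsilon>"
    then obtain \<theta> \<eta> where "\<theta> \<in> \<Theta>" "\<delta> = \<theta> j" "\<eta> \<in> \<Theta>" "\<epsilon> = \<eta> j" by blast
    then show "\<delta> = 0" using tw[of \<theta> \<eta> a b] ab de(3,4) l(2) mj by simp
  qed (fact sK mal l)+
  then show thesis using that l(2) mj \<beta>(5) jB by metis
qed

text \<open>The zigzags of \<open>la\<close> and \<open>lb\<close> are identified with those of \<open>mc\<close> and \<open>md\<close> shifted by \<open>u\<close>, which imposes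
  the law on all new tuples. The homomorphism \<open>\<phi>\<close> extends because its values have exponent two,
  which makes it vanish on fourth powers, and because \<open>\<phi> u = 0\<close>.\<close>

lemma stage_extend:
  fixes j :: idx
  assumes st: "stage K0 u s K \<Theta> \<phi>"
  shows "\<exists>K' \<Theta>' \<phi>'. stage K0 u s K' \<Theta>' \<phi>' \<and> K \<subseteq> K' \<and> \<Theta> \<subseteq> \<Theta>' \<and> (\<forall>k\<in>K. \<phi>' k = \<phi> k) \<and>
    (\<forall>k\<in>K. \<exists>\<theta>\<in>\<Theta>'. \<theta> j = k)"
proof -
  interpret S: stage K0 u s K \<Theta> \<phi> by fact
  note gK = S.gK and tK = S.tK and K0 = S.K0 and uK = S.uK and \<phi>u = S.\<phi>u and T = S.T and TK = S.TK
    and T0 = S.T0 and mal = S.mal and tw = S.tw and lawT = S.lawT and TK0 = S.TK0 and \<phi> = S.\<phi> and \<phi>s = S.\<phi>s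
  have sK: "is_subgroup K" using gK by (rule good_subgroup)
  obtain a b c d where dist: "distinct [j, a, b, c, d]" and U: "UNIV = {j, a, b, c, d}" by (rule idx_cases)
  define R where "R = (\<lambda>\<theta>. \<theta> j) ` \<Theta>"
  obtain la lb where F: "free_pair K R la lb" and la: "\<And>\<theta>. \<theta> \<in> \<Theta> \<Longrightarrow> la (\<theta> j) = \<theta> a"
    and lb: "\<And>\<theta>. \<theta> \<in> \<Theta> \<Longrightarrow> lb (\<theta> j) = \<theta> b" and gJ: "good (join (join K (la ` K)) (join K (lb ` K)))"
    using stage_pair[OF st, of a b j] dist unfolding R_def by auto
  obtain mc md where M: "free_pair K R mc md" and mc: "\<And>\<theta>. \<theta> \<in> \<Theta> \<Longrightarrow> mc (\<theta> j) = \<theta> c"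
    and md: "\<And>\<theta>. \<theta> \<in> \<Theta> \<Longrightarrow> md (\<theta> j) = \<theta> d" and gM: "good (join (join K (mc ` K)) (join K (md ` K)))"
    using stage_pair[OF st, of c d j] dist unfolding R_def by auto
  interpret F: free_pair K R la lb by fact
  interpret M: free_pair K R mc md by fact
  let ?J = "join F.A F.B" and ?N = "join M.A M.B"
  have z: "0 \<in> K" using subgroup_zero[OF sK] .
  define C where "C = F.core 0"
  have C: "is_subgroup C" "C \<subseteq> ?J" unfolding C_def using F.core_subgroup F.core_join[OF z] by auto
  let ?e = "letter (zigzag la lb 0)" and ?e' = "letter (zigzag mc md u)"
  let ?neg = "\<lambda>x :: nat sym + nat sym \<times> bool. case x of Inl g \<Rightarrow> Inl (- g) | Inr (y, s) \<Rightarrow> Inr (y, \<not> s)"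
  \<comment> \<open>By freeness the assignment that fixes \<open>K\<close> and sends each zigzag of
    \<open>la\<close>, \<open>lb\<close> to the one of \<open>mc\<close>, \<open>md\<close> with the
    factor \<open>u\<close> respects all relations; freeness on the other side makes it
    injective.\<close>
  have "\<exists>f. additive_on {sum_list (map ?e ws) |ws. set ws \<subseteq> F.letters} f \<and>
    (\<forall>ws. set ws \<subseteq> F.letters \<longrightarrow> f (sum_list (map ?e ws)) = sum_list (map ?e' ws))"
    by (rule hom_on_words[where neg = ?neg])
      (use F.letters_uminus letter_uminus F.core_kernel[OF z] in \<open>auto simp del: letter.simps\<close>)
  then obtain f where fa: "additive_on C f"
    and fw: "\<And>ws. set ws \<subseteq> F.letters \<Longrightarrow> f (sum_list (map ?e ws)) = sum_list (map ?e' ws)"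
    unfolding C_def F.core_def by blast
  have fe: "embeds C f"
  proof (rule embedsI[OF C(1) fa])
    fix x assume x: "x \<in> C" "f x = 0"
    then obtain L where L: "set L \<subseteq> F.letters" "x = sum_list (map ?e L)" unfolding C_def F.core_def by blast
    then have "sum_list (map ?e' L) = 0" using fw[OF L(1)] x(2) by simp
    from M.core_kernel[OF uK _ this, of "zigzag la lb 0"] L show "x = 0" by simp
  qed
  have fC: "f ` C = M.core u"
    unfolding C_def F.core_def M.core_def setcompr_eq_image image_image using fw by (intro image_cong) auto
  have fK: "f k = k" if "k \<in> K" for k
    using fw[of "[Inl k]"] that by (simp add: F.letters_def)
  have fz: "f (zigzag la lb 0 y) = zigzag mc md u y" if "y \<in> K - R" for y
    using fw[of "[Inr (y, True)]"] that by (simp add: F.letters_def)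
  have "f ` C \<subseteq> ?N" using fC M.core_join[OF uK] by simp
  \<comment> \<open>Gluing along \<open>f\<close> makes each zigzag on the left equal to its partner
    on the right, which is the law for the new tuples.\<close>
  then obtain \<beta> where \<beta>: "embeds ?N \<beta>" "\<And>x. x \<in> C \<Longrightarrow> \<beta> (f x) = x" "?J \<inter> \<beta> ` ?N = C"
    "amalgam ?J (\<beta> ` ?N)" "good (join ?J (\<beta> ` ?N))"
    using amalgam_exists[OF gJ good_subgroup[OF gM] good_countable[OF gM] C fe] by blast
  have KC: "K \<subseteq> C" unfolding C_def by (rule F.K_core)
  have \<beta>K: "\<beta> k = k" if "k \<in> K" for k using \<beta>(2)[of k] fK[OF that] that KC by auto
  define lc ld where "lc = \<beta> \<circ> mc" and "ld = \<beta> \<circ> md"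
  have G: "free_pair K R lc ld" unfolding lc_def ld_def by (rule free_pair_image(1)[OF M \<beta>(1) \<beta>K])
  interpret G: free_pair K R lc ld by fact
  let ?L = "join G.A G.B"
  have L: "?L = \<beta> ` ?N" unfolding lc_def ld_def by (rule free_pair_image(2)[OF M \<beta>(1) \<beta>K])
  have Gcore: "G.core u = C"
  proof -
    have "G.core u = \<beta> ` M.core u" unfolding lc_def ld_def by (rule free_pair_image(4)[OF M \<beta>(1) \<beta>K uK])
    also have "\<dots> = C" unfolding fC[symmetric] using \<beta>(2) by (force simp: image_iff)
    finally show ?thesis .
  qed
  have zz: "zigzag la lb 0 y = zigzag lc ld u y" if "y \<in> K - R" for y
  proof -
    have "\<beta> (f (zigzag la lb 0 y)) = zigzag la lb 0 y"
      using F.zigzag_core[OF that] by (intro \<beta>(2)) (simp add: C_def)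
    moreover have "zigzag lc ld u y = \<beta> (zigzag mc md u y)"
      unfolding lc_def ld_def using that by (intro free_pair_image(3)[OF M \<beta>(1) \<beta>K _ uK]) auto
    ultimately show ?thesis using fz[OF that] by simp
  qed
  have am: "amalgam ?J ?L" and JL: "?J \<inter> ?L = C" and gK': "good (join ?J ?L)"
    using \<beta>(3-5) by (simp_all only: L)
  define K' where "K' = join ?J ?L"
  have sK': "is_subgroup K'" unfolding K'_def using gK' by (rule good_subgroup)
  have JK': "?J \<subseteq> K'" and LK': "?L \<subseteq> K'" unfolding K'_def by (rule join_upper)+
  have KK': "K \<subseteq> K'" using F.JK JK' by blast
  have malJ: "malnormal H K'" if H: "is_subgroup H" "malnormal H ?J" "H \<subseteq> F.A \<union> F.B" for H
    unfolding K'_def using malnormal_free_pairs[OF F G z uK _ refl refl am _ H] Gcore JL by (simp add: C_def)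
  have malL: "malnormal H K'" if H: "is_subgroup H" "malnormal H ?L" "H \<subseteq> G.A \<union> G.B" for H
    unfolding K'_def join_sym[of ?J]
    using malnormal_free_pairs[OF G F uK z _ refl refl amalgam_sym[OF am] _ H] Gcore JL by (simp add: C_def Int_commute)
  \<comment> \<open>The five coordinates as total maps: new elements are entered at index
    \<open>j\<close> by the identity, and the other four coordinates are the inclusions of the
    copies of \<open>K\<close>.\<close>
  define lam where "lam i = (if i = j then (\<lambda>x. x) else if i = a then la else if i = b then lb else if i = c then lc else ld)" for i
  have lam: "lam j = (\<lambda>x. x)" "lam a = la" "lam b = lb" "lam c = lc" "lam d = ld"
    using dist by (auto simp: lam_def)
  have all: "P i" if "P j" "P a" "P b" "P c" "P d" for P i
    using that U by (metis UNIV_I empty_iff insert_iff)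
  have lamT: "lam i (\<theta> j) = \<theta> i" if t: "\<theta> \<in> \<Theta>" for \<theta> i
    by (rule all[of "\<lambda>i. lam i (\<theta> j) = \<theta> i" i])
      (use la[OF t] lb[OF t] mc[OF t] md[OF t] \<beta>K TK[OF t] in \<open>simp_all add: lam lc_def ld_def\<close>)
  have lame: "embeds K (lam i)" for i
    by (rule all[of "\<lambda>i. embeds K (lam i)" i])
      (use F.l F.m G.l G.m in \<open>simp_all add: lam\<close>, simp add: embeds_def additive_on_def)
  have lama: "additive_on K (lam i)" for i using lame by (auto simp: embeds_def)
  have lammal: "malnormal (lam i ` K) K'" for i
  proof (rule all[of "\<lambda>i. malnormal (lam i ` K) K'" i])
    show "malnormal (lam j ` K) K'" using malJ[OF sK F.malnormal_K] F.KA by (auto simp: lam)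
    show "malnormal (lam a ` K) K'" "malnormal (lam b ` K) K'"
      using malJ[OF subgroup_image[OF sK F.l_additive] F.malnormal_lK]
        malJ[OF subgroup_image[OF sK F.m_additive] F.malnormal_mK] F.lA F.mB by (auto simp: lam)
    show "malnormal (lam c ` K) K'" "malnormal (lam d ` K) K'"
      using malL[OF subgroup_image[OF sK G.l_additive] G.malnormal_lK]
        malL[OF subgroup_image[OF sK G.m_additive] G.malnormal_mK] G.lA G.mB by (auto simp: lam)
  qed
  have lamK': "lam i x \<in> K'" if "x \<in> K" for i x using malnormal_subset[OF lammal] that by blast
  have lamR: "x \<in> R" if "x \<in> K" "lam i x \<in> K" "i \<noteq> j" for i x
  proof -
    have "i \<noteq> j \<longrightarrow> lam i x \<in> K \<longrightarrow> x \<in> R"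
      by (rule all[of "\<lambda>i. i \<noteq> j \<longrightarrow> lam i x \<in> K \<longrightarrow> x \<in> R" i])
        (use F.l_in_K F.m_in_K G.l_in_K G.m_in_K that(1) in \<open>simp_all add: lam\<close>)
    then show ?thesis using that by blast
  qed
  have loc: "lam i x \<in> (if i = j then K else if i = a then F.A else if i = b then F.B else if i = c then G.A else G.B)"
    if x: "x \<in> K" for i x
    by (rule all[of "\<lambda>i. lam i x \<in> (if i = j then K else if i = a then F.A else if i = b then F.B else if i = c then G.A else G.B)" i])
      (use dist x F.lA F.mB G.lA G.mB in \<open>auto simp: lam\<close>)
  \<comment> \<open>Elements common to both sides lie in the core, and the core meets each of the
    smaller factors only in \<open>K\<close>.\<close>
  have FG: "p \<in> K" if "p \<in> F.A \<or> p \<in> F.B" "p \<in> G.A \<or> p \<in> G.B" for p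
  proof -
    have "p \<in> ?J" "p \<in> ?L"
      using that by (auto intro: subsetD[OF join_upper(1)] subsetD[OF join_upper(2)])
    then have "p \<in> F.core 0" using JL by (auto simp: C_def)
    then show ?thesis using F.core_Int[OF z _ that(1)] by blast
  qed
  have lamI: "lam p x \<in> K" if "p \<noteq> q" "x \<in> K" "y \<in> K" "lam p x = lam q y" for p q x y
  proof -
    have q: "q = j \<or> q = a \<or> q = b \<or> q = c \<or> q = d" and p: "p = j \<or> p = a \<or> p = b \<or> p = c \<or> p = d" using U by auto
    have 1: "lam p x \<in> (if p = j then K else if p = a then F.A else if p = b then F.B else if p = c then G.A else G.B)"
      using loc[OF that(2)] .
    have 2: "lam p x \<in> (if q = j then K else if q = a then F.A else if q = b then F.B else if q = c then G.A else G.B)"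
      using loc[OF that(3), of q] that(4) by simp
    have "p \<noteq> q" by fact
    then show ?thesis using 1 2 p q dist F.Pint G.Pint FG[of "lam p x"] by (auto split: if_splits)
  qed
  define tup where "tup x = (\<lambda>i. lam i x)" for x
  have tadd: "additive_on K tup"
    unfolding additive_on_def tup_def by (simp add: fun_eq_iff additive_on_add[OF lama])
  define \<Theta>' where "\<Theta>' = tup ` K"
  have sT': "is_subgroup \<Theta>'" unfolding \<Theta>'_def using subgroup_image[OF sK tadd] .
  have tupT: "tup (\<theta> j) = \<theta>" if "\<theta> \<in> \<Theta>" for \<theta> using lamT[OF that] by (simp add: tup_def)
  have TT': "\<Theta> \<subseteq> \<Theta>'"
  proof
    fix \<theta> assume t: "\<theta> \<in> \<Theta>"
    show "\<theta> \<in> \<Theta>'" unfolding \<Theta>'_def using tupT[OF t] TK[OF t] by (metis image_eqI)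
  qed
  have tupR: "tup x \<in> \<Theta>" if "x \<in> R" for x using that tupT by (auto simp: R_def)
  have tup0: "tup 0 = 0" using additive_on_zero[OF sK tadd] .
  \<comment> \<open>The values that equivariance forces on the copy of \<open>K\<close> at index
    \<open>i\<close>. On \<open>R\<close> they agree with \<open>\<phi>\<close>, so
    \<open>extend_hom\<close> applies.\<close>
  define fl where "fl i x = shift (s i + - s j) (\<phi> x)" for i x
  have fl: "additive_on K (fl i)" for i using \<phi> by (auto simp: additive_on_def fl_def additive_shift)
  have flR: "fl i r = \<phi> (lam i r)" if r: "r \<in> R" for i r
  proof -
    obtain \<theta> where t: "\<theta> \<in> \<Theta>" "r = \<theta> j" using r by (auto simp: R_def)
    then show ?thesis using \<phi>s[OF t(1), of i j] lamT[OF t(1)] by (simp add: fl_def)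
  qed
  obtain h1 where h1: "additive_on ?J h1" "\<forall>x\<in>K. h1 x = \<phi> x \<and> h1 (la x) = fl a x \<and> h1 (lb x) = fl b x"
    using F.extend_hom[OF \<phi> fl[of a] fl[of b]] flR[of _ a] flR[of _ b] by (auto simp: lam)
  obtain h2 where h2: "additive_on ?L h2" "\<forall>x\<in>K. h2 x = \<phi> x \<and> h2 (lc x) = fl c x \<and> h2 (ld x) = fl d x"
    using G.extend_hom[OF \<phi> fl[of c] fl[of d]] flR[of _ c] flR[of _ d] by (auto simp: lam)
  have zz0: "h (zigzag l m v y) = \<phi> v"
    if F: "free_pair K R l m" and h: "additive_on (join (join K (l ` K)) (join K (m ` K))) h" "\<forall>x\<in>K. h x = \<phi> x"
      and v: "v \<in> K" "y \<in> K" for l m h v y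
  proof -
    interpret H: free_pair K R l m by fact
    have J: "v \<in> join H.A H.B" "l y \<in> join H.A H.B" "m y \<in> join H.A H.B" using v H.JK H.Jl H.Jm by blast+
    have "h (zigzag l m v y) = h v + pw (h (l y)) (h (m y))"
      using J h(1) H.sJ by (simp add: zigzag_def zig_def pw_def additive_on_add subgroup_add)
    then show ?thesis using h(2) v by (simp add: pw_char2)
  qed
  have h12: "h1 x = h2 x" if x: "x \<in> ?J \<inter> ?L" for x
  proof -
    have xC: "x \<in> F.core 0" using x JL by (auto simp: C_def)
    then obtain W where W: "set W \<subseteq> F.letters" "x = sum_list (map ?e W)" unfolding F.core_def by blast
    have el: "?e w \<in> ?J \<and> ?e w \<in> ?L \<and> h1 (?e w) = h2 (?e w)" if w: "w \<in> F.letters" for w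
    proof (cases w)
      case (Inl g)
      then have "g \<in> K" using w by (auto simp: F.letters_def)
      then show ?thesis using Inl h1 h2 F.JK G.JK by auto
    next
      case (Inr p)
      obtain y t where p: "p = (y, t)" by (cases p)
      have y: "y \<in> K - R" "y \<in> K" using w Inr p by (auto simp: F.letters_def)
      have J: "zigzag la lb 0 y \<in> ?J" "zigzag la lb 0 y \<in> ?L"
        using F.zigzag_join[OF z y(2)] G.zigzag_join[OF uK y(2)] zz[OF y(1)] by simp_all
      have "h1 (zigzag la lb 0 y) = h2 (zigzag la lb 0 y)"
        using zz0[OF F h1(1) _ z y(2)] zz0[OF G h2(1) _ uK y(2)] h1(2) h2(2) zz[OF y(1)] \<phi>u additive_on_zero[OF sK \<phi>]
        by simp
      then show ?thesis using J Inr p h1(1) h2(1) F.sJ G.sJ by (auto simp: additive_on_uminus subgroup_uminus)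
    qed
    have "h1 x = sum_list (map h1 (map ?e W))" unfolding W(2)
      using W(1) el by (intro additive_on_sum_list[OF F.sJ h1(1)]) auto
    also have "\<dots> = sum_list (map h2 (map ?e W))" using W(1) el by (auto simp: subset_iff intro!: arg_cong[of _ _ sum_list])
    also have "\<dots> = h2 x" unfolding W(2)
      using W(1) el by (intro additive_on_sum_list[OF G.sJ h2(1), symmetric]) auto
    finally show ?thesis .
  qed
  obtain \<phi>' where \<phi>'a: "additive_on K' \<phi>'" and \<phi>': "\<forall>x\<in>?J. \<phi>' x = h1 x" "\<forall>x\<in>?L. \<phi>' x = h2 x"
    using amalgam_extend[OF am h1(1) h2(1) h12] unfolding K'_def by blast
  have \<phi>'K: "\<phi>' k = \<phi> k" if "k \<in> K" for k using that \<phi>' h1 F.JK by auto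
  have \<phi>'l: "\<phi>' (lam i x) = fl i x" if x: "x \<in> K" for i x
    by (rule all[of "\<lambda>i. \<phi>' (lam i x) = fl i x" i])
      (use x \<phi>' h1 h2 F.Jl F.Jm G.Jl G.Jm \<phi>'K in \<open>simp_all add: lam image_subset_iff\<close>, simp add: fl_def)
  have "stage K0 u s K' \<Theta>' \<phi>'"
  proof
    show "good K'" using gK' by (simp add: K'_def)
    show "torsion_free_on K'" unfolding K'_def
      using torsion_free_amalgam[OF am F.torsion_free[OF tK] G.torsion_free[OF tK]] .
    have "malnormal K K'" using lammal[of j] by (simp add: lam)
    then show "malnormal K0 K'" using malnormal_trans[OF K0] by blast
    show "u \<in> K'" using uK KK' by blast
    show "\<phi>' u = 0" using \<phi>'K[OF uK] \<phi>u by simp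
    show "is_subgroup \<Theta>'" by fact
    show "\<theta> i \<in> K'" if "\<theta> \<in> \<Theta>'" for \<theta> i using that lamK' by (auto simp: \<Theta>'_def tup_def)
    show "\<theta> = 0" if "\<theta> \<in> \<Theta>'" "\<theta> i = 0" for \<theta> i
      using that embeds_zero_iff[OF sK lame] tup0 by (auto simp: \<Theta>'_def tup_def)
    show "malnormal ((\<lambda>\<theta>. \<theta> i) ` \<Theta>') K'" for i
      using lammal[of i] by (simp add: \<Theta>'_def tup_def image_image)
    show "\<theta> = 0" if h: "\<theta> \<in> \<Theta>'" "\<eta> \<in> \<Theta>'" "p \<noteq> q" "\<theta> p = \<eta> q" "\<theta> q = \<eta> p" for \<theta> \<eta> p q
    proof -
      obtain x y where xy: "x \<in> K" "y \<in> K" "\<theta> = tup x" "\<eta> = tup y" using h(1,2) by (auto simp: \<Theta>'_def)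
      have e: "lam p x = lam q y" "lam q x = lam p y" using h(4,5) xy by (auto simp: tup_def)
      \<comment> \<open>Different coordinates meet only in \<open>K\<close>, and a coordinate other
        than \<open>j\<close> lies in \<open>K\<close> only over \<open>R\<close>. Hence both tuples
        are old ones, for which the claim is known.\<close>
      have "lam p x \<in> K" "lam q x \<in> K" "lam q y \<in> K" "lam p y \<in> K"
        using lamI[OF h(3) xy(1,2) e(1)] lamI[OF h(3)[symmetric] xy(1,2) e(2)] e by auto
      moreover have "p \<noteq> j \<or> q \<noteq> j" using h(3) by blast
      ultimately have "x \<in> R" "y \<in> R" using lamR xy by blast+
      then show ?thesis using tw[OF tupR tupR h(3)] h(4,5) xy by blast
    qed
    show "law u \<theta>" if h: "\<theta> \<in> \<Theta>'" "\<theta> \<noteq> 0" for \<theta>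
    proof -
      obtain x where x: "x \<in> K" "\<theta> = tup x" using h(1) by (auto simp: \<Theta>'_def)
      show ?thesis
      proof (cases "x \<in> R")
        case True
        then show ?thesis using lawT tupR h(2) x by blast
      next
        case False
        then have "pw (\<theta> a) (\<theta> b) = u + pw (\<theta> c) (\<theta> d)"
          using zz[of x] x by (simp add: zigzag_def zig_def pw_def tup_def lam)
        then show ?thesis unfolding law_def by blast
      qed
    qed
    show "\<theta> = 0" if h: "\<theta> \<in> \<Theta>'" "\<theta> I0 \<in> K0" "\<theta> I1 \<in> K0" for \<theta>
    proof -
      obtain x where x: "x \<in> K" "\<theta> = tup x" using h(1) by (auto simp: \<Theta>'_def)
      have "lam I0 x \<in> K" "lam I1 x \<in> K" using h(2,3) x malnormal_subset[OF K0] by (auto simp: tup_def)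
      moreover have "I0 \<noteq> j \<or> I1 \<noteq> j" by auto
      ultimately have "x \<in> R" using lamR x by blast
      then show ?thesis using TK0 tupR h x by blast
    qed
    show "additive_on K' \<phi>'" by fact
    show "\<phi>' (\<theta> i) = shift (s i + - s k) (\<phi>' (\<theta> k))" if "\<theta> \<in> \<Theta>'" for \<theta> i k
      using that \<phi>'l by (auto simp: \<Theta>'_def tup_def fl_def shift_add add.assoc)
  qed
  moreover have "\<exists>\<theta>\<in>\<Theta>'. \<theta> j = k" if "k \<in> K" for k
    using that by (intro bexI[of _ "tup k"]) (auto simp: tup_def lam \<Theta>'_def)
  ultimately show ?thesis using KK' TT' \<phi>'K by blast
qed

subsection \<open>The limit\<close>

text \<open>The start is an infinite cyclic group on \<open>e\<close> with no partial map beyond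
  \<open>0\<close>. The function assigned to \<open>e\<close> is the delta function at
  \<open>0\<close>, since no nontrivial translation fixes it; its double vanishes in characteristic
  two, while \<open>e + e\<close> does not.\<close>

lemma stage_init:
  fixes s :: "idx \<Rightarrow> 'f::group_add"
  obtains K0 e \<phi> where "stage K0 (e + e) s K0 {0} \<phi>" "e \<in> K0" "e + e \<noteq> 0" "\<phi> e = (\<lambda>v. if v = 0 then 1 else 0)"
proof -
  note I = subgroup_UNIV[where 'a = int]
  obtain f :: "int \<Rightarrow> nat sym" where f: "embeds UNIV f" "good (range f)"
    using cayley[OF I] by auto
  have fa: "additive_on UNIV f" and fi: "inj f" using f(1) by (auto simp: embeds_def)
  define g where "g = inv_into UNIV f"
  have gf: "g (f n) = n" for n using fi by (simp add: g_def)
  define \<phi> where "\<phi> k = (\<lambda>v :: 'f. if v = 0 then of_int (g k) else (0 :: bit))" for k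
  show thesis
  proof (rule that[of "range f" "f 1" \<phi>])
    have e: "f 1 + f 1 = f 2" using additive_on_add[OF fa, of 1 1] by simp
    show "stage (range f) (f 1 + f 1) s (range f) {0} \<phi>"
    proof
      show "good (range f)" by fact
      show "torsion_free_on (range f)" using torsion_free_image[OF I f(1) torsion_free_int] .
      show "malnormal (range f) (range f)" by (simp add: malnormal_def)
      show "f 1 + f 1 \<in> range f" by (simp add: e)
      show "\<phi> (f 1 + f 1) = 0" by (simp add: e \<phi>_def gf fun_eq_iff)
      show "is_subgroup {0 :: idx \<Rightarrow> nat sym}" by (simp add: is_subgroup_def)
      have "0 = f 0" using additive_on_zero[OF I fa] by simp
      then have z: "0 \<in> range f" by blast
      show "\<theta> i \<in> range f" if "\<theta> \<in> {0}" for \<theta> :: "idx \<Rightarrow> nat sym" and i using that z by simp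
      show "malnormal ((\<lambda>\<theta>. \<theta> i) ` {0 :: idx \<Rightarrow> nat sym}) (range f)" for i
        using z by (simp add: malnormal_def)
      show "additive_on (range f) \<phi>"
        unfolding additive_on_def
      proof (intro ballI)
        fix x y assume "x \<in> range f" "y \<in> range f"
        then obtain m n where mn: "x = f m" "y = f n" by blast
        have "x + y = f (m + n)" using mn additive_on_add[OF fa, of m n] by simp
        then show "\<phi> (x + y) = \<phi> x + \<phi> y" by (simp add: mn \<phi>_def gf fun_eq_iff)
      qed
      have "\<phi> 0 = 0" using \<open>0 = f 0\<close> gf[of 0] by (simp add: \<phi>_def fun_eq_iff)
      then show "\<phi> (\<theta> i) = shift (s i + - s k) (\<phi> (\<theta> k))" if "\<theta> \<in> {0}" for \<theta> :: "idx \<Rightarrow> nat sym" and i k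
        using that by (simp add: shift_def fun_eq_iff)
    qed auto
    show "f 1 \<in> range f" by simp
    show "f 1 + f 1 \<noteq> 0" using embeds_zero_iff[OF I f(1), of 2] by (simp add: e)
    show "\<phi> (f 1) = (\<lambda>v. if v = 0 then 1 else 0)" by (auto simp: \<phi>_def gf fun_eq_iff)
  qed
qed

lemma stage_extend_list:
  fixes js :: "idx list"
  assumes "stage K0 u s K \<Theta> \<phi>"
  shows "\<exists>K' \<Theta>' \<phi>'. stage K0 u s K' \<Theta>' \<phi>' \<and> K \<subseteq> K' \<and> \<Theta> \<subseteq> \<Theta>' \<and> (\<forall>k\<in>K. \<phi>' k = \<phi> k) \<and>
    (\<forall>j\<in>set js. \<forall>k\<in>K. \<exists>\<theta>\<in>\<Theta>'. \<theta> j = k)"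
proof (induction js)
  case Nil
  then show ?case using assms by auto
next
  case (Cons j js)
  then obtain K1 \<Theta>1 \<phi>1 where 1: "stage K0 u s K1 \<Theta>1 \<phi>1" "K \<subseteq> K1" "\<Theta> \<subseteq> \<Theta>1" "\<forall>k\<in>K. \<phi>1 k = \<phi> k"
    "\<forall>j\<in>set js. \<forall>k\<in>K. \<exists>\<theta>\<in>\<Theta>1. \<theta> j = k" by blast
  obtain K2 \<Theta>2 \<phi>2 where 2: "stage K0 u s K2 \<Theta>2 \<phi>2" "K1 \<subseteq> K2" "\<Theta>1 \<subseteq> \<Theta>2" "\<forall>k\<in>K1. \<phi>2 k = \<phi>1 k"
    "\<forall>k\<in>K1. \<exists>\<theta>\<in>\<Theta>2. \<theta> j = k" using stage_extend[OF 1(1), of j] by blast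
  have "\<forall>i\<in>set (j # js). \<forall>k\<in>K. \<exists>\<theta>\<in>\<Theta>2. \<theta> i = k"
  proof (intro ballI)
    fix i k assume i: "i \<in> set (j # js)" and k: "k \<in> K"
    show "\<exists>\<theta>\<in>\<Theta>2. \<theta> i = k"
    proof (cases "i = j")
      case True
      then show ?thesis using 2(5) 1(2) k by blast
    next
      case False
      then have "i \<in> set js" using i by simp
      then obtain \<theta> where "\<theta> \<in> \<Theta>1" "\<theta> i = k" using 1(5) k by blast
      then show ?thesis using 2(3) by blast
    qed
  qed
  moreover have "\<forall>k\<in>K. \<phi>2 k = \<phi> k" using 1(2,4) 2(4) by auto
  ultimately show ?case using 1(2,3) 2(1,2,3)
    by (intro exI[of _ K2] exI[of _ \<Theta>2] exI[of _ \<phi>2]) auto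
qed

lemma stage_extend_all:
  assumes "stage K0 u s K \<Theta> \<phi>"
  shows "\<exists>K' \<Theta>' \<phi>'. stage K0 u s K' \<Theta>' \<phi>' \<and> K \<subseteq> K' \<and> \<Theta> \<subseteq> \<Theta>' \<and> (\<forall>k\<in>K. \<phi>' k = \<phi> k) \<and>
    (\<forall>j. \<forall>k\<in>K. \<exists>\<theta>\<in>\<Theta>'. \<theta> j = k)"
proof -
  have "j \<in> set [I0, I1, I2, I3, I4]" for j by (cases j) auto
  then show ?thesis using stage_extend_list[OF assms, of "[I0, I1, I2, I3, I4]"] by metis
qed

text \<open>In the limit all partial isomorphisms are total, so that \<open>\<Theta>\<close> is the graph of automorphisms of \<open>K\<close>.\<close>

locale total_stage =
  fixes s :: "idx \<Rightarrow> 'f::group_add" and K :: "nat sym set" and u e :: "nat sym"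
    and \<Theta> :: "(idx \<Rightarrow> nat sym) set" and \<phi> :: "nat sym \<Rightarrow> 'f \<Rightarrow> bit"
  assumes K: "is_subgroup K" and countable_K: "countable K" and torsion_free_K: "torsion_free_on K"
    and u: "u \<in> K" "u \<noteq> 0" and e: "e \<in> K"
    and T: "is_subgroup \<Theta>" and TK: "\<And>\<theta> i. \<theta> \<in> \<Theta> \<Longrightarrow> \<theta> i \<in> K" and surj: "\<And>i k. k \<in> K \<Longrightarrow> \<exists>\<theta>\<in>\<Theta>. \<theta> i = k"
    and T0: "\<And>\<theta> i. \<theta> \<in> \<Theta> \<Longrightarrow> \<theta> i = 0 \<Longrightarrow> \<theta> = 0" and law: "\<And>\<theta>. \<theta> \<in> \<Theta> \<Longrightarrow> \<theta> \<noteq> 0 \<Longrightarrow> law u \<theta>"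
    and \<phi>: "additive_on K \<phi>" and \<phi>s: "\<And>\<theta> i k. \<theta> \<in> \<Theta> \<Longrightarrow> \<phi> (\<theta> i) = shift (s i + - s k) (\<phi> (\<theta> k))"
    and \<phi>e: "\<phi> e = (\<lambda>v. if v = 0 then 1 else 0)"
    and cent: "\<And>\<theta> x. \<theta> \<in> \<Theta> \<Longrightarrow> \<theta> I0 = e \<Longrightarrow> x \<in> K \<Longrightarrow> x + e + - x = e \<Longrightarrow> x + \<theta> I1 + - x = \<theta> I1 \<Longrightarrow> x = 0"

lemma total_stage_exists:
  fixes s :: "idx \<Rightarrow> 'f::group_add"
  obtains K u e \<Theta> \<phi> where "total_stage s K u e \<Theta> \<phi>"
proof -
  obtain K0 e and \<phi>0 :: "nat sym \<Rightarrow> 'f \<Rightarrow> bit" where init: "stage K0 (e + e) s K0 {0} \<phi>0" and e: "e \<in> K0" "e + e \<noteq> 0"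
    and \<phi>0e: "\<phi>0 e = (\<lambda>v. if v = 0 then 1 else 0)" by (rule stage_init)
  define u where "u = e + e"
  define P where "P = (\<lambda>(n :: nat) (K, \<Theta>, \<phi>). stage K0 u s K \<Theta> \<phi> \<and> (n = 0 \<longrightarrow> K = K0 \<and> \<phi> = \<phi>0))"
  define Q where "Q = (\<lambda>(n :: nat) (K, \<Theta>, \<phi>) (K', \<Theta>', \<phi>'). K \<subseteq> K' \<and> \<Theta> \<subseteq> \<Theta>' \<and> (\<forall>k\<in>K. \<phi>' k = (\<phi> :: nat sym \<Rightarrow> 'f \<Rightarrow> bit) k) \<and>
    (\<forall>j :: idx. \<forall>k\<in>K. \<exists>\<theta>\<in>\<Theta>'. \<theta> j = (k :: nat sym)))"
  have "\<exists>S. \<forall>n. P n (S n) \<and> Q n (S n) (S (Suc n))"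
  proof (rule dependent_nat_choice)
    show "\<exists>x. P 0 x" using init by (intro exI[of _ "(K0, {0}, \<phi>0)"]) (simp add: P_def u_def)
    fix x n assume "P n x"
    moreover obtain K \<Theta> \<phi> where "x = (K, \<Theta>, \<phi>)" by (cases x)
    ultimately have "stage K0 u s K \<Theta> \<phi>" "x = (K, \<Theta>, \<phi>)" by (auto simp: P_def)
    with stage_extend_all[OF this(1)] show "\<exists>y. P (Suc n) y \<and> Q n x y" by (auto simp: P_def Q_def)
  qed
  then obtain S where S: "\<And>n. P n (S n)" "\<And>n. Q n (S n) (S (Suc n))" by blast
  define Kn where "Kn n = fst (S n)" for n
  define Tn where "Tn n = fst (snd (S n))" for n
  define Fn where "Fn n = snd (snd (S n))" for n
  have st: "stage K0 u s (Kn n) (Tn n) (Fn n)" for n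
    using S(1)[of n] by (auto simp: P_def Kn_def Tn_def Fn_def split: prod.splits)
  have zero: "Kn 0 = K0" "Fn 0 = \<phi>0"
    using S(1)[of 0] by (auto simp: P_def Kn_def Fn_def split: prod.splits)
  have suc: "Kn n \<subseteq> Kn (Suc n)" "Tn n \<subseteq> Tn (Suc n)" "\<And>k. k \<in> Kn n \<Longrightarrow> Fn (Suc n) k = Fn n k"
    "\<And>j k. k \<in> Kn n \<Longrightarrow> \<exists>\<theta>\<in>Tn (Suc n). \<theta> j = k" for n
    using S(2)[of n] by (auto simp: Q_def Kn_def Tn_def Fn_def split: prod.splits)
  have Kmono: "Kn m \<subseteq> Kn n" and Tmono: "Tn m \<subseteq> Tn n" if "m \<le> n" for m n
    using that suc(1,2) lift_Suc_mono_le[of Kn] lift_Suc_mono_le[of Tn] by blast+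
  have Fmono: "Fn n k = Fn m k" if "m \<le> n" "k \<in> Kn m" for m n k
    using that
  proof (induction n rule: dec_induct)
    case (step n)
    then show ?case using suc(3)[of k n] Kmono[of m n] by auto
  qed simp
  define K where "K = (\<Union>n. Kn n)"
  define \<Theta> where "\<Theta> = (\<Union>n. Tn n)"
  \<comment> \<open>Any stage containing \<open>k\<close> gives the same value, as later maps extend
    earlier ones.\<close>
  define \<phi> where "\<phi> k = Fn (LEAST n. k \<in> Kn n) k" for k
  have \<phi>n: "\<phi> k = Fn n k" if "k \<in> Kn n" for k n
    unfolding \<phi>_def using that LeastI[of "\<lambda>n. k \<in> Kn n" n] Least_le[of "\<lambda>n. k \<in> Kn n" n] Fmono by metis
  interpret st: stage K0 u s "Kn n" "Tn n" "Fn n" for n by (rule st)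
  have two: "\<exists>n. x \<in> Kn n \<and> y \<in> Kn n" if "x \<in> K" "y \<in> K" for x y
  proof -
    obtain m n where "x \<in> Kn m" "y \<in> Kn n" using \<open>x \<in> K\<close> \<open>y \<in> K\<close> by (auto simp: K_def)
    then show ?thesis using Kmono[of m "max m n"] Kmono[of n "max m n"] by (intro exI[of _ "max m n"]) auto
  qed
  have twoT: "\<exists>n. x \<in> Tn n \<and> y \<in> Tn n" if "x \<in> \<Theta>" "y \<in> \<Theta>" for x y
  proof -
    obtain m n where "x \<in> Tn m" "y \<in> Tn n" using \<open>x \<in> \<Theta>\<close> \<open>y \<in> \<Theta>\<close> by (auto simp: \<Theta>_def)
    then show ?thesis using Tmono[of m "max m n"] Tmono[of n "max m n"] by (intro exI[of _ "max m n"]) auto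
  qed
  have sKn: "is_subgroup (Kn n)" for n using st.gK by (rule good_subgroup)
  have KnK: "Kn n \<subseteq> K" for n by (auto simp: K_def)
  have TnT: "Tn n \<subseteq> \<Theta>" for n by (auto simp: \<Theta>_def)
  have sK: "is_subgroup K"
    unfolding is_subgroup_def
  proof (intro conjI ballI)
    show "0 \<in> K" using subgroup_zero[OF sKn] KnK by blast
    show "x + y \<in> K" if "x \<in> K" "y \<in> K" for x y using two[OF that] subgroup_add[OF sKn] KnK by blast
    show "- x \<in> K" if "x \<in> K" for x using two[OF that that] subgroup_uminus[OF sKn] KnK by blast
  qed
  have sT: "is_subgroup \<Theta>"
    unfolding is_subgroup_def
  proof (intro conjI ballI)
    show "0 \<in> \<Theta>" using subgroup_zero[OF st.T] TnT by blast
    show "x + y \<in> \<Theta>" if "x \<in> \<Theta>" "y \<in> \<Theta>" for x y using twoT[OF that] subgroup_add[OF st.T] TnT by blast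
    show "- x \<in> \<Theta>" if "x \<in> \<Theta>" for x using twoT[OF that that] subgroup_uminus[OF st.T] TnT by blast
  qed
  have TK: "\<theta> i \<in> K" if "\<theta> \<in> \<Theta>" for \<theta> i
  proof -
    obtain n where "\<theta> \<in> Tn n" using \<open>\<theta> \<in> \<Theta>\<close> by (auto simp: \<Theta>_def)
    then show ?thesis using st.TK KnK by blast
  qed
  have surj: "\<exists>\<theta>\<in>\<Theta>. \<theta> i = k" if "k \<in> K" for i k
  proof -
    obtain n where "k \<in> Kn n" using \<open>k \<in> K\<close> by (auto simp: K_def)
    then show ?thesis using suc(4) TnT by blast
  qed
  have T0: "\<theta> = 0" if "\<theta> \<in> \<Theta>" "\<theta> i = 0" for \<theta> i using that st.T0 by (auto simp: \<Theta>_def)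
  have mal: "malnormal K0 K"
    unfolding malnormal_def
  proof (intro conjI ballI impI)
    show "K0 \<subseteq> K" using KnK[of 0] zero by simp
    fix x h assume x: "x \<in> K" and h: "h \<in> K0" "h \<noteq> 0" "x + h + - x \<in> K0"
    obtain n where "x \<in> Kn n" using x by (auto simp: K_def)
    then show "x \<in> K0" using malnormalD[OF st.K0 _ h] by blast
  qed
  have TK0: "\<theta> = 0" if "\<theta> \<in> \<Theta>" "\<theta> I0 \<in> K0" "\<theta> I1 \<in> K0" for \<theta> using that st.TK0 by (auto simp: \<Theta>_def)
  have eK: "e \<in> K" using e malnormal_subset[OF mal] by blast
  have "total_stage s K u e \<Theta> \<phi>"
  proof
    show "is_subgroup K" "is_subgroup \<Theta>" by fact+
    show "countable K" using good_countable[OF st.gK] by (auto simp: K_def)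
    show "torsion_free_on K" using st.tK by (auto simp: torsion_free_on_def K_def)
    show "u \<in> K" using eK sK by (simp add: u_def subgroup_add)
    show "u \<noteq> 0" using e by (simp add: u_def)
    show "e \<in> K" by fact
    show "law u \<theta>" if "\<theta> \<in> \<Theta>" "\<theta> \<noteq> 0" for \<theta> using that st.lawT by (auto simp: \<Theta>_def)
    show "additive_on K \<phi>"
      unfolding additive_on_def
    proof (intro ballI)
      fix x y assume "x \<in> K" "y \<in> K"
      then obtain n where "x \<in> Kn n" "y \<in> Kn n" using two by blast
      then show "\<phi> (x + y) = \<phi> x + \<phi> y"
        using \<phi>n[of x n] \<phi>n[of y n] \<phi>n[of "x + y" n] additive_on_add[OF st.\<phi>, of x n y] subgroup_add[OF sKn, of x n y]
        by simp
    qed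
    show "\<phi> (\<theta> i) = shift (s i + - s k) (\<phi> (\<theta> k))" if "\<theta> \<in> \<Theta>" for \<theta> i k
    proof -
      obtain n where n: "\<theta> \<in> Tn n" using \<open>\<theta> \<in> \<Theta>\<close> by (auto simp: \<Theta>_def)
      then have "\<phi> (\<theta> i) = Fn n (\<theta> i)" "\<phi> (\<theta> k) = Fn n (\<theta> k)" using \<phi>n st.TK by blast+
      then show ?thesis using st.\<phi>s[OF n] by simp
    qed
    show "\<phi> e = (\<lambda>v. if v = 0 then 1 else 0)" using \<phi>n[of e 0] e zero \<phi>0e by simp
    fix \<theta> x assume t: "\<theta> \<in> \<Theta>" "\<theta> I0 = e" and x: "x \<in> K" "x + e + - x = e" "x + \<theta> I1 + - x = \<theta> I1"
    have e0: "e \<noteq> 0" using e(2) by auto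
    have xK0: "x \<in> K0" using malnormalD[OF mal x(1) e(1) e0] x(2) e(1) by simp
    \<comment> \<open>The second commutation is pulled back along the isomorphism from coordinate
      \<open>I0\<close> to \<open>I1\<close>: the commutator of \<open>\<eta>\<close> and
      \<open>\<theta>\<close> vanishes at \<open>I1\<close>, hence at \<open>I0\<close>. So
      \<open>\<eta> I0\<close> commutes with \<open>e\<close> and lies in \<open>K0\<close> by
      malnormality, as does \<open>x = \<eta> I1\<close>; then \<open>TK0\<close> forces
      \<open>\<eta>\<close> to be zero.\<close>
    obtain \<eta> where \<eta>: "\<eta> \<in> \<Theta>" "\<eta> I1 = x" using surj[OF x(1)] by blast
    have "\<eta> + \<theta> + - \<eta> + - \<theta> \<in> \<Theta>" using t(1) \<eta>(1) sT by (simp add: subgroup_add subgroup_uminus)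
    moreover have "(\<eta> + \<theta> + - \<eta> + - \<theta>) I1 = 0" using \<eta>(2) x(3) by simp
    ultimately have "\<eta> + \<theta> + - \<eta> + - \<theta> = 0" by (rule T0)
    then have "(\<eta> + \<theta> + - \<eta> + - \<theta>) I0 = 0" by simp
    then have "\<eta> I0 + e + - \<eta> I0 = e" using t(2) by (simp add: add_eq_0_iff2)
    then have "\<eta> I0 \<in> K0" using malnormalD[OF mal TK[OF \<eta>(1)] e(1) e0] e(1) by simp
    then have "\<eta> = 0" using TK0[OF \<eta>(1)] \<eta>(2) xK0 by simp
    then show "x = 0" using \<eta>(2) by simp
  qed (use TK surj T0 in blast)+
  then show thesis by (rule that)
qed

text \<open>Extended by the identity off \<open>K\<close>, the automorphisms become permutations of
  the whole type. They thus lie in a group, which can serve as the target of a homomorphism from the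
  free group.\<close>

lemma (in total_stage) automorphism_exists:
  "\<exists>q :: idx \<Rightarrow> nat sym sym. q I0 = 0 \<and> (\<forall>\<theta>\<in>\<Theta>. \<forall>i. app (q i) (\<theta> I0) = \<theta> i)"
proof -
  have inj: "\<theta> = \<eta>" if "\<theta> \<in> \<Theta>" "\<eta> \<in> \<Theta>" "\<theta> i = \<eta> i" for \<theta> \<eta> i
  proof -
    have "\<theta> + - \<eta> \<in> \<Theta>" using that T by (simp add: subgroup_add subgroup_uminus)
    moreover have "(\<theta> + - \<eta>) i = 0" using that(3) by simp
    ultimately have "\<theta> + - \<eta> = 0" by (rule T0)
    then show ?thesis by (simp add: add_eq_0_iff2)
  qed
  define t where "t i k = (THE \<theta>. \<theta> \<in> \<Theta> \<and> \<theta> i = k)" for i k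
  have t: "t i (\<theta> i) = \<theta>" if "\<theta> \<in> \<Theta>" for \<theta> i
    unfolding t_def using that inj by blast
  define p where "p a b k = (if k \<in> K then t a k b else k)" for a b k
  have pT: "p a b (\<theta> a) = \<theta> b" if "\<theta> \<in> \<Theta>" for \<theta> a b using t[OF that] TK[OF that] by (simp add: p_def)
  have pp: "p a b (p b a k) = k" for a b k
  proof (cases "k \<in> K")
    case True
    then obtain \<theta> where "\<theta> \<in> \<Theta>" "k = \<theta> b" using surj by metis
    then show ?thesis using pT by simp
  qed (simp add: p_def)
  have bij: "bij (p a b)" for a b using pp by (intro o_bij[of "p b a"]) (auto simp: fun_eq_iff)
  have "p I0 I0 k = k" for k
  proof (cases "k \<in> K")
    case True
    then obtain \<theta> where "\<theta> \<in> \<Theta>" "k = \<theta> I0" using surj by metis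
    then show ?thesis using pT by simp
  qed (simp add: p_def)
  then have "Sym (p I0 I0) = 0" using bij by (intro sym_eqI) (simp add: app_Sym)
  moreover have "app (Sym (p I0 i)) (\<theta> I0) = \<theta> i" if "\<theta> \<in> \<Theta>" for \<theta> i using pT[OF that] bij by (simp add: app_Sym)
  ultimately show ?thesis by (intro exI[of _ "\<lambda>i. Sym (p I0 i)"]) blast
qed

subsection \<open>A free group of rank four\<close>

definition zmul :: "int \<Rightarrow> 'g \<Rightarrow> 'g::group_add" where
  "zmul n x = nmul (nat n) x + - nmul (nat (- n)) x"

lemma nmul_add: "nmul (m + n) x = nmul m x + nmul n x"
  by (induction m) (simp_all add: nmul_Suc add.assoc)

lemma nmul_Suc_right: "nmul (Suc n) x = nmul n x + x"
  using nmul_add[of n 1 x] by (simp add: nmul_Suc)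

lemma zmul_succ: "zmul (n + 1) x = zmul n x + x"
proof (cases "0 \<le> n")
  case True
  then have "nat (n + 1) = Suc (nat n)" "nat (- n) = 0" "nat (- (n + 1)) = 0" by auto
  then show ?thesis by (simp only: zmul_def nmul_Suc_right) simp
next
  case False
  then have "nat (- n) = Suc (nat (- (n + 1)))" "nat n = 0" "nat (n + 1) = 0" by auto
  then show ?thesis by (simp only: zmul_def nmul_Suc minus_add) (simp add: add.assoc)
qed

lemma zmul_pred: "zmul (n - 1) x = zmul n x + - x"
  using zmul_succ[of "n - 1" x] by (simp add: add.assoc)

lemma zmul_additive: "additive_on UNIV (\<lambda>n. zmul n x)"
  unfolding additive_on_def
proof (intro ballI)
  fix m n
  show "zmul (m + n) x = zmul m x + zmul n x"
  proof (induction n rule: int_induct[where k = 0])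
    case base
    then show ?case by (simp add: zmul_def)
  next
    case (step1 i)
    then show ?case using zmul_succ[of "m + i" x] zmul_succ[of i x] by (simp add: add.assoc)
  next
    case (step2 i)
    then show ?case using zmul_pred[of "m + i" x] zmul_pred[of i x] by (simp add: add.assoc add_diff_eq)
  qed
qed

text \<open>The free product with an infinite cyclic group, obtained as an amalgam over the trivial
  subgroup. The minimality clause allows proofs on generators, and the last clause is the universal
  property for one fixed target type.\<close>

lemma free_extend:
  assumes F: "good F"
  obtains F' t where "good F'" "F \<subseteq> F'" "t \<in> F'" "torsion_free_on F \<Longrightarrow> torsion_free_on F'"
    "\<And>S. is_subgroup S \<Longrightarrow> F \<subseteq> S \<Longrightarrow> t \<in> S \<Longrightarrow> F' \<subseteq> S"
    "\<And>(f :: nat sym \<Rightarrow> 'h::group_add) h. additive_on F f \<Longrightarrow> \<exists>f'. additive_on F' f' \<and> (\<forall>x\<in>F. f' x = f x) \<and> f' t = h"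
proof -
  note sF = good_subgroup[OF F]
  note I = subgroup_UNIV[where 'a = int]
  have Z: "is_subgroup {0 :: nat sym}" "{0} \<subseteq> F" using subgroup_zero[OF sF] by (auto simp: is_subgroup_def)
  have E: "embeds {0 :: nat sym} (\<lambda>_. 0 :: int)" by (simp add: embeds_def additive_on_def)
  obtain \<beta> :: "int \<Rightarrow> nat sym" where \<beta>: "embeds UNIV \<beta>" "F \<inter> range \<beta> = {0}" "amalgam F (range \<beta>)"
      "good (join F (range \<beta>))"
    using amalgam_exists[OF F I _ Z E] by (metis countableI_type subset_UNIV)
  have \<beta>a: "additive_on UNIV \<beta>" and \<beta>i: "inj \<beta>" using \<beta>(1) by (auto simp: embeds_def)
  define F' where "F' = join F (range \<beta>)"
  have sub: "F \<subseteq> F'" "range \<beta> \<subseteq> F'" unfolding F'_def by (rule join_upper)+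
  show thesis
  proof (rule that[of F' "\<beta> 1"])
    show "good F'" using \<beta>(4) by (simp add: F'_def)
    show "F \<subseteq> F'" "\<beta> 1 \<in> F'" using sub by auto
    show "torsion_free_on F'" if "torsion_free_on F" unfolding F'_def
      using torsion_free_amalgam[OF \<beta>(3) that torsion_free_image[OF I \<beta>(1) torsion_free_int]] .
    show "F' \<subseteq> S" if S: "is_subgroup S" "F \<subseteq> S" "\<beta> 1 \<in> S" for S
    proof -
      have "\<beta> n \<in> S" for n
      proof (induction n rule: int_induct[where k = 0])
        case base
        then show ?case using additive_on_zero[OF I \<beta>a] subgroup_zero[OF S(1)] by simp
      next
        case (step1 i)
        then show ?case using additive_on_add[OF \<beta>a, of i 1] S by (simp add: subgroup_add)
      next
        case (step2 i)
        have "\<beta> (i - 1) = \<beta> i + - \<beta> 1"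
          using additive_on_add[OF \<beta>a, of i "- 1"] additive_on_uminus[OF I \<beta>a, of 1] by (simp add: add_uminus_conv_diff)
        then show ?case using step2 S by (simp add: subgroup_add subgroup_uminus)
      qed
      then show ?thesis unfolding F'_def using S by (intro join_least) auto
    qed
    fix f :: "nat sym \<Rightarrow> 'h" and h :: 'h assume f: "additive_on F f"
    define g where "g x = zmul (inv_into UNIV \<beta> x) h" for x
    have g\<beta>: "g (\<beta> n) = zmul n h" for n using \<beta>i by (simp add: g_def)
    have "additive_on (range \<beta>) g"
      unfolding additive_on_def
    proof (intro ballI)
      fix x y assume "x \<in> range \<beta>" "y \<in> range \<beta>"
      then obtain m n where mn: "x = \<beta> m" "y = \<beta> n" by blast
      then have "x + y = \<beta> (m + n)" using additive_on_add[OF \<beta>a, of m n] by simp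
      then show "g (x + y) = g x + g y" using mn g\<beta> additive_on_add[OF zmul_additive, of m n h] by simp
    qed
    moreover have "f c = g c" if "c \<in> F \<inter> range \<beta>" for c
    proof -
      have "c = 0" "c = \<beta> 0" using that \<beta>(2) additive_on_zero[OF I \<beta>a] by auto
      then show ?thesis using additive_on_zero[OF sF f] g\<beta>[of 0] by (simp add: zmul_def)
    qed
    ultimately obtain f' where "additive_on F' f'" "\<forall>a\<in>F. f' a = f a" "\<forall>b\<in>range \<beta>. f' b = g b"
      using amalgam_extend[OF \<beta>(3) f] unfolding F'_def by blast
    moreover have "g (\<beta> 1) = h" by (simp add: g\<beta> zmul_def nmul_Suc)
    ultimately show "\<exists>f'. additive_on F' f' \<and> (\<forall>x\<in>F. f' x = f x) \<and> f' (\<beta> 1) = h" by auto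
  qed
qed

lemma free_group_exists:
  obtains F :: "nat sym set" and s :: "idx \<Rightarrow> nat sym" where
    "is_subgroup F" "countable F" "torsion_free_on F" "s I0 = 0" "\<And>i. s i \<in> F"
    "\<And>S. is_subgroup S \<Longrightarrow> (\<And>i. s i \<in> S) \<Longrightarrow> F \<subseteq> S"
    "\<And>h :: idx \<Rightarrow> 'h::group_add. h I0 = 0 \<Longrightarrow> \<exists>f. additive_on F f \<and> (\<forall>i. f (s i) = h i)"
proof -
  have Z: "is_subgroup {0 :: nat sym}" by (simp add: is_subgroup_def)
  obtain g :: "nat sym \<Rightarrow> nat sym" where g: "embeds {0} g" "good (g ` {0})" using cayley[OF Z] by auto
  have "g 0 = 0" using additive_on_zero[OF Z] g(1) by (auto simp: embeds_def)
  then have Z: "good {0 :: nat sym}" using g(2) by simp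
  obtain F1 t1 where 1: "good F1" "{0} \<subseteq> F1" "t1 \<in> F1" "torsion_free_on {0 :: nat sym} \<Longrightarrow> torsion_free_on F1"
    "\<And>S. is_subgroup S \<Longrightarrow> {0} \<subseteq> S \<Longrightarrow> t1 \<in> S \<Longrightarrow> F1 \<subseteq> S"
    "\<And>(f :: nat sym \<Rightarrow> 'h) h. additive_on {0} f \<Longrightarrow> \<exists>f'. additive_on F1 f' \<and> (\<forall>x\<in>{0}. f' x = f x) \<and> f' t1 = h"
    using free_extend[OF Z, where 'h = 'h] by blast
  obtain F2 t2 where 2: "good F2" "F1 \<subseteq> F2" "t2 \<in> F2" "torsion_free_on F1 \<Longrightarrow> torsion_free_on F2"
    "\<And>S. is_subgroup S \<Longrightarrow> F1 \<subseteq> S \<Longrightarrow> t2 \<in> S \<Longrightarrow> F2 \<subseteq> S"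
    "\<And>(f :: nat sym \<Rightarrow> 'h) h. additive_on F1 f \<Longrightarrow> \<exists>f'. additive_on F2 f' \<and> (\<forall>x\<in>F1. f' x = f x) \<and> f' t2 = h"
    using free_extend[OF 1(1), where 'h = 'h] by blast
  obtain F3 t3 where 3: "good F3" "F2 \<subseteq> F3" "t3 \<in> F3" "torsion_free_on F2 \<Longrightarrow> torsion_free_on F3"
    "\<And>S. is_subgroup S \<Longrightarrow> F2 \<subseteq> S \<Longrightarrow> t3 \<in> S \<Longrightarrow> F3 \<subseteq> S"
    "\<And>(f :: nat sym \<Rightarrow> 'h) h. additive_on F2 f \<Longrightarrow> \<exists>f'. additive_on F3 f' \<and> (\<forall>x\<in>F2. f' x = f x) \<and> f' t3 = h"
    using free_extend[OF 2(1), where 'h = 'h] by blast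
  obtain F4 t4 where 4: "good F4" "F3 \<subseteq> F4" "t4 \<in> F4" "torsion_free_on F3 \<Longrightarrow> torsion_free_on F4"
    "\<And>S. is_subgroup S \<Longrightarrow> F3 \<subseteq> S \<Longrightarrow> t4 \<in> S \<Longrightarrow> F4 \<subseteq> S"
    "\<And>(f :: nat sym \<Rightarrow> 'h) h. additive_on F3 f \<Longrightarrow> \<exists>f'. additive_on F4 f' \<and> (\<forall>x\<in>F3. f' x = f x) \<and> f' t4 = h"
    using free_extend[OF 3(1), where 'h = 'h] by blast
  define s where "s i = (case i of I0 \<Rightarrow> 0 | I1 \<Rightarrow> t1 | I2 \<Rightarrow> t2 | I3 \<Rightarrow> t3 | I4 \<Rightarrow> t4)" for i
  have s: "s I0 = 0" "s I1 = t1" "s I2 = t2" "s I3 = t3" "s I4 = t4" by (simp_all add: s_def)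
  show thesis
  proof (rule that[of F4 s])
    show "is_subgroup F4" "countable F4" using good_subgroup good_countable 4(1) by blast+
    have "torsion_free_on {0 :: nat sym}" by (simp add: torsion_free_on_def)
    then show "torsion_free_on F4" using 1(4) 2(4) 3(4) 4(4) by blast
    show "s I0 = 0" by (rule s)
    show "s i \<in> F4" for i using 1(2,3) 2(2,3) 3(2,3) 4(2,3) by (cases i) (auto simp: s)
    show "F4 \<subseteq> S" if S: "is_subgroup S" "\<And>i. s i \<in> S" for S
    proof -
      have "t1 \<in> S" "t2 \<in> S" "t3 \<in> S" "t4 \<in> S" "{0} \<subseteq> S"
        using S(2)[of I1] S(2)[of I2] S(2)[of I3] S(2)[of I4] S(2)[of I0] by (simp_all add: s)
      then show ?thesis using 1(5)[OF S(1)] 2(5)[OF S(1)] 3(5)[OF S(1)] 4(5)[OF S(1)] by blast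
    qed
    fix h :: "idx \<Rightarrow> 'h" assume h0: "h I0 = 0"
    have "additive_on {0} (\<lambda>_ :: nat sym. 0 :: 'h)" by (simp add: additive_on_def)
    from 1(6)[OF this, of "h I1"] obtain f1 where f1: "additive_on F1 f1" "f1 0 = 0" "f1 t1 = h I1" by auto
    from 2(6)[OF f1(1), of "h I2"] obtain f2 where f2: "additive_on F2 f2" "\<forall>x\<in>F1. f2 x = f1 x" "f2 t2 = h I2" by blast
    from 3(6)[OF f2(1), of "h I3"] obtain f3 where f3: "additive_on F3 f3" "\<forall>x\<in>F2. f3 x = f2 x" "f3 t3 = h I3" by blast
    from 4(6)[OF f3(1), of "h I4"] obtain f4 where f4: "additive_on F4 f4" "\<forall>x\<in>F3. f4 x = f3 x" "f4 t4 = h I4" by blast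
    have "f4 (s i) = h i" for i
      using f1 f2 f3 f4 1(2,3) 2(2,3) 3(2,3) h0 by (cases i) (auto simp: s subset_iff)
    then show "\<exists>f. additive_on F4 f \<and> (\<forall>i. f (s i) = h i)" using f4(1) by blast
  qed
qed

subsection \<open>Word maps and group topologies\<close>

text \<open>Group words in one variable with coefficients in \<open>G\<close>, that is, maps
  continuous in every group topology.\<close>

inductive word_map :: "('a, 'b) monoid_scheme \<Rightarrow> ('a \<Rightarrow> 'a) \<Rightarrow> bool" for G (structure) where
  word_map_const: "c \<in> carrier G \<Longrightarrow> word_map G (\<lambda>_. c)"
| word_map_id: "word_map G (\<lambda>x. x)"
| word_map_mult: "word_map G f \<Longrightarrow> word_map G g \<Longrightarrow> word_map G (\<lambda>x. f x \<otimes> g x)"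
| word_map_inv: "word_map G f \<Longrightarrow> word_map G (\<lambda>x. inv (f x))"

lemma word_map_continuous:
  assumes "group_topology G T" "word_map G f"
  shows "continuous_map T T f"
  using assms(2)
proof (induction rule: word_map.induct)
  case (word_map_const c)
  then show ?case using assms(1) by (simp add: group_topology_def)
next
  case word_map_id
  then show ?case by simp
next
  case (word_map_mult f g)
  have "continuous_map T (prod_topology T T) (\<lambda>x. (f x, g x))"
    using word_map_mult.IH by (simp add: continuous_map_pairwise comp_def)
  from continuous_map_compose[OF this] assms(1) show ?case
    unfolding group_topology_def by (fastforce simp: comp_def)
next
  case (word_map_inv f)
  from continuous_map_compose[OF word_map_inv.IH] assms(1) show ?case
    unfolding group_topology_def by (fastforce simp: comp_def)
qed

text \<open>The zeros of the word maps in \<open>E\<close>, none of which vanishes at \<open>\<one>\<close>, cover \<open>N - {\<one>}\<close>; the word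
  maps in \<open>D\<close> take values in \<open>N\<close> and vanish simultaneously only at \<open>\<one>\<close>.\<close>

locale rigid = group G for G (structure) +
  fixes E D :: "('a \<Rightarrow> 'a) set" and N :: "'a set"
  assumes finE: "finite E" and finD: "finite D"
    and wE: "\<And>f. f \<in> E \<Longrightarrow> word_map G f" and wD: "\<And>f. f \<in> D \<Longrightarrow> word_map G f"
    and E1: "\<And>f. f \<in> E \<Longrightarrow> f \<one> \<noteq> \<one>" and EN: "\<And>x. x \<in> N \<Longrightarrow> x \<noteq> \<one> \<Longrightarrow> \<exists>f\<in>E. f x = \<one>"
    and D1: "\<And>f. f \<in> D \<Longrightarrow> f \<one> = \<one>" and DN: "\<And>f x. f \<in> D \<Longrightarrow> x \<in> carrier G \<Longrightarrow> f x \<in> N"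
    and Dx: "\<And>x. x \<in> carrier G \<Longrightarrow> (\<And>f. f \<in> D \<Longrightarrow> f x = \<one>) \<Longrightarrow> x = \<one>"

lemma (in rigid) discrete:
  assumes T: "group_topology G T" "Hausdorff_space T"
  shows "T = discrete_topology (carrier G)"
proof -
  have top: "topspace T = carrier G" using T(1) by (simp add: group_topology_def)
  have cont: "continuous_map T T f" if "word_map G f" for f
    using word_map_continuous[OF T(1) that] .
  have "closedin T {\<one>\<^bsub>G\<^esub>}" using T(2) top by (simp add: closedin_Hausdorff_singleton)
  then have op: "openin T {x \<in> carrier G. f x \<noteq> \<one>\<^bsub>G\<^esub>}" if f: "word_map G f" for f
  proof -
    have "openin T (topspace T - {x \<in> topspace T. f x \<in> {\<one>\<^bsub>G\<^esub>}})"
      using closedin_continuous_map_preimage[OF cont[OF f] \<open>closedin T {\<one>\<^bsub>G\<^esub>}\<close>] by blast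
    moreover have "topspace T - {x \<in> topspace T. f x \<in> {\<one>\<^bsub>G\<^esub>}} = {x \<in> carrier G. f x \<noteq> \<one>\<^bsub>G\<^esub>}"
      using top by auto
    ultimately show ?thesis by simp
  qed
  have fin_Int: "openin T {x \<in> carrier G. \<forall>f\<in>S. P f x}"
    if "finite S" "\<And>f. f \<in> S \<Longrightarrow> openin T {x \<in> carrier G. P f x}" for S :: "('a \<Rightarrow> 'a) set" and P
    using that
  proof (induction S rule: finite_induct)
    case empty
    then show ?case using openin_topspace[of T] top by simp
  next
    case (insert g S)
    have "{x \<in> carrier G. \<forall>f\<in>insert g S. P f x} = {x \<in> carrier G. P g x} \<inter> {x \<in> carrier G. \<forall>f\<in>S. P f x}" by auto
    then show ?case using insert by (simp add: openin_Int)
  qed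
  define U where "U = {x \<in> carrier G. \<forall>f\<in>E. f x \<noteq> \<one>\<^bsub>G\<^esub>}"
  have U: "openin T U" unfolding U_def using finE op wE by (intro fin_Int) auto
  \<comment> \<open>For \<open>x\<close> in \<open>V\<close> each \<open>f x\<close> lies in
    \<open>N\<close> and in \<open>U\<close>. These meet only in the identity, so all maps in
    \<open>D\<close> vanish at \<open>x\<close> and \<open>x\<close> is the identity.\<close>
  define V where "V = {x \<in> carrier G. \<forall>f\<in>D. f x \<in> U}"
  have V: "openin T V" unfolding V_def
  proof (rule fin_Int[OF finD])
    fix f assume "f \<in> D"
    then have "continuous_map T T f" using cont wD by blast
    from openin_continuous_map_preimage[OF this U] show "openin T {x \<in> carrier G. f x \<in> U}" using top by simp
  qed
  have "V = {\<one>\<^bsub>G\<^esub>}"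
  proof
    show "V \<subseteq> {\<one>\<^bsub>G\<^esub>}"
    proof
      fix x assume x: "x \<in> V"
      have "f x = \<one>\<^bsub>G\<^esub>" if "f \<in> D" for f
        using EN[of "f x"] DN[OF that] x that unfolding V_def U_def by blast
      then show "x \<in> {\<one>\<^bsub>G\<^esub>}" using Dx x by (auto simp: V_def)
    qed
    have "\<one>\<^bsub>G\<^esub> \<in> U" using E1 by (auto simp: U_def)
    then have "f \<one>\<^bsub>G\<^esub> \<in> U" if "f \<in> D" for f using D1[OF that] by simp
    then show "{\<one>\<^bsub>G\<^esub>} \<subseteq> V" by (auto simp: V_def)
  qed
  then have one: "openin T {\<one>\<^bsub>G\<^esub>}" using V by simp
  have "openin T {a}" if a: "a \<in> carrier G" for a
  proof -
    have "word_map G (\<lambda>x. inv\<^bsub>G\<^esub> a \<otimes>\<^bsub>G\<^esub> x)" using a by (intro word_map.intros) simp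
    from openin_continuous_map_preimage[OF cont[OF this] one]
    have "openin T {x \<in> carrier G. inv\<^bsub>G\<^esub> a \<otimes>\<^bsub>G\<^esub> x = \<one>\<^bsub>G\<^esub>}" using top by simp
    moreover have "{x \<in> carrier G. inv\<^bsub>G\<^esub> a \<otimes>\<^bsub>G\<^esub> x = \<one>\<^bsub>G\<^esub>} = {a}"
    proof (intro equalityI subsetI)
      fix x assume "x \<in> {x \<in> carrier G. inv\<^bsub>G\<^esub> a \<otimes>\<^bsub>G\<^esub> x = \<one>\<^bsub>G\<^esub>}"
      then have x: "x \<in> carrier G" "inv\<^bsub>G\<^esub> a \<otimes>\<^bsub>G\<^esub> x = \<one>\<^bsub>G\<^esub>" by auto
      have "x = a \<otimes>\<^bsub>G\<^esub> (inv\<^bsub>G\<^esub> a \<otimes>\<^bsub>G\<^esub> x)" using a x(1) by (simp add: m_assoc[symmetric])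
      then show "x \<in> {a}" using a x(2) by simp
    qed (use a in auto)
    ultimately show ?thesis by simp
  qed
  then show ?thesis using top discrete_topology_unique[of "carrier G" T] by simp
qed

text \<open>The pullback of a Hausdorff group topology along an isomorphism is one as well, hence
  discrete, and its open singletons are carried back by bijectivity.\<close>

lemma discrete_iso:
  assumes G: "group G" and H: "group H" and h: "h \<in> iso G H" and T: "group_topology H T" "Hausdorff_space T"
    and discrete: "\<And>T'. group_topology G T' \<Longrightarrow> Hausdorff_space T' \<Longrightarrow> T' = discrete_topology (carrier G)"
  shows "T = discrete_topology (carrier H)"
proof -
  interpret group_hom G H h using G H h by (simp add: group_hom_def group_hom_axioms_def iso_def)
  have bij: "bij_betw h (carrier G) (carrier H)" using h by (simp add: iso_def)
  have top: "topspace T = carrier H" using T(1) by (simp add: group_topology_def)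
  define P where "P = pullback_topology (carrier G) h T"
  have topP: "topspace P = carrier G" by (auto simp: P_def topspace_pullback_topology top)
  have hP: "continuous_map P T h"
    unfolding P_def using continuous_map_pullback[of T T "\<lambda>x. x"] by (simp add: comp_def)
  have lift: "continuous_map X P f" if "continuous_map X T (\<lambda>x. h (f x))" "f ` topspace X \<subseteq> carrier G" for X f
    unfolding P_def using that by (intro continuous_map_pullback') (auto simp: comp_def)
  have "group_topology G P"
    unfolding group_topology_def
  proof (intro conjI topP lift)
    let ?PP = "prod_topology P P"
    have "continuous_map ?PP (prod_topology T T) (\<lambda>z. (h (fst z), h (snd z)))"
      using continuous_map_compose[OF continuous_map_fst[of P P] hP] continuous_map_compose[OF continuous_map_snd[of P P] hP]
      by (simp add: continuous_map_pairwise comp_def)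
    moreover have "continuous_map (prod_topology T T) T (\<lambda>(x, y). x \<otimes>\<^bsub>H\<^esub> y)" using T(1) by (simp add: group_topology_def)
    ultimately have "continuous_map ?PP T (\<lambda>z. h (fst z) \<otimes>\<^bsub>H\<^esub> h (snd z))"
      by (drule_tac continuous_map_compose) (auto simp: comp_def)
    then show "continuous_map ?PP T (\<lambda>z. h (case z of (x, y) \<Rightarrow> x \<otimes>\<^bsub>G\<^esub> y))"
      by (rule continuous_map_eq) (auto simp: topP)
    have "continuous_map T T (\<lambda>x. inv\<^bsub>H\<^esub> x)" using T(1) by (simp add: group_topology_def)
    from continuous_map_compose[OF hP this] show "continuous_map P T (\<lambda>x. h (inv\<^bsub>G\<^esub> x))"
      by (rule continuous_map_eq) (auto simp: topP)
  qed (auto simp: topP)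
  moreover have "Hausdorff_space P"
    using Hausdorff_space_injective_preimage[OF T(2) hP] bij by (simp add: topP bij_betw_def)
  ultimately have P: "P = discrete_topology (carrier G)" by (rule discrete)
  have "openin T {y}" if y: "y \<in> carrier H" for y
  proof -
    obtain x where x: "x \<in> carrier G" "y = h x" using y bij by (auto simp: bij_betw_def)
    have "openin P {x}" using x by (simp add: P)
    then obtain U where U: "openin T U" "{x} = h -` U \<inter> carrier G" by (auto simp: P_def openin_pullback_topology)
    then have "U \<subseteq> h ` carrier G" using openin_subset[OF U(1)] bij top by (simp add: bij_betw_def)
    then have "U = h ` {x}" unfolding U(2) by blast
    then have "U = {y}" using x(2) by simp
    then show ?thesis using U(1) by simp
  qed
  then show ?thesis using top discrete_topology_unique[of "carrier H" T] by simp
qed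

lemma nat_copy:
  fixes G :: "'a monoid"
  assumes G: "group G" and "countable (carrier G)"
  obtains H :: "nat monoid" and h where "group H" "h \<in> iso G H"
proof -
  interpret group G by fact
  define h where "h = to_nat_on (carrier G)"
  have inj: "inj_on h (carrier G)" unfolding h_def using assms(2) by (rule inj_on_to_nat_on)
  define k where "k = inv_into (carrier G) h"
  have kh: "k (h x) = x" if "x \<in> carrier G" for x using that inj by (simp add: k_def)
  define H where "H = \<lparr>carrier = h ` carrier G, mult = (\<lambda>x y. h (k x \<otimes>\<^bsub>G\<^esub> k y)), one = h \<one>\<^bsub>G\<^esub>\<rparr>"
  have "group H"
  proof (rule groupI)
    show "\<exists>y\<in>carrier H. y \<otimes>\<^bsub>H\<^esub> x = \<one>\<^bsub>H\<^esub>" if "x \<in> carrier H" for x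
    proof -
      obtain a where "a \<in> carrier G" "x = h a" using \<open>x \<in> carrier H\<close> by (auto simp: H_def)
      then show ?thesis by (intro bexI[of _ "h (inv\<^bsub>G\<^esub> a)"]) (auto simp: H_def kh)
    qed
  qed (auto simp: H_def kh m_assoc)
  moreover have "h \<in> iso G H"
    using inj by (auto simp: iso_def hom_def H_def kh bij_betw_def)
  ultimately show thesis by (rule that)
qed

lemma torsion_free_iso:
  assumes G: "group G" and H: "group H" and h: "h \<in> iso G H" and "torsion_free G"
  shows "torsion_free H"
  unfolding torsion_free_def
proof (intro ballI allI impI)
  interpret group_hom G H h using G H h by (simp add: group_hom_def group_hom_axioms_def iso_def)
  fix y n assume y: "y \<in> carrier H" "0 < (n::nat)" "y [^]\<^bsub>H\<^esub> n = \<one>\<^bsub>H\<^esub>"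
  have bij: "bij_betw h (carrier G) (carrier H)" using h by (simp add: iso_def)
  obtain x where x: "x \<in> carrier G" "y = h x" using y(1) bij by (auto simp: bij_betw_def)
  have "h (x [^]\<^bsub>G\<^esub> n) = h \<one>\<^bsub>G\<^esub>" using x y(3) by (simp add: hom_nat_pow)
  then have "x [^]\<^bsub>G\<^esub> n = \<one>\<^bsub>G\<^esub>"
    by (rule inj_onD[OF bij_betw_imp_inj_on[OF bij]]) (use x in auto)
  then have "x = \<one>\<^bsub>G\<^esub>" using assms(4) x(1) y(2) by (auto simp: torsion_free_def)
  then show "y = \<one>\<^bsub>H\<^esub>" using x(2) by simp
qed

subsection \<open>Semidirect products\<close>

locale semidirect =
  fixes K :: "'k::group_add set" and F :: "'f::group_add set" and \<rho> :: "'f \<Rightarrow> 'k sym"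
  assumes K: "is_subgroup K" and F: "is_subgroup F" and \<rho>: "additive_on F \<rho>"
    and \<rho>K: "\<And>v k. v \<in> F \<Longrightarrow> k \<in> K \<Longrightarrow> app (\<rho> v) k \<in> K"
    and \<rho>add: "\<And>v. v \<in> F \<Longrightarrow> additive_on K (app (\<rho> v))"
begin

definition sd :: "('k \<times> 'f) monoid" where
  "sd = \<lparr>carrier = K \<times> F, mult = (\<lambda>(k, v) (l, w). (k + app (\<rho> v) l, v + w)), one = (0, 0)\<rparr>"

lemma sd_simps [simp]:
  "carrier sd = K \<times> F" "\<one>\<^bsub>sd\<^esub> = (0, 0)" "(k, v) \<otimes>\<^bsub>sd\<^esub> (l, w) = (k + app (\<rho> v) l, v + w)"
  by (simp_all add: sd_def)

lemma \<rho>0 [simp]: "\<rho> 0 = 0"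
  using additive_on_zero[OF F \<rho>] .

lemma \<rho>z: "v \<in> F \<Longrightarrow> app (\<rho> v) 0 = 0"
  using additive_on_zero[OF K \<rho>add] .

lemma group_sd: "group sd"
proof (rule groupI)
  show "\<one>\<^bsub>sd\<^esub> \<in> carrier sd" using K F by (simp add: subgroup_zero)
  fix x assume "x \<in> carrier sd"
  then obtain k v where x: "x = (k, v)" "k \<in> K" "v \<in> F" by auto
  show "\<one>\<^bsub>sd\<^esub> \<otimes>\<^bsub>sd\<^esub> x = x" using x by simp
  have "app (\<rho> (- v)) k \<in> K" using x F \<rho>K by (simp add: subgroup_uminus)
  then show "\<exists>y\<in>carrier sd. y \<otimes>\<^bsub>sd\<^esub> x = \<one>\<^bsub>sd\<^esub>"
    using x K F by (intro bexI[of _ "(- app (\<rho> (- v)) k, - v)"]) (auto simp: subgroup_uminus)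
  fix y assume "y \<in> carrier sd"
  then obtain l w where y: "y = (l, w)" "l \<in> K" "w \<in> F" by auto
  show "x \<otimes>\<^bsub>sd\<^esub> y \<in> carrier sd" using x y K F \<rho>K by (simp add: subgroup_add)
  fix z assume "z \<in> carrier sd"
  then obtain m t where z: "z = (m, t)" "m \<in> K" "t \<in> F" by auto
  show "x \<otimes>\<^bsub>sd\<^esub> y \<otimes>\<^bsub>sd\<^esub> z = x \<otimes>\<^bsub>sd\<^esub> (y \<otimes>\<^bsub>sd\<^esub> z)"
    using x y z \<rho> \<rho>K by (simp add: additive_on_add additive_on_add[OF \<rho>add] add.assoc)
qed

lemma inv_sd: "k \<in> K \<Longrightarrow> v \<in> F \<Longrightarrow> inv\<^bsub>sd\<^esub> (k, v) = (- app (\<rho> (- v)) k, - v)"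
  using K F \<rho>K by (intro group.inv_equality[OF group_sd]) (auto simp: subgroup_uminus)

lemma torsion_free_sd:
  assumes "torsion_free_on K" "torsion_free_on F"
  shows "torsion_free sd"
  unfolding torsion_free_def
proof (intro ballI allI impI)
  fix x n assume "x \<in> carrier sd" and n: "0 < (n::nat)" "x [^]\<^bsub>sd\<^esub> n = \<one>\<^bsub>sd\<^esub>"
  then obtain k v where x: "x = (k, v)" "k \<in> K" "v \<in> F" by auto
  have "snd (x [^]\<^bsub>sd\<^esub> m) = nmul m v" for m :: nat
  proof (induction m)
    case (Suc m)
    then show ?case by (cases "x [^]\<^bsub>sd\<^esub> m") (simp add: x nmul_Suc_right)
  qed simp
  then have "nmul n v = 0" using n(2) by (metis sd_simps(2) snd_conv)
  then have v: "v = 0" using assms(2) x n(1) by (auto simp: torsion_free_on_def)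
  have "x [^]\<^bsub>sd\<^esub> m = (nmul m k, 0)" for m :: nat
    by (induction m) (simp_all add: x v nmul_Suc_right)
  then have "nmul n k = 0" using n(2) by simp
  then show "x = \<one>\<^bsub>sd\<^esub>" using assms(1) x v n(1) by (auto simp: torsion_free_on_def)
qed

end

lemma rigid_group_exists:
  obtains G :: "(nat sym \<times> nat sym) monoid" and E D N where "countable (carrier G)" "torsion_free G" "rigid G E D N"
    "carrier G \<noteq> {\<one>\<^bsub>G\<^esub>}"
proof -
  obtain F :: "nat sym set" and s :: "idx \<Rightarrow> nat sym" where Fs: "is_subgroup F" "countable F" "torsion_free_on F"
    and s0: "s I0 = 0" and sF: "\<And>i. s i \<in> F" and gen: "\<And>S. is_subgroup S \<Longrightarrow> (\<And>i. s i \<in> S) \<Longrightarrow> F \<subseteq> S"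
    and ext: "\<And>h :: idx \<Rightarrow> nat sym sym. h I0 = 0 \<Longrightarrow> \<exists>f. additive_on F f \<and> (\<forall>i. f (s i) = h i)"
    using free_group_exists[where 'h = "nat sym sym"] by blast
  obtain K u e \<Theta> \<phi> where "total_stage s K u e \<Theta> \<phi>" by (rule total_stage_exists)
  then interpret T: total_stage s K u e \<Theta> \<phi> .
  note Ks = T.K T.countable_K T.torsion_free_K and u = T.u and e = T.e and T = T.T and TK = T.TK and surj = T.surj
    and law = T.law and \<phi> = T.\<phi> and \<phi>s = T.\<phi>s and \<phi>e = T.\<phi>e and cent = T.cent
  obtain q :: "idx \<Rightarrow> nat sym sym" where q: "\<And>\<theta> i. \<theta> \<in> \<Theta> \<Longrightarrow> app (q i) (\<theta> I0) = \<theta> i" "q I0 = 0"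
    using T.automorphism_exists by blast
  obtain \<rho> where \<rho>s: "additive_on F \<rho>" "\<And>i. \<rho> (s i) = q i" using ext[of q, OF q(2)] by blast
  \<comment> \<open>The properties of \<open>\<rho>\<close> are known only at the generators
    \<open>s i\<close>; as the elements having them form a subgroup, they hold on all of
    \<open>F\<close>. Asking for \<open>K\<close> to be mapped onto itself, rather than into itself,
    makes the set closed under negation.\<close>
  define S where "S = {v \<in> F. app (\<rho> v) ` K = K \<and> additive_on K (app (\<rho> v)) \<and> (\<forall>k\<in>K. \<phi> (app (\<rho> v) k) = shift v (\<phi> k))}"
  have S: "is_subgroup S"
    unfolding is_subgroup_def
  proof (intro conjI ballI)
    have "\<rho> 0 = 0" using additive_on_zero[OF Fs(1) \<rho>s(1)] .
    then show "0 \<in> S" using subgroup_zero[OF Fs(1)] by (simp add: S_def additive_on_def)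
    show "v + w \<in> S" if "v \<in> S" "w \<in> S" for v w
    proof -
      have v: "v \<in> F" "app (\<rho> v) ` K = K" "additive_on K (app (\<rho> v))" "\<forall>k\<in>K. \<phi> (app (\<rho> v) k) = shift v (\<phi> k)"
        and w: "w \<in> F" "app (\<rho> w) ` K = K" "additive_on K (app (\<rho> w))" "\<forall>k\<in>K. \<phi> (app (\<rho> w) k) = shift w (\<phi> k)"
        using \<open>v \<in> S\<close> \<open>w \<in> S\<close> by (auto simp: S_def)
      have r: "app (\<rho> (v + w)) = app (\<rho> v) \<circ> app (\<rho> w)"
        using additive_on_add[OF \<rho>s(1) v(1) w(1)] by (simp add: fun_eq_iff)
      have "app (\<rho> w) k \<in> K" if "k \<in> K" for k using w(2) that by blast
      moreover have "(app (\<rho> v) \<circ> app (\<rho> w)) ` K = K" using v(2) w(2) by (metis image_comp)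
      moreover have "additive_on K (app (\<rho> v) \<circ> app (\<rho> w))"
        using additive_on_comp[OF w(3)] v(3) w(2) by simp
      ultimately show ?thesis using v w Fs(1) unfolding S_def mem_Collect_eq r
        by (simp add: subgroup_add shift_add)
    qed
    show "- v \<in> S" if "v \<in> S" for v
    proof -
      have v: "v \<in> F" "app (\<rho> v) ` K = K" "additive_on K (app (\<rho> v))" "\<forall>k\<in>K. \<phi> (app (\<rho> v) k) = shift v (\<phi> k)"
        using \<open>v \<in> S\<close> by (auto simp: S_def)
      have r: "\<rho> (- v) = - \<rho> v" using additive_on_uminus[OF Fs(1) \<rho>s(1) v(1)] .
      have "(app (- \<rho> v) \<circ> app (\<rho> v)) ` K = K" by (simp add: comp_def)
      then have 1: "app (- \<rho> v) ` K = K" using v(2) by (metis image_comp)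
      have 2: "additive_on K (app (- \<rho> v))"
        unfolding additive_on_def
      proof (intro ballI)
        fix x y assume xy: "x \<in> K" "y \<in> K"
        then have m: "app (- \<rho> v) x \<in> K" "app (- \<rho> v) y \<in> K" using 1 by blast+
        have "x + y = app (\<rho> v) (app (- \<rho> v) x + app (- \<rho> v) y)"
          using additive_on_add[OF v(3) m] by simp
        then show "app (- \<rho> v) (x + y) = app (- \<rho> v) x + app (- \<rho> v) y" by simp
      qed
      have 3: "\<phi> (app (- \<rho> v) k) = shift (- v) (\<phi> k)" if "k \<in> K" for k
      proof -
        have "app (- \<rho> v) k \<in> K" using 1 that by blast
        then have "\<phi> k = shift v (\<phi> (app (- \<rho> v) k))" using v(4) by (metis app_uminus(2))
        then show ?thesis by (simp add: shift_add)
      qed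
      show ?thesis using v(1) 1 2 3 Fs(1) by (simp add: S_def r subgroup_uminus)
    qed
  qed
  have "s i \<in> S" for i
  proof -
    have ap: "app (q i) k \<in> K \<and> \<phi> (app (q i) k) = shift (s i) (\<phi> k)" if k: "k \<in> K" for k
    proof -
      obtain \<theta> where "\<theta> \<in> \<Theta>" "\<theta> I0 = k" using surj[OF k] by blast
      then show ?thesis using q(1)[of \<theta> i] TK[of \<theta> i] \<phi>s[of \<theta> i I0] s0 by simp
    qed
    have "app (q i) ` K = K"
    proof (intro equalityI subsetI)
      fix k assume "k \<in> K"
      then obtain \<theta> where "\<theta> \<in> \<Theta>" "\<theta> i = k" using surj by blast
      then show "k \<in> app (q i) ` K" using q(1)[of \<theta> i] TK[of \<theta> I0] by (metis imageI)
    qed (use ap in auto)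
    moreover have "additive_on K (app (q i))"
      unfolding additive_on_def
    proof (intro ballI)
      fix x y assume "x \<in> K" "y \<in> K"
      then obtain \<theta> \<eta> where "\<theta> \<in> \<Theta>" "\<theta> I0 = x" "\<eta> \<in> \<Theta>" "\<eta> I0 = y" using surj by metis
      then show "app (q i) (x + y) = app (q i) x + app (q i) y"
        using q(1)[of "\<theta> + \<eta>" i] q(1)[of \<theta> i] q(1)[of \<eta> i] T by (simp add: subgroup_add)
    qed
    ultimately show ?thesis using sF ap by (simp add: S_def \<rho>s(2))
  qed
  then have FS: "v \<in> S" if "v \<in> F" for v using gen[OF S] that by blast
  interpret semidirect K F \<rho>
    using Ks(1) Fs(1) \<rho>s(1) FS by unfold_locales (auto simp: S_def)
  interpret G: group sd by (rule group_sd)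
  have z: "0 \<in> K" "0 \<in> F" using K F by (simp_all add: subgroup_zero)
  have mK: "- k \<in> K" if "k \<in> K" for k using that K by (simp add: subgroup_uminus)
  have pwK: "k + l \<in> K" if "k \<in> K" "l \<in> K" for k l using that K by (simp add: subgroup_add)
  \<comment> \<open>Conjugation by \<open>(0, s i)\<close> induces \<open>q i\<close> on the normal
    subgroup \<open>K \<times> {0}\<close>. In this way the coordinates of a tuple become words in
    its element at \<open>I0\<close>, and \<open>eq\<close> is the quotient of the two sides of the
    law.\<close>
  define cj where "cj i x = (0, s i) \<otimes>\<^bsub>sd\<^esub> x \<otimes>\<^bsub>sd\<^esub> inv\<^bsub>sd\<^esub> (0, s i)" for i x
  define pr where "pr x y = x \<otimes>\<^bsub>sd\<^esub> y \<otimes>\<^bsub>sd\<^esub> x \<otimes>\<^bsub>sd\<^esub> y \<otimes>\<^bsub>sd\<^esub> (x \<otimes>\<^bsub>sd\<^esub> y \<otimes>\<^bsub>sd\<^esub> x \<otimes>\<^bsub>sd\<^esub> y)" for x y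
  define eq where "eq = (\<lambda>(a, b, c, d) x. pr (cj a x) (cj b x) \<otimes>\<^bsub>sd\<^esub> inv\<^bsub>sd\<^esub> ((u, 0) \<otimes>\<^bsub>sd\<^esub> pr (cj c x) (cj d x)))"
  define cm where "cm c x = x \<otimes>\<^bsub>sd\<^esub> (c, 0) \<otimes>\<^bsub>sd\<^esub> inv\<^bsub>sd\<^esub> x \<otimes>\<^bsub>sd\<^esub> inv\<^bsub>sd\<^esub> (c, 0)" for c x
  obtain \<theta> where \<theta>: "\<theta> \<in> \<Theta>" "\<theta> I0 = e" using surj[OF e] by blast
  have \<theta>1: "\<theta> I1 \<in> K" using TK \<theta> by blast
  have cjK: "cj i (k, 0) = (app (q i) k, 0)" if "k \<in> K" for i k
    using that z sF Fs(1) by (simp add: cj_def inv_sd \<rho>z subgroup_uminus \<rho>s(2)[symmetric])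
  have prK: "pr (k, 0) (l, 0) = (pw k l, 0)" for k l by (simp add: pr_def pw_def add.assoc)
  have qK: "app (q i) k \<in> K" if "k \<in> K" for i k using \<rho>K[OF sF that] by (simp add: \<rho>s(2))
  have pwKK: "pw k l \<in> K" if "k \<in> K" "l \<in> K" for k l using that pwK by (simp add: pw_def)
  have "rigid sd (range eq) (cm ` {e, \<theta> I1}) (K \<times> {0})"
  proof (intro rigid.intro group_sd rigid_axioms.intro)
    have "UNIV = {I0, I1, I2, I3, I4}" by (auto intro: idx.exhaust)
    then have "finite (UNIV :: idx set)" by (metis finite.emptyI finite.insertI)
    then have "finite (UNIV :: (idx \<times> idx \<times> idx \<times> idx) set)" by (simp add: finite_prod)
    then show "finite (range eq)" by simp
    show "finite (cm ` {e, \<theta> I1})" by simp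
    have wc: "word_map sd (cj i)" for i
      unfolding cj_def[abs_def] using z sF by (intro word_map.intros) auto
    have wp: "word_map sd (\<lambda>x. pr (f x) (g x))" if "word_map sd f" "word_map sd g" for f g
      unfolding pr_def using that by (intro word_map.intros)
    have we: "word_map sd (eq p)" for p
      unfolding eq_def using u z by (cases p) (auto intro!: word_map.intros wp wc)
    have "word_map sd (cm c)" if "c \<in> K" for c
      unfolding cm_def[abs_def] using that z by (intro word_map.intros) auto
    then show "word_map sd f" if "f \<in> cm ` {e, \<theta> I1}" for f using that e \<theta>1 by auto
    show "word_map sd f" if "f \<in> range eq" for f using that we by auto
    have eqK: "eq (a, b, c, d) (k, 0) = (pw (app (q a) k) (app (q b) k) + - (u + pw (app (q c) k) (app (q d) k)), 0)"
      if "k \<in> K" for a b c d k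
      using that u qK pwK pwKK z by (simp add: eq_def cjK prK inv_sd)
    show "f \<one>\<^bsub>sd\<^esub> \<noteq> \<one>\<^bsub>sd\<^esub>" if "f \<in> range eq" for f
    proof -
      obtain a b c d where f: "f = eq (a, b, c, d)" using \<open>f \<in> range eq\<close> by auto
      have "app (q i) 0 = 0" for i using \<rho>z[OF sF] by (simp add: \<rho>s(2))
      then show ?thesis using eqK[OF z(1), of a b c d] u(2) by (simp add: f pw_def)
    qed
    show "\<exists>f\<in>range eq. f x = \<one>\<^bsub>sd\<^esub>" if "x \<in> K \<times> {0}" "x \<noteq> \<one>\<^bsub>sd\<^esub>" for x
    proof -
      obtain k where k: "x = (k, 0)" "k \<in> K" "k \<noteq> 0" using \<open>x \<in> _\<close> \<open>x \<noteq> _\<close> by auto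
      obtain \<eta> where \<eta>: "\<eta> \<in> \<Theta>" "\<eta> I0 = k" using surj[OF k(2)] by blast
      then have "\<eta> \<noteq> 0" using k(3) by auto
      then obtain a b c d where "pw (\<eta> a) (\<eta> b) = u + pw (\<eta> c) (\<eta> d)" using law[OF \<eta>(1)] by (auto simp: law_def)
      then have "eq (a, b, c, d) x = \<one>\<^bsub>sd\<^esub>" using eqK[OF k(2)] q(1)[OF \<eta>(1)] \<eta>(2) k(1) by auto
      then show ?thesis by blast
    qed
    have cmx: "cm c (k, v) = (k + app (\<rho> v) c + - k + - c, 0)" if "c \<in> K" "k \<in> K" "v \<in> F" for c k v
    proof -
      have "app (- \<rho> v) k \<in> K"
        using \<rho>K[of "- v" k] that Fs(1) additive_on_uminus[OF Fs(1) \<rho>] by (simp add: subgroup_uminus)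
      then show ?thesis
        using that z Fs(1) \<rho>K additive_on_uminus[OF Ks(1) \<rho>add] additive_on_uminus[OF Fs(1) \<rho>]
        by (simp add: cm_def inv_sd subgroup_uminus)
    qed
    show "f \<one>\<^bsub>sd\<^esub> = \<one>\<^bsub>sd\<^esub>" if "f \<in> cm ` {e, \<theta> I1}" for f using that cmx[OF _ z] e \<theta>1 by auto
    show "f x \<in> K \<times> {0}" if "f \<in> cm ` {e, \<theta> I1}" "x \<in> carrier sd" for f x
      using that cmx e \<theta>1 pwK mK \<rho>K by (cases x) auto
    show "x = \<one>\<^bsub>sd\<^esub>" if x: "x \<in> carrier sd" "\<And>f. f \<in> cm ` {e, \<theta> I1} \<Longrightarrow> f x = \<one>\<^bsub>sd\<^esub>" for x
    proof -
      obtain k v where kv: "x = (k, v)" "k \<in> K" "v \<in> F" using x(1) by auto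
      have c0: "k + app (\<rho> v) c + - k = c" if "c \<in> {e, \<theta> I1}" for c
      proof -
        have "cm c x = \<one>\<^bsub>sd\<^esub>" "c \<in> K" using x(2) that e \<theta>1 by auto
        then have "k + app (\<rho> v) c + - k + - c = 0" using cmx[of c k v] kv by simp
        then show ?thesis by (simp only: add_eq_0_iff2 minus_minus)
      qed
      have re: "app (\<rho> v) e \<in> K" using \<rho>K kv e by blast
      \<comment> \<open>The target of \<open>\<phi>\<close> is commutative, so conjugation by
        \<open>k\<close> is invisible to it, and the delta function of \<open>e\<close> is invariant
        under translation by \<open>v\<close>. Evaluation at \<open>v\<close> compares
        \<open>\<phi> e v\<close> with \<open>\<phi> e 0\<close>, which is one, so \<open>v\<close>
        is zero.\<close>
      have "\<phi> e = \<phi> (k + app (\<rho> v) e + - k)" using c0[of e] by simp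
      also have "\<dots> = \<phi> (app (\<rho> v) e)"
        using kv re mK pwK by (simp add: additive_on_add[OF \<phi>] additive_on_uminus[OF Ks(1) \<phi>])
      also have "\<dots> = shift v (\<phi> e)" using FS[OF kv(3)] e by (simp add: S_def)
      finally have "\<phi> e v = shift v (\<phi> e) v" by simp
      then have v: "v = 0" by (simp add: shift_def \<phi>e split: if_splits)
      have "k = 0" using cent[OF \<theta> kv(2)] c0[of e] c0[of "\<theta> I1"] v by simp
      then show ?thesis using kv v by simp
    qed
  qed
  moreover have "carrier sd \<noteq> {\<one>\<^bsub>sd\<^esub>}"
  proof -
    have "(u, 0) \<in> carrier sd" using u z by simp
    then show ?thesis using u(2) by auto
  qed
  ultimately show thesis using that[of sd] Ks Fs torsion_free_sd by simp
qed

(* Every countable group is isomorphic to one whose carrier is a set of natural numbers,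
   so fixing the element type nat loses no generality. *)
theorem mainTheorem2:
  shows "\<exists>G :: nat monoid.
           group G \<and> carrier G \<noteq> {\<one>\<^bsub>G\<^esub>} \<and> countable (carrier G) \<and> torsion_free G \<and>
           \<not> (\<exists>T. group_topology G T \<and> Hausdorff_space T \<and> T \<noteq> discrete_topology (carrier G))"
proof -
  obtain S :: "(nat sym \<times> nat sym) monoid" and E D N where S: "countable (carrier S)" "torsion_free S"
    "rigid S E D N" "carrier S \<noteq> {\<one>\<^bsub>S\<^esub>}" by (rule rigid_group_exists)
  have gS: "group S" using S(3) by (simp add: rigid_def)
  obtain G :: "nat monoid" and h where G: "group G" "h \<in> iso S G" using nat_copy[OF gS S(1)] .
  interpret group_hom S G h using gS G by (simp add: group_hom_def group_hom_axioms_def iso_def)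
  have "carrier G \<noteq> {\<one>\<^bsub>G\<^esub>}"
  proof
    assume "carrier G = {\<one>\<^bsub>G\<^esub>}"
    moreover have "bij_betw h (carrier S) (carrier G)" using G(2) by (simp add: iso_def)
    ultimately have "x = \<one>\<^bsub>S\<^esub>" if "x \<in> carrier S" for x
      using that by (metis bij_betw_def imageI inj_on_eq_iff singletonD G.one_closed hom_one)
    then show False using S(4) G.one_closed by blast
  qed
  then show ?thesis
    using G(1) torsion_free_iso[OF gS G S(2)] discrete_iso[OF gS G _ _ rigid.discrete[OF S(3)]]
    by (intro exI[of _ G]) auto
qed

end
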